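(* Let $s,r\in\mathbb{R}$. If $s\le0$ or $r\le\frac12$ or $r<s$ or $r>1+s$ or $r>\frac12+2s$, then for all $\sigma,\rho\in\mathbb{R}$ and $\varepsilon>0$, at least one of the following two estimates fails: $$ \text{(i)}\quad \left\|\langle\beta P_{[\pm]}(D_x)\psi,\,P_{\pm}(D_x)\psi'\rangle\right\|_{H^{-r,-\rho}}\lesssim\|\psi\|_{X^{s,\sigma}_{[\pm]}}\,\|\psi'\|_{X^{-s,1-\sigma-\varepsilon}_{\pm}}, $$ $$ \text{(ii)}\quad \left\|\langle\beta P_{[\pm]}(D_x)\psi,\,P_{\pm}(D_x)\psi'\rangle\right\|_{H^{r-1,\rho-1+\varepsilon}}\lesssim\|\psi\|_{X^{s,\sigma}_{[\pm]}}\,\|\psi'\|_{X^{s,\sigma}_{\pm}}, $$ where each estimate is understood to be required for all $\psi,\psi'\in\mathcal{S}(\mathbb{R}^{1+3})$ (with values in $\mathbb{C}^4$) and all choices of the independent signs $\pm$ and $[\pm]$.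
   Context: Write $\langle\cdot\rangle=1+|\cdot|$ for scalars and vectors, and $\langle u,v\rangle=v^\dagger u$ for $u,v\in\mathbb{C}^4$. The space-time Fourier transform is $\widetilde u(\tau,\xi)=\int_{\mathbb{R}^{1+3}}e^{-i(t\tau+x\cdot\xi)}u(t,x)\,dt\,dx$. For $a,b\in\mathbb{R}$, $X^{a,b}_\pm$ and $H^{a,b}$ are the completions of $\mathcal{S}(\mathbb{R}^{1+3})$ with respect to $$\|u\|_{X^{a,b}_\pm}=\left\|\langle\xi\rangle^a\langle\tau\pm|\xi|\rangle^b\,\widetilde u(\tau,\xi)\right\|_{L^2_{\tau,\xi}},\qquad \|u\|_{H^{a,b}}=\left\|\langle\xi\rangle^a\langle|\tau|-|\xi|\rangle^b\,\widetilde u(\tau,\xi)\right\|_{L^2_{\tau,\xi}}.$$ The Dirac matrices are $\beta=\begin{pmatrix}I&0\\0&-I\end{pmatrix}$, $\alpha^j=\begin{pmatrix}0&\sigma^j\\ \sigma^j&0\end{pmatrix}$ ($2\times2$ blocks) with Pauli matrices $\sigma^1=\begin{pmatrix}0&1\\1&0\end{pmatrix}$, $\sigma^2=\begin{pmatrix}0&-i\\ i&0\end{pmatrix}$, $\sigma^3=\begin{pmatrix}1&0\\0&-1\end{pmatrix}$. The projections are $P_\pm(\xi)=\frac12\left(I\pm\hat\xi\cdot\alpha\right)$ with $\hat\xi=\xi/|\xi|$ and $\hat\xi\cdot\alpha=\sum_j\hat\xi_j\alpha^j$; $P_\pm(D_x)$ is the Fourier multiplier in $x$ with symbol $P_\pm(\xi)$.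 The symbol $\lesssim$ means $\le$ up to a positive constant independent of $\psi,\psi'$. *)

theory Defs
  imports "HOL-Analysis.Analysis"
begin

section \<open>Schwartz functions\<close>

text \<open>\<open>iter_partial [v\<^sub>1, \<dots>, v\<^sub>k] f\<close> is \<open>\<partial>\<^bsub>v\<^sub>1\<^esub> \<dots> \<partial>\<^bsub>v\<^sub>k\<^esub> f\<close>.\<close>

primrec iter_partial ::
    "'a list \<Rightarrow> ('a::euclidean_space \<Rightarrow> 'b::real_normed_vector) \<Rightarrow> 'a \<Rightarrow> 'b" where
  "iter_partial [] f = f"
| "iter_partial (v # vs) f = (\<lambda>x. frechet_derivative (iter_partial vs f) (at x) v)"

text \<open>Differentiability of all iterated partial derivatives is smoothness; in particular the
  Frechet derivatives in \<^const>\<open>iter_partial\<close> are never junk values here.\<close>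

definition schwartz :: "('a::euclidean_space \<Rightarrow> 'b::real_normed_vector) \<Rightarrow> bool" where
  "schwartz f \<longleftrightarrow>
     (\<forall>vs. set vs \<subseteq> Basis \<longrightarrow>
        (\<forall>x. iter_partial vs f differentiable (at x)) \<and>
        (\<forall>N::nat. bounded (range (\<lambda>x. (1 + norm x) ^ N *\<^sub>R iter_partial vs f x))))"

section \<open>Fourier transforms and norms\<close>

type_synonym spacetime = "real \<times> (real^3)"
type_synonym spinor = "complex^4"

definition jbr :: "'a::real_normed_vector \<Rightarrow> real" where
  "jbr x = 1 + norm x"

definition st_fourier :: "(spacetime \<Rightarrow> complex) \<Rightarrow> spacetime \<Rightarrow> complex" where
  "st_fourier u = (\<lambda>(\<tau>, \<xi>). \<integral>(t, x). exp (- (\<i> * of_real (t * \<tau> + x \<bullet> \<xi>))) * u (t, x) \<partial>lborel)"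

definition st_fourier_spinor :: "(spacetime \<Rightarrow> spinor) \<Rightarrow> spacetime \<Rightarrow> spinor" where
  "st_fourier_spinor u = (\<lambda>\<zeta>. \<chi> k. st_fourier (\<lambda>z. u z $ k) \<zeta>)"

text \<open>The \<open>L\<^sup>2\<close> norm takes values in \<^typ>\<open>ennreal\<close>, so that an infinite norm is not
  confused with a finite one.\<close>

definition L2_enorm :: "('a::euclidean_space \<Rightarrow> 'b::real_normed_vector) \<Rightarrow> ennreal" where
  "L2_enorm f =
     (let I = \<integral>\<^sup>+ z. ennreal ((norm (f z))\<^sup>2) \<partial>lborel
      in if I = top then top else ennreal (sqrt (enn2real I)))"

text \<open>The sign \<open>e\<close> is \<open>1\<close> or \<open>-1\<close>.\<close>

definition X_norm :: "real \<Rightarrow> real \<Rightarrow> real \<Rightarrow> (spacetime \<Rightarrow> spinor) \<Rightarrow> ennreal" where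
  "X_norm e a b u =
     L2_enorm (\<lambda>(\<tau>, \<xi>).
       (jbr \<xi> powr a * jbr (\<tau> + e * norm \<xi>) powr b) *\<^sub>R st_fourier_spinor u (\<tau>, \<xi>))"

definition H_norm :: "real \<Rightarrow> real \<Rightarrow> (spacetime \<Rightarrow> complex) \<Rightarrow> ennreal" where
  "H_norm a b u =
     L2_enorm (\<lambda>(\<tau>, \<xi>).
       (jbr \<xi> powr a * jbr (\<bar>\<tau>\<bar> - norm \<xi>) powr b) *\<^sub>R st_fourier u (\<tau>, \<xi>))"

section \<open>Dirac matrices and projections\<close>

definition pauli :: "3 \<Rightarrow> complex^2^2" where
  "pauli j = (vector [vector [vector [0, 1], vector [1, 0]],
                      vector [vector [0, - \<i>], vector [\<i>, 0]],
                      vector [vector [1, 0], vector [0, -1]]] :: complex^2^2^3) $ j"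

definition block_matrix ::
    "complex^2^2 \<Rightarrow> complex^2^2 \<Rightarrow> complex^2^2 \<Rightarrow> complex^2^2 \<Rightarrow> complex^4^4" where
  "block_matrix A B C D = vector
     [vector [A $ 1 $ 1, A $ 1 $ 2, B $ 1 $ 1, B $ 1 $ 2],
      vector [A $ 2 $ 1, A $ 2 $ 2, B $ 2 $ 1, B $ 2 $ 2],
      vector [C $ 1 $ 1, C $ 1 $ 2, D $ 1 $ 1, D $ 1 $ 2],
      vector [C $ 2 $ 1, C $ 2 $ 2, D $ 2 $ 1, D $ 2 $ 2]]"

definition dirac_beta :: "complex^4^4" where
  "dirac_beta = block_matrix (mat 1) 0 0 (- mat 1)"

definition dirac_alpha :: "3 \<Rightarrow> complex^4^4" where
  "dirac_alpha j = block_matrix 0 (pauli j) (pauli j) 0"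

text \<open>At the null set \<open>\<xi> = 0\<close> the symbol takes the value \<open>I / 2\<close>, by \<open>x / 0 = 0\<close>.\<close>

definition dirac_proj :: "real \<Rightarrow> real^3 \<Rightarrow> complex^4^4" where
  "dirac_proj e \<xi> =
     (1/2) *\<^sub>R (mat 1 + e *\<^sub>R (\<Sum>j\<in>UNIV. (\<xi> $ j / norm \<xi>) *\<^sub>R dirac_alpha j))"

definition x_fourier :: "(spacetime \<Rightarrow> spinor) \<Rightarrow> real \<Rightarrow> real^3 \<Rightarrow> spinor" where
  "x_fourier u t \<xi> = (\<integral>x. exp (- (\<i> * of_real (x \<bullet> \<xi>))) *s u (t, x) \<partial>lborel)"

definition x_multiplier ::
    "(real^3 \<Rightarrow> complex^4^4) \<Rightarrow> (spacetime \<Rightarrow> spinor) \<Rightarrow> spacetime \<Rightarrow> spinor" where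
  "x_multiplier m u = (\<lambda>(t, x).
     (1 / (2 * pi) ^ 3) *\<^sub>R
       (\<integral>\<xi>. exp (\<i> * of_real (x \<bullet> \<xi>)) *s (m \<xi> *v x_fourier u t \<xi>) \<partial>lborel))"

abbreviation dirac_proj_D :: "real \<Rightarrow> (spacetime \<Rightarrow> spinor) \<Rightarrow> spacetime \<Rightarrow> spinor" where
  "dirac_proj_D e \<equiv> x_multiplier (dirac_proj e)"

text \<open>Linear in the first and antilinear in the second argument: \<open>\<langle>u, v\<rangle> = v\<^sup>\<dagger> u\<close>.\<close>

definition spinor_inner :: "spinor \<Rightarrow> spinor \<Rightarrow> complex" where
  "spinor_inner u v = (\<Sum>k\<in>UNIV. cnj (v $ k) * u $ k)"

definition dirac_product ::
    "real \<Rightarrow> real \<Rightarrow> (spacetime \<Rightarrow> spinor) \<Rightarrow> (spacetime \<Rightarrow> spinor) \<Rightarrow> spacetime \<Rightarrow> complex" where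
  "dirac_product e e' \<psi> \<psi>' =
     (\<lambda>z. spinor_inner (dirac_beta *v dirac_proj_D e \<psi> z) (dirac_proj_D e' \<psi>' z))"

text \<open>The estimate is in \<open>H\<close>-norm with exponents \<open>a, b\<close> for the product, and in
  \<open>X\<close>-norms with exponents \<open>a1, b1\<close> and \<open>a2, b2\<close> for the two factors. The product need not
  be a Schwartz function (the symbols are discontinuous at \<open>0\<close>), but it is integrable, being
  a product of square-integrable functions, so \<^const>\<open>st_fourier\<close> is meaningful for it.\<close>

definition dirac_estimate ::
    "real \<Rightarrow> real \<Rightarrow> real \<Rightarrow> real \<Rightarrow> real \<Rightarrow> real \<Rightarrow> bool" where
  "dirac_estimate a b a1 b1 a2 b2 \<longleftrightarrow>
     (\<forall>e\<in>{1, -1}. \<forall>e'\<in>{1, -1}. \<exists>C::real. C > 0 \<and>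
       (\<forall>\<psi> \<psi>'. schwartz \<psi> \<longrightarrow> schwartz \<psi>' \<longrightarrow>
          H_norm a b (dirac_product e e' \<psi> \<psi>')
            \<le> ennreal C * X_norm e a1 b1 \<psi> * X_norm e' a2 b2 \<psi>'))"

end

theory Submission
  imports Defs "HOL-Probability.Probability"
begin

text \<open>For \<open>\<psi> = F\<close> times the third and \<open>\<psi>' = G\<close> times the first basis spinor (on the Fourier side),
  the product has the scalar Fourier transform
  \<open>c \<integral> (e \<xi>\<^sub>1\<^sub>,\<^sub>3 / |\<xi>\<^sub>1| - e' \<xi>\<^sub>2\<^sub>,\<^sub>3 / |\<xi>\<^sub>2|) F(X\<^sub>1) G(X\<^sub>2) dX\<^sub>2\<close> at \<open>X\<^sub>0 = X\<^sub>1 - X\<^sub>2\<close>.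
  Taking for \<open>F, G\<close> smooth bumps on sets \<open>A, B\<close> with \<open>C + B \<subseteq> A\<close>, an estimate with output weights
  \<open>a, b\<close> and input weights \<open>a1, b1, a2, b2\<close> forces
  \<open>a \<le> a2\<close> (unit boxes, low frequency times high frequency),
  \<open>1/2 + a \<le> a1 + a2\<close> (planks of size \<open>\<lambda> \<times> \<surd>\<lambda> \<times> \<surd>\<lambda> \<times> 1\<close> along the cone, at angle \<open>\<lambda>\<^bsup>-1/2\<^esup>\<close>, where the
  null symbol gains only \<open>\<lambda>\<^bsup>-1/2\<^esup>\<close>), and \<open>1 + a \<le> a1 + b1 + a2\<close> (unit neighbourhoods \<open>B, C\<close> of the
  cone, \<open>A\<close> a ball of radius \<open>\<lambda>\<close>). By symmetry the last condition also holds with the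
  inputs exchanged; for estimate (i) the two versions add up to \<open>r \<ge> 1/2 + \<epsilon>/2\<close>.\<close>


section \<open>Fourier inversion\<close>

text \<open>Spinor components 3 and 1 are chosen because the complex entries of these two columns of
  the projections meet zeros in the pairing. What survives is real, and the sign in
  \<open>dirac_beta\<close> turns it into a difference of directions. With nonnegative
  \<open>F\<close>, \<open>G\<close> and the symbol bounded below by \<open>\<theta>\<close>,
  nothing cancels, so the estimate reduces to comparing \<open>\<theta> |B'| sqrt |C|\<close>, times
  the output weight, with \<open>sqrt |A| sqrt |B|\<close>, times the input weights. The modulation
  weights of the output and of the second input have size 1 in all three examples. Hence neither
  \<open>b\<close> nor \<open>b2\<close> enters the conditions, and \<open>\<rho>\<close> cannot
  help. Opposite signs are taken where the symbol should have size 1, equal signs for the planks.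
  The analytic obstacle is the jump of the projection symbols at frequency 0: the projected waves
  need not be Schwartz. Inversion is therefore proved for continuous bounded integrable functions
  with integrable inverse transform, and \<open>F\<close> is required to vanish for
  \<open>norm \<xi> < 1\<close>.\<close>

lemma
  fixes f :: "'a::euclidean_space \<Rightarrow> real \<Rightarrow> 'c::{real_normed_field,banach,second_countable_topology}"
  assumes f: "\<And>b. b \<in> Basis \<Longrightarrow> integrable lborel (f b)"
  shows integrable_lborel_prod_Basis: "integrable lborel (\<lambda>z::'a. \<Prod>b\<in>Basis. f b (z \<bullet> b))"
    and integral_lborel_prod_Basis:
      "(\<integral>z. (\<Prod>b\<in>Basis. f b (z \<bullet> b)) \<partial>lborel) = (\<Prod>b\<in>Basis. \<integral>x. f b x \<partial>lborel)"
proof -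
  interpret product_sigma_finite "\<lambda>_::'a. lborel :: real measure" ..
  have [measurable]: "f b \<in> borel_measurable borel" if "b \<in> Basis" for b
    using borel_measurable_integrable[OF f[OF that]] by simp
  have m1[measurable]: "(\<lambda>x::'a \<Rightarrow> real. \<Sum>b\<in>Basis. x b *\<^sub>R b) \<in> measurable (\<Pi>\<^sub>M b\<in>Basis. lborel) borel"
    by measurable
  have m2[measurable]: "(\<lambda>z::'a. \<Prod>b\<in>Basis. f b (z \<bullet> b)) \<in> borel_measurable borel"
    by measurable
  have eq: "(\<Prod>b\<in>Basis. f b ((\<Sum>c\<in>Basis. x c *\<^sub>R c) \<bullet> b)) = (\<Prod>b\<in>Basis. f b (x b))" for x
    by (intro prod.cong) auto
  show "integrable lborel (\<lambda>z::'a. \<Prod>b\<in>Basis. f b (z \<bullet> b))"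
    by (subst lborel_eq, subst integrable_distr_eq[OF m1 m2], unfold eq)
       (intro product_integrable_prod finite_Basis f)
  show "(\<integral>z. (\<Prod>b\<in>Basis. f b (z \<bullet> b)) \<partial>lborel) = (\<Prod>b\<in>Basis. \<integral>x. f b x \<partial>lborel)"
    by (subst lborel_eq, subst integral_distr[OF m1 m2], unfold eq)
       (intro product_integral_prod finite_Basis f)
qed

lemma
  fixes f :: "'a::euclidean_space \<Rightarrow> 'b::{banach,second_countable_topology}"
  assumes f[measurable]: "f \<in> borel_measurable borel" and c: "c \<noteq> 0"
  shows integral_lborel_affine: "(\<integral>x. f x \<partial>lborel) = \<bar>c\<bar> ^ DIM('a) *\<^sub>R (\<integral>x. f (t + c *\<^sub>R x) \<partial>lborel)"
    and integrable_lborel_affine: "integrable lborel f \<longleftrightarrow> integrable lborel (\<lambda>x. f (t + c *\<^sub>R x))"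
proof -
  show "(\<integral>x. f x \<partial>lborel) = \<bar>c\<bar> ^ DIM('a) *\<^sub>R (\<integral>x. f (t + c *\<^sub>R x) \<partial>lborel)"
    by (subst lborel_affine[OF c, of t]) (simp add: integral_density integral_distr)
  show "integrable lborel f \<longleftrightarrow> integrable lborel (\<lambda>x. f (t + c *\<^sub>R x))"
  proof -
    have "integrable lborel f \<longleftrightarrow> integrable lborel (\<lambda>x. \<bar>c\<bar> ^ DIM('a) *\<^sub>R f (t + c *\<^sub>R x))"
      by (subst lborel_affine[OF c, of t]) (simp add: integrable_density integrable_distr_eq)
    moreover have "integrable lborel (\<lambda>x. inverse (\<bar>c\<bar> ^ DIM('a)) *\<^sub>R \<bar>c\<bar> ^ DIM('a) *\<^sub>R f (t + c *\<^sub>R x))"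
      if "integrable lborel (\<lambda>x. \<bar>c\<bar> ^ DIM('a) *\<^sub>R f (t + c *\<^sub>R x))"
      using that by (rule integrable_scaleR_right)
    ultimately show ?thesis
      using c by auto
  qed
qed

section \<open>Gaussians and their Fourier transforms\<close>

definition gaussian :: "'a::euclidean_space \<Rightarrow> real" where
  "gaussian z = exp (- (norm z)\<^sup>2 / 2)"

lemma gaussian_eq_prod: "gaussian z = (\<Prod>b\<in>Basis. exp (- (z \<bullet> b)\<^sup>2 / 2))"
proof -
  have "(norm z)\<^sup>2 = (\<Sum>b\<in>Basis. (z \<bullet> b)\<^sup>2)"
    by (subst power2_norm_eq_inner, subst euclidean_inner) (simp add: power2_eq_square)
  then show ?thesis
    by (simp add: gaussian_def exp_sum[symmetric] sum_negf sum_divide_distrib)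
qed

lemma continuous_on_gaussian [continuous_intros]:
  "continuous_on A f \<Longrightarrow> continuous_on A (\<lambda>x. gaussian (f x))"
  unfolding gaussian_def by (intro continuous_intros) auto

lemma borel_measurable_gaussian [measurable]: "gaussian \<in> borel_measurable borel"
  by (intro borel_measurable_continuous_onI continuous_intros)

lemma gaussian_pos: "gaussian z > 0" and gaussian_le_1: "gaussian z \<le> 1"
  by (simp_all add: gaussian_def)

text \<open>This is the characteristic function of the standard normal distribution with the
  density's normalisation removed. No other transform is evaluated in closed form.\<close>

lemma
  shows integrable_iexp_gaussian_real: "integrable lborel (\<lambda>x. exp (\<i> * of_real (x * w)) * of_real (exp (- x\<^sup>2 / 2)))"
    and integral_iexp_gaussian_real:
      "(\<integral>x. exp (\<i> * of_real (x * w)) * of_real (exp (- x\<^sup>2 / 2)) \<partial>lborel)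
        = of_real (sqrt (2 * pi) * exp (- w\<^sup>2 / 2))"
proof -
  have eq: "exp (\<i> * of_real (x * w)) * of_real (exp (- x\<^sup>2 / 2))
      = sqrt (2 * pi) *\<^sub>R (std_normal_density x *\<^sub>R exp (\<i> * of_real (w * x)))" for x
    by (simp add: std_normal_density_def scaleR_conv_of_real mult.commute)
  have "char std_normal_distribution w = of_real (exp (- w\<^sup>2 / 2))"
    by (simp add: char_std_normal_distribution)
  then have 1: "(\<integral>x. std_normal_density x *\<^sub>R exp (\<i> * of_real (w * x)) \<partial>lborel) = of_real (exp (- w\<^sup>2 / 2))"
    unfolding char_def by (subst (asm) integral_density) (auto simp: normal_density_nonneg)
  have 2: "integrable lborel (\<lambda>x. std_normal_density x *\<^sub>R exp (\<i> * of_real (w * x)))"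
    by (rule Bochner_Integration.integrable_bound[of _ "std_normal_density"])
       (auto simp: integrable_normal_density normal_density_nonneg)
  show "integrable lborel (\<lambda>x. exp (\<i> * of_real (x * w)) * of_real (exp (- x\<^sup>2 / 2)))"
    unfolding eq by (intro integrable_scaleR_right 2)
  show "(\<integral>x. exp (\<i> * of_real (x * w)) * of_real (exp (- x\<^sup>2 / 2)) \<partial>lborel)
        = of_real (sqrt (2 * pi) * exp (- w\<^sup>2 / 2))"
    unfolding eq using 1 by (simp add: scaleR_conv_of_real)
qed

lemma
  fixes w :: "'a::euclidean_space"
  shows integrable_iexp_gaussian: "integrable lborel (\<lambda>z. exp (\<i> * of_real (z \<bullet> w)) * of_real (gaussian z))"
    and integral_iexp_gaussian:
      "(\<integral>z. exp (\<i> * of_real (z \<bullet> w)) * of_real (gaussian z) \<partial>lborel)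
         = of_real (sqrt (2 * pi) ^ DIM('a) * gaussian w)"
proof -
  have eq: "exp (\<i> * of_real (z \<bullet> w)) * of_real (gaussian z)
     = (\<Prod>b\<in>Basis. exp (\<i> * of_real ((z \<bullet> b) * (w \<bullet> b))) * of_real (exp (- (z \<bullet> b)\<^sup>2 / 2)))" for z
  proof -
    have "exp (\<i> * of_real (z \<bullet> w)) = (\<Prod>b\<in>Basis. exp (\<i> * of_real ((z \<bullet> b) * (w \<bullet> b))))"
      by (subst exp_sum[symmetric]) (simp_all add: euclidean_inner[of z w] sum_distrib_left of_real_sum)
    then show ?thesis
      by (simp add: gaussian_eq_prod prod.distrib of_real_prod)
  qed
  show "integrable lborel (\<lambda>z. exp (\<i> * of_real (z \<bullet> w)) * of_real (gaussian z))"
    unfolding eq by (intro integrable_lborel_prod_Basis integrable_iexp_gaussian_real)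
  show "(\<integral>z. exp (\<i> * of_real (z \<bullet> w)) * of_real (gaussian z) \<partial>lborel)
         = of_real (sqrt (2 * pi) ^ DIM('a) * gaussian w)"
    unfolding eq
    by (subst integral_lborel_prod_Basis[OF integrable_iexp_gaussian_real], unfold integral_iexp_gaussian_real)
       (simp add: gaussian_eq_prod prod.distrib)
qed

lemma
  shows integrable_gaussian: "integrable lborel (gaussian :: 'a::euclidean_space \<Rightarrow> real)"
    and integral_gaussian: "(\<integral>z. gaussian (z::'a) \<partial>lborel) = sqrt (2 * pi) ^ DIM('a)"
proof -
  have "integrable lborel (\<lambda>z::'a. complex_of_real (gaussian z))"
    using integrable_iexp_gaussian[of "0::'a"] by simp
  then show "integrable lborel (gaussian :: 'a::euclidean_space \<Rightarrow> real)"
    by (simp only: complex_of_real_integrable_eq)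
  have "complex_of_real (\<integral>z. gaussian (z::'a) \<partial>lborel) = of_real (sqrt (2 * pi) ^ DIM('a))"
    using integral_iexp_gaussian[of "0::'a"] by (simp add: gaussian_def)
  then show "(\<integral>z. gaussian (z::'a) \<partial>lborel) = sqrt (2 * pi) ^ DIM('a)"
    by (simp only: of_real_eq_iff)
qed

section \<open>The Fourier transform on a Euclidean space and its inversion\<close>

definition fourier :: "('a::euclidean_space \<Rightarrow> complex) \<Rightarrow> 'a \<Rightarrow> complex" where
  "fourier u \<zeta> = (\<integral>z. exp (- (\<i> * of_real (z \<bullet> \<zeta>))) * u z \<partial>lborel)"

text \<open>The space is arbitrary because inversion is applied both on space-time, for
  \<open>st_fourier\<close>, and on \<open>real^3\<close> alone, for
  \<open>x_fourier\<close>.\<close>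

definition inv_fourier :: "('a::euclidean_space \<Rightarrow> complex) \<Rightarrow> 'a \<Rightarrow> complex" where
  "inv_fourier G z = (1 / (2 * pi) ^ DIM('a)) *\<^sub>R (\<integral>\<zeta>. exp (\<i> * of_real (z \<bullet> \<zeta>)) * G \<zeta> \<partial>lborel)"

lemma integrable_iexp_mult [simp]:
  fixes G :: "'a::euclidean_space \<Rightarrow> complex"
  assumes "integrable lborel G"
  shows "integrable lborel (\<lambda>\<zeta>. exp (\<i> * of_real (z \<bullet> \<zeta>)) * G \<zeta>)"
    and "integrable lborel (\<lambda>\<zeta>. exp (- (\<i> * of_real (\<zeta> \<bullet> z))) * G \<zeta>)"
  using borel_measurable_integrable[OF assms]
  by (auto intro!: Bochner_Integration.integrable_bound[OF assms] simp: norm_mult)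

lemma norm_inv_fourier_le:
  fixes G :: "'a::euclidean_space \<Rightarrow> complex"
  shows "norm (inv_fourier G z) \<le> (\<integral>\<zeta>. norm (G \<zeta>) \<partial>lborel) / (2 * pi) ^ DIM('a)"
proof -
  have "norm (\<integral>\<zeta>. exp (\<i> * of_real (z \<bullet> \<zeta>)) * G \<zeta> \<partial>lborel) \<le> (\<integral>\<zeta>. norm (exp (\<i> * of_real (z \<bullet> \<zeta>)) * G \<zeta>) \<partial>lborel)"
    by (rule integral_norm_bound)
  then show ?thesis
    by (simp add: inv_fourier_def norm_mult field_simps)
qed

text \<open>Gaussian regularisation of the outer integral makes Fubini's theorem applicable.\<close>

theorem fourier_inversion:
  fixes G :: "'a::euclidean_space \<Rightarrow> complex"
  assumes u: "integrable lborel (inv_fourier G)" and G: "integrable lborel G"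
    and cont: "continuous_on UNIV G" and bdd: "\<And>x. norm (G x) \<le> M"
  shows "fourier (inv_fourier G) \<zeta>\<^sub>0 = G \<zeta>\<^sub>0"
proof -
  let ?n = "DIM('a)"
  let ?u = "inv_fourier G"
  define \<epsilon> where "\<epsilon> k = 1 / real (Suc k)" for k
  have eps: "\<epsilon> k > 0" for k by (simp add: \<epsilon>_def)
  have eps0: "\<epsilon> \<longlonglongrightarrow> 0"
    unfolding \<epsilon>_def using LIMSEQ_inverse_real_of_nat by (simp add: inverse_eq_divide)
  have [measurable]: "G \<in> borel_measurable borel" using borel_measurable_integrable[OF G] by simp
  have [measurable]: "?u \<in> borel_measurable borel" using borel_measurable_integrable[OF u] by simp
  define I where "I k = (\<integral>z. exp (- (\<i> * of_real (z \<bullet> \<zeta>\<^sub>0))) * ?u z * of_real (gaussian (\<epsilon> k *\<^sub>R z)) \<partial>lborel)" for k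
  have lim1: "I \<longlonglongrightarrow> fourier ?u \<zeta>\<^sub>0"
    unfolding I_def fourier_def
  proof (rule integral_dominated_convergence[where w="\<lambda>z. norm (?u z)"])
    show "AE z in lborel. (\<lambda>k. exp (- (\<i> * of_real (z \<bullet> \<zeta>\<^sub>0))) * ?u z * of_real (gaussian (\<epsilon> k *\<^sub>R z)))
        \<longlonglongrightarrow> exp (- (\<i> * of_real (z \<bullet> \<zeta>\<^sub>0))) * ?u z"
    proof (rule AE_I2)
      fix z :: 'a
      have "(\<lambda>k. gaussian (\<epsilon> k *\<^sub>R z)) \<longlonglongrightarrow> gaussian (0 *\<^sub>R z)"
        unfolding gaussian_def by (intro tendsto_intros eps0) simp
      then have "(\<lambda>k. gaussian (\<epsilon> k *\<^sub>R z)) \<longlonglongrightarrow> 1"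
        by (simp add: gaussian_def)
      from tendsto_mult[OF tendsto_const tendsto_of_real[OF this]]
      show "(\<lambda>k. exp (- (\<i> * of_real (z \<bullet> \<zeta>\<^sub>0))) * ?u z * of_real (gaussian (\<epsilon> k *\<^sub>R z)))
        \<longlonglongrightarrow> exp (- (\<i> * of_real (z \<bullet> \<zeta>\<^sub>0))) * ?u z"
        by simp
    qed
    show "AE z in lborel. norm (exp (- (\<i> * of_real (z \<bullet> \<zeta>\<^sub>0))) * ?u z * of_real (gaussian (\<epsilon> k *\<^sub>R z))) \<le> norm (?u z)" for k
      by (intro AE_I2) (simp add: norm_mult abs_of_pos gaussian_pos mult_left_le gaussian_le_1)
  qed (use u in auto)
  \<comment> \<open>Carrying out the \<open>z\<close>-integral first gives the transform of a
    dilated Gaussian, that is, a Gaussian of width \<open>\<epsilon> k\<close> around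
    \<open>\<zeta>\<^sub>0\<close>. So \<open>I k\<close> is a Gaussian average of \<open>G\<close>
    near that point.\<close>
  have key: "I k = (1 / sqrt (2 * pi) ^ ?n) *\<^sub>R (\<integral>\<eta>. gaussian \<eta> *\<^sub>R G (\<zeta>\<^sub>0 + \<epsilon> k *\<^sub>R \<eta>) \<partial>lborel)" for k
  proof -
    let ?e = "\<epsilon> k"
    let ?c = "1 / (2 * pi) ^ ?n"
    have ig: "integrable lborel (\<lambda>z::'a. gaussian (?e *\<^sub>R z))"
      using integrable_lborel_affine[of "gaussian::'a\<Rightarrow>real" ?e 0] eps[of k] integrable_gaussian[where 'a='a] by simp
    let ?f = "\<lambda>(z, \<zeta>). exp (\<i> * of_real (z \<bullet> (\<zeta> - \<zeta>\<^sub>0))) * G \<zeta> * of_real (gaussian (?e *\<^sub>R z))"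
    have int: "integrable (lborel \<Otimes>\<^sub>M lborel) ?f"
    proof (rule Bochner_Integration.integrable_bound)
      show "integrable (lborel \<Otimes>\<^sub>M lborel) (\<lambda>(z::'a, \<zeta>). gaussian (?e *\<^sub>R z) *\<^sub>R G \<zeta>)"
      proof (rule lborel_pair.Fubini_integrable)
        show "(\<lambda>(z::'a, \<zeta>). gaussian (?e *\<^sub>R z) *\<^sub>R G \<zeta>) \<in> borel_measurable (lborel \<Otimes>\<^sub>M lborel)"
          by measurable
        show "integrable lborel (\<lambda>z. \<integral>\<zeta>. norm (case (z, \<zeta>) of (z::'a, \<zeta>) \<Rightarrow> gaussian (?e *\<^sub>R z) *\<^sub>R G \<zeta>) \<partial>lborel)"
          using ig by (simp add: abs_of_pos gaussian_pos)
        show "AE z in lborel. integrable lborel (\<lambda>\<zeta>. case (z, \<zeta>) of (z::'a, \<zeta>) \<Rightarrow> gaussian (?e *\<^sub>R z) *\<^sub>R G \<zeta>)"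
          using G by simp
      qed
    qed (auto simp: norm_mult split_beta)
    have "I k = (\<integral>z. ?c *\<^sub>R (\<integral>\<zeta>. ?f (z, \<zeta>) \<partial>lborel) \<partial>lborel)"
      unfolding I_def inv_fourier_def
    proof (intro Bochner_Integration.integral_cong refl)
      fix z :: 'a
      have "?f (z, \<zeta>) = (exp (- (\<i> * of_real (z \<bullet> \<zeta>\<^sub>0))) * of_real (gaussian (?e *\<^sub>R z))) * (exp (\<i> * of_real (z \<bullet> \<zeta>)) * G \<zeta>)" for \<zeta>
        by (simp add: exp_add[symmetric] inner_diff_right algebra_simps exp_minus exp_diff field_simps)
      then show "exp (- (\<i> * of_real (z \<bullet> \<zeta>\<^sub>0))) * (?c *\<^sub>R (\<integral>\<zeta>. exp (\<i> * of_real (z \<bullet> \<zeta>)) * G \<zeta> \<partial>lborel)) * of_real (gaussian (?e *\<^sub>R z))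
          = ?c *\<^sub>R (\<integral>\<zeta>. ?f (z, \<zeta>) \<partial>lborel)"
        by (simp only: integral_mult_right_zero) (simp add: scaleR_conv_of_real)
    qed
    also have "\<dots> = ?c *\<^sub>R (\<integral>\<zeta>. (\<integral>z. ?f (z, \<zeta>) \<partial>lborel) \<partial>lborel)"
      using lborel_pair.Fubini_integral[OF int]
      by simp
    also have "(\<lambda>\<zeta>. (\<integral>z. ?f (z, \<zeta>) \<partial>lborel)) = (\<lambda>\<zeta>. (sqrt (2 * pi) / ?e) ^ ?n *\<^sub>R gaussian ((1 / ?e) *\<^sub>R (\<zeta> - \<zeta>\<^sub>0)) *\<^sub>R G \<zeta>)"
    proof
      fix \<zeta> :: 'a
      have "(\<integral>z. exp (\<i> * of_real (z \<bullet> (\<zeta> - \<zeta>\<^sub>0))) * of_real (gaussian (?e *\<^sub>R z)) \<partial>lborel)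
         = (1 / ?e) ^ ?n *\<^sub>R (\<integral>z. exp (\<i> * of_real (z \<bullet> ((1 / ?e) *\<^sub>R (\<zeta> - \<zeta>\<^sub>0)))) * of_real (gaussian z) \<partial>lborel)"
        using eps[of k]
        by (subst integral_lborel_affine[of _ "1 / ?e" 0]) (simp_all add: power_divide)
      also have "\<dots> = of_real ((sqrt (2 * pi) / ?e) ^ ?n * gaussian ((1 / ?e) *\<^sub>R (\<zeta> - \<zeta>\<^sub>0)))"
        by (subst integral_iexp_gaussian) (simp add: scaleR_conv_of_real power_divide)
      finally have 1: "(\<integral>z. exp (\<i> * of_real (z \<bullet> (\<zeta> - \<zeta>\<^sub>0))) * of_real (gaussian (?e *\<^sub>R z)) \<partial>lborel)
         = of_real ((sqrt (2 * pi) / ?e) ^ ?n * gaussian ((1 / ?e) *\<^sub>R (\<zeta> - \<zeta>\<^sub>0)))" .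
      have "(\<lambda>z. ?f (z, \<zeta>)) = (\<lambda>z. (exp (\<i> * of_real (z \<bullet> (\<zeta> - \<zeta>\<^sub>0))) * of_real (gaussian (?e *\<^sub>R z))) * G \<zeta>)"
        by (simp add: mult.commute mult.left_commute)
      then show "(\<integral>z. ?f (z, \<zeta>) \<partial>lborel) = (sqrt (2 * pi) / ?e) ^ ?n *\<^sub>R gaussian ((1 / ?e) *\<^sub>R (\<zeta> - \<zeta>\<^sub>0)) *\<^sub>R G \<zeta>"
        by (simp only: integral_mult_left_zero 1) (simp add: scaleR_conv_of_real)
    qed
    also have "(\<integral>\<zeta>. (sqrt (2 * pi) / ?e) ^ ?n *\<^sub>R gaussian ((1 / ?e) *\<^sub>R (\<zeta> - \<zeta>\<^sub>0)) *\<^sub>R G \<zeta> \<partial>lborel)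
        = (sqrt (2 * pi) / ?e) ^ ?n *\<^sub>R (\<integral>\<zeta>. gaussian ((1 / ?e) *\<^sub>R (\<zeta> - \<zeta>\<^sub>0)) *\<^sub>R G \<zeta> \<partial>lborel)"
      by (rule integral_scaleR_right)
    also have "(\<integral>\<zeta>. gaussian ((1 / ?e) *\<^sub>R (\<zeta> - \<zeta>\<^sub>0)) *\<^sub>R G \<zeta> \<partial>lborel)
        = ?e ^ ?n *\<^sub>R (\<integral>\<eta>. gaussian \<eta> *\<^sub>R G (\<zeta>\<^sub>0 + ?e *\<^sub>R \<eta>) \<partial>lborel)"
      using eps[of k] by (subst integral_lborel_affine[of _ ?e \<zeta>\<^sub>0]) simp_all
    finally have "I k = (?c * (sqrt (2 * pi) / ?e) ^ ?n * ?e ^ ?n) *\<^sub>R (\<integral>\<eta>. gaussian \<eta> *\<^sub>R G (\<zeta>\<^sub>0 + ?e *\<^sub>R \<eta>) \<partial>lborel)"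
      by (simp only: scaleR_scaleR mult.assoc)
    moreover have "?c * (sqrt (2 * pi) / ?e) ^ ?n * ?e ^ ?n = 1 / sqrt (2 * pi) ^ ?n"
    proof -
      have "(2 * pi) ^ ?n = sqrt (2 * pi) ^ ?n * sqrt (2 * pi) ^ ?n"
        by (subst power_mult_distrib[symmetric]) simp
      moreover have "1 / (S * S) * (S / E) * E = 1 / S" if "S > 0" "E > 0" for S E :: real
        using that by (simp add: field_simps)
      ultimately show ?thesis
        using eps[of k] by (simp only: power_divide) simp
    qed
    ultimately show ?thesis
      by simp
  qed
  \<comment> \<open>Approximate identity: continuity of \<open>G\<close> gives the pointwise limit
    and its bound \<open>M\<close> the majorant. Uniqueness of the limit of \<open>I\<close> then
    identifies the two values.\<close>
  have "(\<lambda>k. \<integral>\<eta>. gaussian \<eta> *\<^sub>R G (\<zeta>\<^sub>0 + \<epsilon> k *\<^sub>R \<eta>) \<partial>lborel) \<longlonglongrightarrow> (\<integral>\<eta>. gaussian (\<eta>::'a) *\<^sub>R G \<zeta>\<^sub>0 \<partial>lborel)"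
  proof (rule integral_dominated_convergence[where w="\<lambda>\<eta>. gaussian \<eta> *\<^sub>R M"])
    show "AE \<eta> in lborel. (\<lambda>k. gaussian \<eta> *\<^sub>R G (\<zeta>\<^sub>0 + \<epsilon> k *\<^sub>R \<eta>)) \<longlonglongrightarrow> gaussian \<eta> *\<^sub>R G \<zeta>\<^sub>0"
    proof (rule AE_I2, intro tendsto_intros)
      fix \<eta> :: 'a
      have "(\<lambda>k. \<zeta>\<^sub>0 + \<epsilon> k *\<^sub>R \<eta>) \<longlonglongrightarrow> \<zeta>\<^sub>0 + 0 *\<^sub>R \<eta>"
        by (intro tendsto_intros eps0)
      moreover have "isCont G (\<zeta>\<^sub>0 + 0 *\<^sub>R \<eta>)"
        using cont by (simp add: continuous_on_eq_continuous_at)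
      ultimately show "(\<lambda>k. G (\<zeta>\<^sub>0 + \<epsilon> k *\<^sub>R \<eta>)) \<longlonglongrightarrow> G \<zeta>\<^sub>0"
        using isCont_tendsto_compose by fastforce
    qed
    show "AE \<eta> in lborel. norm (gaussian \<eta> *\<^sub>R G (\<zeta>\<^sub>0 + \<epsilon> k *\<^sub>R \<eta>)) \<le> gaussian \<eta> *\<^sub>R M" for k
      using bdd by (auto simp: abs_of_pos gaussian_pos less_imp_le intro!: mult_left_mono)
  qed (use integrable_gaussian in auto)
  then have "(\<lambda>k. I k) \<longlonglongrightarrow> (1 / sqrt (2 * pi) ^ ?n) *\<^sub>R (\<integral>\<eta>. gaussian (\<eta>::'a) *\<^sub>R G \<zeta>\<^sub>0 \<partial>lborel)"
    unfolding key by (intro tendsto_intros)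
  also have "(\<integral>\<eta>. gaussian (\<eta>::'a) *\<^sub>R G \<zeta>\<^sub>0 \<partial>lborel) = sqrt (2 * pi) ^ ?n *\<^sub>R G \<zeta>\<^sub>0"
    by (subst integral_scaleR_left[OF integrable_gaussian]) (simp only: integral_gaussian)
  finally have "I \<longlonglongrightarrow> G \<zeta>\<^sub>0"
    by simp
  with lim1 show ?thesis
    by (rule LIMSEQ_unique)
qed

section \<open>Smooth test functions\<close>

text \<open>Differentiating \<open>exp (- 1 / t)\<close> produces powers of \<open>1 / t\<close>.
  Carrying the power as an index makes the family closed under differentiation up to linear
  combinations.\<close>

definition flat_exp :: "nat \<Rightarrow> real \<Rightarrow> real" where
  "flat_exp n t = (if t > 0 then (1 / t) ^ n * exp (- (1 / t)) else 0)"

lemma flat_nonneg: "flat_exp n t \<ge> 0"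
  by (simp add: flat_exp_def)

lemma flat_tendsto_0: "(flat_exp n \<longlongrightarrow> 0) (at 0)"
proof -
  have "((\<lambda>t. inverse t ^ n / exp (inverse t)) \<longlongrightarrow> (0::real)) (at_right 0)"
    by (rule filterlim_compose[OF tendsto_power_div_exp_0 filterlim_inverse_at_top_right])
  moreover have "eventually (\<lambda>t. inverse t ^ n / exp (inverse t) = flat_exp n t) (at_right 0)"
    unfolding eventually_at_right_field
    by (intro exI[of _ 1]) (auto simp: flat_exp_def exp_minus field_simps)
  ultimately have R: "(flat_exp n \<longlongrightarrow> 0) (at_right 0)"
    by (rule Lim_transform_eventually)
  have "eventually (\<lambda>t. 0 = flat_exp n t) (at_left 0)"
    unfolding eventually_at_left_field by (intro exI[of _ "-1"]) (auto simp: flat_exp_def)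
  then have L: "(flat_exp n \<longlongrightarrow> 0) (at_left 0)"
    by (rule Lim_transform_eventually[OF tendsto_const])
  show ?thesis
    by (rule filterlim_split_at[OF L R])
qed

lemma flat_has_real_derivative:
  "(flat_exp n has_real_derivative flat_exp (n + 2) t - real n * flat_exp (n + 1) t) (at t)"
proof (cases t "0::real" rule: linorder_cases)
  case less
  have "(flat_exp n has_real_derivative 0) (at t)"
    by (rule has_field_derivative_transform_within_open[OF DERIV_const open_lessThan[of 0]])
       (use less in \<open>auto simp: flat_exp_def\<close>)
  with less show ?thesis by (simp add: flat_exp_def)
next
  case equal
  \<comment> \<open>The difference quotient at 0 is \<open>flat_exp (n + 1)\<close>, so
    differentiability there is the limit lemma with the index raised by one.\<close>
  have "((\<lambda>h. flat_exp n h / h) \<longlongrightarrow> 0) (at 0)"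
    by (rule Lim_transform_eventually[OF flat_tendsto_0[of "n + 1"]])
       (auto simp: flat_exp_def eventually_at_filter)
  with equal show ?thesis
    by (simp add: DERIV_def flat_exp_def[of _ 0])
next
  case greater
  have "((\<lambda>t. (1 / t) ^ n * exp (- (1 / t))) has_real_derivative flat_exp (n + 2) t - real n * flat_exp (n + 1) t) (at t)"
    using greater
    by (auto intro!: derivative_eq_intros simp: flat_exp_def field_simps power2_eq_square)
       (cases n; simp add: field_simps)
  then show ?thesis
    by (rule has_field_derivative_transform_within_open[OF _ open_greaterThan[of 0]])
       (use greater in \<open>auto simp: flat_exp_def\<close>)
qed

text \<open>Smoothness is encoded by the way a function is built, so that derivatives of all orders
  come from a single induction. The class contains the polynomials, and composing them with
  \<open>flat_exp\<close> gives cutoffs to neighbourhoods of planes and of the cone.\<close>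

inductive_set smooth_alg :: "('a::euclidean_space \<Rightarrow> real) set" where
  smooth_alg_const: "(\<lambda>x. c) \<in> smooth_alg"
| smooth_alg_inner: "(\<lambda>x. x \<bullet> a) \<in> smooth_alg"
| smooth_alg_add: "f \<in> smooth_alg \<Longrightarrow> g \<in> smooth_alg \<Longrightarrow> (\<lambda>x. f x + g x) \<in> smooth_alg"
| smooth_alg_mult: "f \<in> smooth_alg \<Longrightarrow> g \<in> smooth_alg \<Longrightarrow> (\<lambda>x. f x * g x) \<in> smooth_alg"
| smooth_alg_flat: "f \<in> smooth_alg \<Longrightarrow> (\<lambda>x. flat_exp n (f x)) \<in> smooth_alg"

text \<open>The derivative of each building step is again made of building steps, the chain rule for
  \<open>flat_exp\<close> only raising its index. Iteration yields derivatives of every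
  order.\<close>

lemma smooth_alg_has_derivative:
  "f \<in> smooth_alg \<Longrightarrow> \<exists>f'. (\<forall>x. (f has_derivative f' x) (at x)) \<and> (\<forall>v. (\<lambda>x. f' x v) \<in> smooth_alg)"
proof (induction rule: smooth_alg.induct)
  case (smooth_alg_const c)
  show ?case
    by (intro exI[of _ "\<lambda>x v. 0"]) (auto intro: smooth_alg.intros)
next
  case (smooth_alg_inner a)
  show ?case
    by (intro exI[of _ "\<lambda>x v. v \<bullet> a"]) (auto intro: smooth_alg.intros intro!: derivative_eq_intros)
next
  case (smooth_alg_add f g)
  then obtain f' g' where "\<forall>x. (f has_derivative f' x) (at x)" "\<forall>v. (\<lambda>x. f' x v) \<in> smooth_alg"
    "\<forall>x. (g has_derivative g' x) (at x)" "\<forall>v. (\<lambda>x. g' x v) \<in> smooth_alg" by blast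
  then show ?case
    by (intro exI[of _ "\<lambda>x v. f' x v + g' x v"])
       (auto intro: smooth_alg.intros intro!: has_derivative_add)
next
  case (smooth_alg_mult f g)
  then obtain f' g' where "\<forall>x. (f has_derivative f' x) (at x)" "\<forall>v. (\<lambda>x. f' x v) \<in> smooth_alg"
    "\<forall>x. (g has_derivative g' x) (at x)" "\<forall>v. (\<lambda>x. g' x v) \<in> smooth_alg" by blast
  with smooth_alg_mult.hyps show ?case
    by (intro exI[of _ "\<lambda>x v. f x * g' x v + f' x v * g x"])
       (auto intro!: smooth_alg.intros has_derivative_mult)
next
  case (smooth_alg_flat f n)
  then obtain f' where f': "\<forall>x. (f has_derivative f' x) (at x)" "\<forall>v. (\<lambda>x. f' x v) \<in> smooth_alg"
    by blast
  let ?F' = "\<lambda>x v. f' x v * (flat_exp (n + 2) (f x) + (- real n) * flat_exp (n + 1) (f x))"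
  have "((\<lambda>x. flat_exp n (f x)) has_derivative ?F' x) (at x)" for x
    using has_derivative_compose[OF f'(1)[rule_format, of x] flat_has_real_derivative[unfolded has_field_derivative_def]]
    by (simp add: mult.commute)
  moreover have "(\<lambda>x. ?F' x v) \<in> smooth_alg" for v
    using f' smooth_alg_flat.hyps by (intro smooth_alg.intros) auto
  ultimately show ?case
    by (intro exI[of _ ?F'] conjI allI)
qed

definition test_fun :: "('a::euclidean_space \<Rightarrow> real) \<Rightarrow> bool" where
  "test_fun f \<longleftrightarrow> f \<in> smooth_alg \<and> (\<exists>R. \<forall>x. f x \<noteq> 0 \<longrightarrow> norm x \<le> R)"

lemma test_fun_has_derivative:
  "test_fun f \<Longrightarrow> (f has_derivative frechet_derivative f (at x)) (at x)"
  using smooth_alg_has_derivative[of f] unfolding test_fun_def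
  by (metis frechet_derivative_works differentiableI)

lemma continuous_on_test_fun: "test_fun f \<Longrightarrow> continuous_on A f"
  by (meson continuous_at_imp_continuous_on has_derivative_continuous test_fun_has_derivative)

lemma borel_measurable_test_fun: "test_fun f \<Longrightarrow> f \<in> borel_measurable borel"
  by (intro borel_measurable_continuous_onI continuous_on_test_fun)

text \<open>Outside a closed ball the function vanishes on an open set, so its derivative vanishes
  there too and the same radius serves.\<close>

lemma test_fun_deriv:
  assumes "test_fun f"
  shows "test_fun (\<lambda>x. frechet_derivative f (at x) v)"
proof -
  from assms obtain R where R: "\<And>x. f x \<noteq> 0 \<Longrightarrow> norm x \<le> R" and f: "f \<in> smooth_alg"
    unfolding test_fun_def by auto
  from smooth_alg_has_derivative[OF f] obtain f' where
    f': "\<And>x. (f has_derivative f' x) (at x)" "\<And>v. (\<lambda>x. f' x v) \<in> smooth_alg" by blast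
  have eq: "frechet_derivative f (at x) = f' x" for x
    using frechet_derivative_at[OF f'(1)] by simp
  have "norm x \<le> R" if "f' x v \<noteq> 0" for x
  proof (rule ccontr)
    assume "\<not> norm x \<le> R"
    then have x: "x \<in> - cball 0 R" by simp
    have "(f has_derivative (\<lambda>_. 0)) (at x)"
      by (rule has_derivative_transform_within_open[OF has_derivative_const[of 0] _ x])
         (use R in \<open>auto simp: open_Compl\<close>)
    then have "f' x = (\<lambda>_. 0)"
      using f'(1) has_derivative_unique by blast
    with that show False by simp
  qed
  with f' show ?thesis
    unfolding test_fun_def eq by blast
qed

lemma test_fun_mult_left:
  "f \<in> smooth_alg \<Longrightarrow> test_fun g \<Longrightarrow> test_fun (\<lambda>x. f x * g x)"
  unfolding test_fun_def by (auto intro: smooth_alg.intros)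

lemma test_fun_mult_inner: "test_fun f \<Longrightarrow> test_fun (\<lambda>x. f x * (x \<bullet> v))"
  unfolding test_fun_def by (auto intro: smooth_alg.intros)

lemma test_fun_bounded:
  fixes f :: "'a::euclidean_space \<Rightarrow> real"
  assumes "test_fun f"
  obtains M where "M > 0" "\<And>x. \<bar>f x\<bar> \<le> M"
proof -
  from assms obtain R where R: "\<And>x. f x \<noteq> 0 \<Longrightarrow> norm x \<le> R"
    unfolding test_fun_def by auto
  have "bounded (f ` cball 0 R)"
    by (intro compact_imp_bounded compact_continuous_image continuous_on_test_fun assms) auto
  then obtain M where M: "M > 0" "\<And>x. x \<in> cball 0 R \<Longrightarrow> \<bar>f x\<bar> \<le> M"
    unfolding bounded_pos by auto
  have "\<bar>f x\<bar> \<le> M" for x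
    using M R[of x] by (cases "f x = 0") auto
  with M(1) show thesis by (rule that)
qed

lemma integrable_test_fun:
  fixes f :: "'a::euclidean_space \<Rightarrow> real"
  assumes "test_fun f"
  shows "integrable lborel f"
proof -
  from assms obtain R where R: "\<And>x. f x \<noteq> 0 \<Longrightarrow> norm x \<le> R"
    unfolding test_fun_def by auto
  obtain M where "\<And>x. \<bar>f x\<bar> \<le> M"
    using test_fun_bounded[OF assms] by blast
  then have M: "\<bar>f x\<bar> \<le> \<bar>M\<bar>" for x
    by (meson abs_ge_self order_trans)
  have "integrable lborel (\<lambda>x. indicator (cball 0 R) x *\<^sub>R M)"
    by (intro integrable_scaleR_left integrable_real_indicator) (use emeasure_lborel_cball_finite[of 0 R] in \<open>auto simp: infinity_ennreal_def\<close>)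
  then show ?thesis
    by (rule Bochner_Integration.integrable_bound)
       (use R M assms borel_measurable_test_fun in \<open>auto simp: indicator_def\<close>)
qed

section \<open>Inverse transforms of test functions: smoothness, decay, inversion\<close>

lemma integrable_complex_test_fun:
  "test_fun f \<Longrightarrow> integrable lborel (\<lambda>x. complex_of_real (f x))"
  by (simp add: integrable_test_fun)

text \<open>Differentiation under the integral with an explicit remainder: \<open>exp (i t)\<close>
  differs from \<open>1 + i t\<close> by at most \<open>t^2 / 2\<close>, and
  \<open>t = (y - z) \<bullet> x\<close> is at most \<open>R * norm (y - z)\<close> on the support
  of \<open>f\<close>.\<close>

lemma inv_fourier_has_derivative:
  fixes f :: "'a::euclidean_space \<Rightarrow> real"
  assumes f: "test_fun f"
  shows "(inv_fourier (\<lambda>x. of_real (f x)) has_derivative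
     (\<lambda>v. \<i> * inv_fourier (\<lambda>x. of_real (f x * (x \<bullet> v))) z)) (at z)"
proof -
  let ?c = "1 / (2 * pi) ^ DIM('a)"
  let ?D = "\<lambda>v. \<i> * inv_fourier (\<lambda>x. of_real (f x * (x \<bullet> v))) z"
  from f obtain R0 where R0: "\<And>x. f x \<noteq> 0 \<Longrightarrow> norm x \<le> R0"
    unfolding test_fun_def by auto
  define R where "R = max R0 0"
  have R: "norm x \<le> R" if "f x \<noteq> 0" for x using R0[OF that] by (simp add: R_def)
  have R_nn: "R \<ge> 0" by (simp add: R_def)
  have [simp]: "integrable lborel f" "integrable lborel (\<lambda>x. f x * (x \<bullet> v))" for v
    using f by (auto intro: integrable_test_fun test_fun_mult_inner)
  have int: "integrable lborel (\<lambda>x. exp (\<i> * of_real (z \<bullet> x)) * complex_of_real (f x))"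
    "integrable lborel (\<lambda>x. exp (\<i> * of_real (z \<bullet> x)) * complex_of_real (f x * (x \<bullet> v)))" for z v
    by (rule integrable_iexp_mult(1), rule integrable_of_real, simp)+
  have lin: "linear ?D"
  proof (rule linearI)
    show "?D (v + w) = ?D v + ?D w" for v w
    proof -
      have eq: "(\<lambda>x. exp (\<i> * of_real (z \<bullet> x)) * complex_of_real (f x * (x \<bullet> (v + w))))
         = (\<lambda>x. exp (\<i> * of_real (z \<bullet> x)) * complex_of_real (f x * (x \<bullet> v))
              + exp (\<i> * of_real (z \<bullet> x)) * complex_of_real (f x * (x \<bullet> w)))"
        by (auto simp: inner_add_right algebra_simps)
      show ?thesis
        unfolding inv_fourier_def eq
        by (simp only: Bochner_Integration.integral_add[OF int(2) int(2)] scaleR_add_right distrib_left)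
    qed
    show "?D (r *\<^sub>R v) = r *\<^sub>R ?D v" for r v
    proof -
      have "(\<lambda>x. exp (\<i> * of_real (z \<bullet> x)) * complex_of_real (f x * (x \<bullet> (r *\<^sub>R v))))
         = (\<lambda>x. r *\<^sub>R (exp (\<i> * of_real (z \<bullet> x)) * complex_of_real (f x * (x \<bullet> v))))"
        by (auto simp: scaleR_conv_of_real)
      then show ?thesis
        unfolding inv_fourier_def by simp
    qed
  qed
  \<comment> \<open>The constant of the quadratic remainder: \<open>R\<^sup>2\<close> comes from the
    support, the integral from the size of \<open>f\<close>, \<open>?c\<close> from the
    normalisation.\<close>
  define K where "K = ?c * (R\<^sup>2 * (\<integral>x. \<bar>f x\<bar> \<partial>lborel))"
  have "K \<ge> 0"
    by (simp add: K_def)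
  have bound: "norm (inv_fourier (\<lambda>x. of_real (f x)) y - inv_fourier (\<lambda>x. of_real (f x)) z - ?D (y - z))
      \<le> K * (norm (y - z))\<^sup>2" for y
  proof -
    let ?g = "\<lambda>x. exp (\<i> * of_real (y \<bullet> x)) * complex_of_real (f x) - exp (\<i> * of_real (z \<bullet> x)) * complex_of_real (f x)
        - \<i> * (exp (\<i> * of_real (z \<bullet> x)) * complex_of_real (f x * (x \<bullet> (y - z))))"
    have "inv_fourier (\<lambda>x. of_real (f x)) y - inv_fourier (\<lambda>x. of_real (f x)) z - ?D (y - z)
      = ?c *\<^sub>R (\<integral>x. ?g x \<partial>lborel)"
      unfolding inv_fourier_def
      by (simp only: Bochner_Integration.integral_diff[OF int(1) int(1)] integral_mult_right_zero
          Bochner_Integration.integral_diff[OF Bochner_Integration.integrable_diff[OF int(1) int(1)] integrable_mult_right[OF int(2)]]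
          scaleR_diff_right mult_scaleR_right)
    also have "norm \<dots> \<le> ?c * (\<integral>x. (norm (y - z))\<^sup>2 * (R\<^sup>2 * \<bar>f x\<bar>) \<partial>lborel)"
    proof -
      have "norm (?g x) \<le> (norm (y - z))\<^sup>2 * (R\<^sup>2 * \<bar>f x\<bar>)" for x
      proof (cases "f x = 0")
        case False
        let ?t = "(y - z) \<bullet> x"
        have "?g x = exp (\<i> * of_real (z \<bullet> x)) * of_real (f x) * (exp (\<i> * of_real ?t) - (1 + \<i> * of_real ?t))"
          by (simp add: inner_diff_left inner_diff_right inner_commute[of x] algebra_simps exp_diff)
        then have eq: "norm (?g x) = \<bar>f x\<bar> * norm (exp (\<i> * of_real ?t) - (1 + \<i> * of_real ?t))"
          by (simp add: norm_mult)
        have "norm (exp (\<i> * of_real ?t) - (1 + \<i> * of_real ?t)) \<le> \<bar>?t\<bar> ^ 2 / 2"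
          using iexp_approx1[of ?t 1] by (simp add: numeral_2_eq_2)
        also have "\<bar>?t\<bar> ^ 2 / 2 \<le> \<bar>?t\<bar> ^ 2"
          by simp
        also have "\<bar>?t\<bar> ^ 2 \<le> (norm (y - z) * R) ^ 2"
        proof (rule power_mono)
          have "\<bar>?t\<bar> \<le> norm (y - z) * norm x" by (rule Cauchy_Schwarz_ineq2)
          also have "\<dots> \<le> norm (y - z) * R" using R[OF False] by (intro mult_left_mono) auto
          finally show "\<bar>?t\<bar> \<le> norm (y - z) * R" .
        qed simp
        finally show ?thesis
          unfolding eq power_mult_distrib by (metis abs_ge_zero mult.assoc mult.commute mult_left_mono)
      qed (simp)
      then have "norm (\<integral>x. ?g x \<partial>lborel) \<le> (\<integral>x. (norm (y - z))\<^sup>2 * (R\<^sup>2 * \<bar>f x\<bar>) \<partial>lborel)"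
        by (intro Bochner_Integration.integral_norm_bound_integral Bochner_Integration.integrable_diff int integrable_mult_right) auto
      then show ?thesis
        by (simp add: divide_right_mono)
    qed
    also have "\<dots> = K * (norm (y - z))\<^sup>2"
      by (simp add: K_def)
    finally show ?thesis .
  qed
  show ?thesis
    unfolding has_derivative_within_alt
  proof (intro conjI allI impI)
    show "bounded_linear ?D"
      using lin by (simp add: linear_conv_bounded_linear)
    fix e :: real assume "e > 0"
    show "\<exists>d>0. \<forall>y\<in>UNIV. norm (y - z) < d \<longrightarrow>
      norm (inv_fourier (\<lambda>x. of_real (f x)) y - inv_fourier (\<lambda>x. of_real (f x)) z - ?D (y - z)) \<le> e * norm (y - z)"
    \<comment> \<open>\<open>K + 1\<close> replaces \<open>K\<close> because \<open>K\<close> is 0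
      when \<open>f\<close> is.\<close>
    proof (intro exI[of _ "e / (K + 1)"] conjI ballI impI)
      show "0 < e / (K + 1)" using \<open>e > 0\<close> \<open>K \<ge> 0\<close> by simp
      fix y assume y: "norm (y - z) < e / (K + 1)"
      have "K * norm (y - z) \<le> (K + 1) * norm (y - z)"
        by (simp add: mult_right_mono)
      also have "\<dots> \<le> e"
        using y \<open>K \<ge> 0\<close> by (simp add: field_simps)
      finally have "K * (norm (y - z))\<^sup>2 \<le> e * norm (y - z)"
        by (simp add: power2_eq_square mult.assoc[symmetric] mult_right_mono)
      with bound[of y] show "norm (inv_fourier (\<lambda>x. of_real (f x)) y - inv_fourier (\<lambda>x. of_real (f x)) z - ?D (y - z)) \<le> e * norm (y - z)"
        by linarith
    qed
  qed
qed

text \<open>A derivative in direction \<open>v\<close> multiplies the Fourier side by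
  \<open>\<i> * (x \<bullet> v)\<close>. This multiplication preserves test functions, so the
  induction can be repeated for any list of directions.\<close>

lemma iter_partial_inv_fourier:
  fixes f :: "'a::euclidean_space \<Rightarrow> real"
  assumes f: "test_fun f"
  shows "test_fun (\<lambda>x. f x * prod_list (map ((\<bullet>) x) vs))" (is "test_fun (?g vs)")
    and "iter_partial vs (inv_fourier (\<lambda>x. of_real (f x)))
      = (\<lambda>z. \<i> ^ length vs * inv_fourier (\<lambda>x. of_real (f x * prod_list (map ((\<bullet>) x) vs))) z)"
proof -
  show test: "test_fun (?g vs)" for vs
  proof (induction vs)
    case (Cons v vs)
    from test_fun_mult_inner[OF this, of v] show ?case
      by (simp add: mult_ac)
  qed (simp add: f)
  show "iter_partial vs (inv_fourier (\<lambda>x. of_real (f x)))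
      = (\<lambda>z. \<i> ^ length vs * inv_fourier (\<lambda>x. of_real (?g vs x)) z)"
  proof (induction vs)
    case (Cons v vs)
    have "((\<lambda>z. \<i> ^ length vs * inv_fourier (\<lambda>x. of_real (?g vs x)) z) has_derivative
      (\<lambda>v. \<i> ^ length vs * (\<i> * inv_fourier (\<lambda>x. of_real (?g vs x * (x \<bullet> v))) z))) (at z)" for z
      by (intro has_derivative_mult_right inv_fourier_has_derivative test)
    from frechet_derivative_at[OF this, symmetric] show ?case
      by (simp add: Cons.IH mult_ac)
  qed simp
qed

text \<open>Integration by parts, from the translation invariance of the integral.\<close>

lemma inner_mult_inv_fourier:
  fixes f :: "'a::euclidean_space \<Rightarrow> real"
  assumes f: "test_fun f"
  shows "of_real (z \<bullet> b) * inv_fourier (\<lambda>x. of_real (f x)) z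
     = \<i> * inv_fourier (\<lambda>x. of_real (frechet_derivative f (at x) b)) z"
proof -
  define h where "h k = 1 / real (Suc k)" for k
  have h: "h k > 0" "h k \<le> 1" for k by (auto simp: h_def)
  have h0: "h \<longlonglongrightarrow> 0"
    unfolding h_def using LIMSEQ_inverse_real_of_nat by (simp add: inverse_eq_divide)
  have h_at: "filterlim h (at 0) sequentially"
    unfolding filterlim_at using h h0 by (auto intro!: always_eventually less_imp_neq[symmetric])
  let ?f' = "\<lambda>x. frechet_derivative f (at x) b"
  let ?e = "\<lambda>x. exp (\<i> * of_real (z \<bullet> x))"
  let ?I = "\<integral>x. ?e x * complex_of_real (f x) \<partial>lborel"
  have [measurable]: "f \<in> borel_measurable borel" "?f' \<in> borel_measurable borel"
    using f by (auto intro: borel_measurable_test_fun test_fun_deriv)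
  have deriv: "((\<lambda>t. f (x + t *\<^sub>R b)) has_real_derivative ?f' (x + t *\<^sub>R b)) (at t)" for x t
  proof -
    have "((\<lambda>t. f (x + t *\<^sub>R b)) has_derivative (\<lambda>s. frechet_derivative f (at (x + t *\<^sub>R b)) (s *\<^sub>R b))) (at t)"
      by (rule has_derivative_compose[OF _ test_fun_has_derivative[OF f]])
         (auto intro!: derivative_eq_intros)
    moreover have "(\<lambda>s. frechet_derivative f (at (x + t *\<^sub>R b)) (s *\<^sub>R b)) = (*) (?f' (x + t *\<^sub>R b))"
      using linear_frechet_derivative[OF differentiableI[OF test_fun_has_derivative[OF f]]]
      by (auto simp: linear_cmul mult.commute)
    ultimately show ?thesis
      unfolding has_field_derivative_def by simp
  qed
  obtain M where M: "M > 0" "\<And>x. \<bar>?f' x\<bar> \<le> M"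
    using test_fun_bounded[OF test_fun_deriv[OF f]] by blast
  obtain R where R: "\<And>x. f x \<noteq> 0 \<Longrightarrow> norm x \<le> R"
    using f unfolding test_fun_def by auto
  let ?q = "\<lambda>k x. (f (x + h k *\<^sub>R b) - f x) / h k"
  \<comment> \<open>Since \<open>h k \<le> 1\<close>, all shifted supports lie in one ball of radius
    \<open>R + norm b\<close>. Inside it the mean value theorem bounds the quotient by the maximum
    of the derivative.\<close>
  have q_bound: "\<bar>?q k x\<bar> \<le> indicator (cball 0 (R + norm b)) x * M" for k x
  proof (cases "x \<in> cball 0 (R + norm b)")
    case True
    from MVT2[OF h(1)[of k], of "\<lambda>t. f (x + t *\<^sub>R b)" "\<lambda>t. ?f' (x + t *\<^sub>R b)"] deriv
    obtain t where "f (x + h k *\<^sub>R b) - f x = h k * ?f' (x + t *\<^sub>R b)"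
      by auto
    with h(1)[of k] M(2) True show ?thesis
      by (simp add: abs_mult)
  next
    case False
    then have "R + norm b < norm x" by simp
    moreover have "norm x \<le> norm (x + h k *\<^sub>R b) + norm (h k *\<^sub>R b)"
      using norm_triangle_ineq4[of "x + h k *\<^sub>R b" "h k *\<^sub>R b"] by simp
    moreover have "norm (h k *\<^sub>R b) \<le> norm b"
      using h[of k] by (simp add: abs_of_pos mult_left_le_one_le)
    ultimately have "f (x + h k *\<^sub>R b) = 0" "f x = 0"
      using R[of x] R[of "x + h k *\<^sub>R b"] norm_ge_zero[of b] by (force, linarith)
    then show ?thesis
      using False by simp
  qed
  have lim1: "(\<lambda>k. \<integral>x. ?e x * of_real (?q k x) \<partial>lborel) \<longlonglongrightarrow> (\<integral>x. ?e x * of_real (?f' x) \<partial>lborel)"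
  proof (rule integral_dominated_convergence[where w="\<lambda>x. indicator (cball 0 (R + norm b)) x * M"])
    show "integrable lborel (\<lambda>x::'a. indicator (cball 0 (R + norm b)) x * M)"
      by (intro integrable_mult_left integrable_real_indicator)
         (use emeasure_lborel_cball_finite[of 0 "R + norm b"] in \<open>auto simp: infinity_ennreal_def\<close>)
    show "AE x in lborel. (\<lambda>k. ?e x * of_real (?q k x)) \<longlonglongrightarrow> ?e x * of_real (?f' x)"
    proof (intro AE_I2 tendsto_intros)
      fix x
      have "((\<lambda>t. (f (x + t *\<^sub>R b) - f x) / t) \<longlongrightarrow> ?f' x) (at 0)"
        using deriv[of x 0] by (simp add: DERIV_def)
      from filterlim_compose[OF this h_at] show "(\<lambda>k. ?q k x) \<longlonglongrightarrow> ?f' x" .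
    qed
    show "AE x in lborel. norm (?e x * of_real (?q k x)) \<le> indicator (cball 0 (R + norm b)) x * M" for k
      by (intro AE_I2, unfold norm_mult norm_of_real norm_exp_i_times, unfold mult_1) (rule q_bound)
  qed measurable
  \<comment> \<open>Translating the shifted term moves the difference quotient from \<open>f\<close>
    to the phase: what remains is the difference quotient at 0 of an exponential in
    \<open>h k\<close>, whose limit is \<open>- \<i> * (z \<bullet> b)\<close>.\<close>
  have eq: "(\<integral>x. ?e x * of_real (?q k x) \<partial>lborel)
      = (exp (- (\<i> * of_real (z \<bullet> b)) * of_real (h k)) - 1) / of_real (h k) * ?I" for k
  proof -
    have int: "integrable lborel (\<lambda>x. ?e x * complex_of_real (f x))"
      by (intro integrable_iexp_mult integrable_complex_test_fun f)
    have e: "?e (x + h k *\<^sub>R b) * exp (- (\<i> * of_real (z \<bullet> b)) * of_real (h k)) = ?e x" for x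
      by (simp add: exp_add[symmetric] inner_add_right algebra_simps)
    have int2: "integrable lborel (\<lambda>x. ?e x * complex_of_real (f (x + h k *\<^sub>R b)))"
    proof -
      have "integrable lborel (\<lambda>x. exp (- (\<i> * of_real (z \<bullet> b)) * of_real (h k)) * (?e (h k *\<^sub>R b + 1 *\<^sub>R x) * complex_of_real (f (h k *\<^sub>R b + 1 *\<^sub>R x))))"
        by (intro integrable_mult_right integrable_lborel_affine[THEN iffD1] int) auto
      moreover have "(\<lambda>x. exp (- (\<i> * of_real (z \<bullet> b)) * of_real (h k)) * (?e (h k *\<^sub>R b + 1 *\<^sub>R x) * complex_of_real (f (h k *\<^sub>R b + 1 *\<^sub>R x))))
         = (\<lambda>x. ?e x * complex_of_real (f (x + h k *\<^sub>R b)))"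
        by (subst e[symmetric]) (simp add: add.commute mult_ac)
      ultimately show ?thesis by simp
    qed
    have shift: "?I = exp (\<i> * of_real (z \<bullet> b) * of_real (h k)) * (\<integral>x. ?e x * complex_of_real (f (x + h k *\<^sub>R b)) \<partial>lborel)"
    proof -
      have "?I = (\<integral>x. ?e (h k *\<^sub>R b + 1 *\<^sub>R x) * complex_of_real (f (h k *\<^sub>R b + 1 *\<^sub>R x)) \<partial>lborel)"
        by (subst integral_lborel_affine[of _ 1 "h k *\<^sub>R b"]) auto
      also have "\<dots> = (\<integral>x. exp (\<i> * of_real (z \<bullet> b) * of_real (h k)) * (?e x * complex_of_real (f (x + h k *\<^sub>R b))) \<partial>lborel)"
        by (intro Bochner_Integration.integral_cong refl)
           (simp add: exp_add inner_add_right algebra_simps)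
      finally show ?thesis
        by (simp only: integral_mult_right_zero)
    qed
    have "(\<integral>x. ?e x * of_real (?q k x) \<partial>lborel)
       = (\<integral>x. (?e x * complex_of_real (f (x + h k *\<^sub>R b)) - ?e x * complex_of_real (f x)) / of_real (h k) \<partial>lborel)"
      by (intro Bochner_Integration.integral_cong refl) (simp add: algebra_simps diff_divide_distrib)
    also have "\<dots> = ((\<integral>x. ?e x * complex_of_real (f (x + h k *\<^sub>R b)) \<partial>lborel) - ?I) / of_real (h k)"
      by (simp only: integral_divide_zero Bochner_Integration.integral_diff[OF int2 int])
    also have "(\<integral>x. ?e x * complex_of_real (f (x + h k *\<^sub>R b)) \<partial>lborel) = exp (- (\<i> * of_real (z \<bullet> b)) * of_real (h k)) * ?I"
    proof -
      have "J = E' * I" if "I = E * J" "E' * E = 1" for I J E E' :: complex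
        using that by (simp add: mult.assoc[symmetric])
      from this[OF shift] show ?thesis
        by (simp add: exp_minus)
    qed
    finally show ?thesis
      by (simp add: algebra_simps)
  qed
  have "((\<lambda>w. (exp (- (\<i> * of_real (z \<bullet> b)) * w) - 1) / w) \<longlongrightarrow> - (\<i> * of_real (z \<bullet> b))) (at 0)"
  proof -
    have "((\<lambda>w. exp (- (\<i> * of_real (z \<bullet> b)) * w)) has_field_derivative - (\<i> * of_real (z \<bullet> b))) (at 0)"
      by (auto intro!: derivative_eq_intros)
    then show ?thesis
      by (simp add: DERIV_def)
  qed
  moreover have "filterlim (\<lambda>k. complex_of_real (h k)) (at 0) sequentially"
    unfolding filterlim_at using h tendsto_of_real[OF h0, where 'a=complex]
    by (auto intro!: always_eventually less_imp_neq[symmetric])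
  ultimately have "(\<lambda>k. (exp (- (\<i> * of_real (z \<bullet> b)) * of_real (h k)) - 1) / of_real (h k)) \<longlonglongrightarrow> - (\<i> * of_real (z \<bullet> b))"
    by (rule filterlim_compose)
  then have "(\<lambda>k. (exp (- (\<i> * of_real (z \<bullet> b)) * of_real (h k)) - 1) / of_real (h k) * ?I) \<longlonglongrightarrow> - (\<i> * of_real (z \<bullet> b)) * ?I"
    by (rule tendsto_mult_right)
  with lim1 have "(\<integral>x. ?e x * of_real (?f' x) \<partial>lborel) = - (\<i> * of_real (z \<bullet> b)) * ?I"
    unfolding eq by (rule LIMSEQ_unique)
  then show ?thesis
    by (simp add: inv_fourier_def scaleR_conv_of_real mult.assoc)
qed

text \<open>Each factor \<open>z \<bullet> b\<close> is traded for a derivative of \<open>f\<close>,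
  which is again a test function; hence the induction on \<open>N\<close> leaves \<open>f\<close>
  arbitrary. The factor \<open>1 + norm z\<close> splits into such products because the norm is at
  most the sum of the coordinates.\<close>

lemma inv_fourier_rapid_decay:
  fixes f :: "'a::euclidean_space \<Rightarrow> real"
  assumes "test_fun f"
  shows "\<exists>C. \<forall>z. (1 + norm z) ^ N * norm (inv_fourier (\<lambda>x. of_real (f x)) z) \<le> C"
  using assms
proof (induction N arbitrary: f)
  case 0
  show ?case
    using norm_inv_fourier_le[of "\<lambda>x. of_real (f x)"] by auto
next
  case (Suc N)
  let ?d = "\<lambda>b x. frechet_derivative f (at x) b"
  obtain C0 where C0: "\<And>z. (1 + norm z) ^ N * norm (inv_fourier (\<lambda>x. of_real (f x)) z) \<le> C0"
    using Suc by blast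
  have "\<exists>C. \<forall>z. (1 + norm z) ^ N * norm (inv_fourier (\<lambda>x. of_real (?d b x)) z) \<le> C" for b
    by (rule Suc.IH) (rule test_fun_deriv[OF Suc.prems])
  then obtain C where C: "\<And>b z. (1 + norm z) ^ N * norm (inv_fourier (\<lambda>x. of_real (?d b x)) z) \<le> C b"
    by metis
  have "(1 + norm z) ^ Suc N * norm (inv_fourier (\<lambda>x. of_real (f x)) z) \<le> C0 + (\<Sum>b\<in>Basis. C b)" for z
  proof -
    let ?u = "norm (inv_fourier (\<lambda>x. of_real (f x)) z)"
    have "(1 + norm z) * ?u \<le> (1 + (\<Sum>b\<in>Basis. \<bar>z \<bullet> b\<bar>)) * ?u"
      by (intro mult_right_mono add_left_mono norm_le_l1) auto
    also have "\<dots> = ?u + (\<Sum>b\<in>Basis. norm (of_real (z \<bullet> b) * inv_fourier (\<lambda>x. of_real (f x)) z))"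
      by (simp add: distrib_right sum_distrib_right norm_mult)
    also have "\<dots> = ?u + (\<Sum>b\<in>Basis. norm (inv_fourier (\<lambda>x. of_real (?d b x)) z))"
      by (simp add: inner_mult_inv_fourier[OF Suc.prems] norm_mult)
    finally have "(1 + norm z) ^ N * ((1 + norm z) * ?u)
        \<le> (1 + norm z) ^ N * (?u + (\<Sum>b\<in>Basis. norm (inv_fourier (\<lambda>x. of_real (?d b x)) z)))"
      by (intro mult_left_mono) auto
    also have "\<dots> = (1 + norm z) ^ N * ?u + (\<Sum>b\<in>Basis. (1 + norm z) ^ N * norm (inv_fourier (\<lambda>x. of_real (?d b x)) z))"
      by (simp add: distrib_left sum_distrib_left)
    also have "\<dots> \<le> C0 + (\<Sum>b\<in>Basis. C b)"
      by (intro add_mono sum_mono C0 C)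
    finally show ?thesis
      by (simp add: mult_ac)
  qed
  then show ?case by blast
qed

lemma schwartz_inv_fourier:
  fixes f :: "'a::euclidean_space \<Rightarrow> real"
  assumes f: "test_fun f"
  shows "schwartz (inv_fourier (\<lambda>x. of_real (f x)))"
  unfolding schwartz_def
proof (intro allI impI conjI)
  fix vs :: "'a list" and x and N :: nat
  let ?g = "\<lambda>x. f x * prod_list (map ((\<bullet>) x) vs)"
  have g: "test_fun ?g" and
    eq: "iter_partial vs (inv_fourier (\<lambda>x. of_real (f x))) = (\<lambda>z. \<i> ^ length vs * inv_fourier (\<lambda>x. of_real (?g x)) z)"
    by (rule iter_partial_inv_fourier[OF f])+
  show "iter_partial vs (inv_fourier (\<lambda>x. of_real (f x))) differentiable at x"
    unfolding eq using has_derivative_mult_right[OF inv_fourier_has_derivative[OF g]]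
    by (rule differentiableI)
  obtain C where "\<And>z. (1 + norm z) ^ N * norm (inv_fourier (\<lambda>x. of_real (?g x)) z) \<le> C"
    using inv_fourier_rapid_decay[OF g] by blast
  then show "bounded (range (\<lambda>x. (1 + norm x) ^ N *\<^sub>R iter_partial vs (inv_fourier (\<lambda>x. of_real (f x))) x))"
    unfolding eq by (intro boundedI[of _ C]) (auto simp: norm_mult norm_power)
qed

text \<open>Derivatives commute with bounded linear maps. It serves to place a scalar Schwartz
  function into one component of a spinor.\<close>

lemma schwartz_bounded_linear:
  fixes f :: "'a::euclidean_space \<Rightarrow> 'b::real_normed_vector" and L :: "'b \<Rightarrow> 'c::real_normed_vector"
  assumes L: "bounded_linear L" and f: "schwartz f"
  shows "schwartz (\<lambda>x. L (f x))"
proof -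
  have D: "iter_partial vs f differentiable at x" if "set vs \<subseteq> Basis" for vs x
    using f that by (simp add: schwartz_def)
  have eq: "iter_partial vs (\<lambda>x. L (f x)) = (\<lambda>x. L (iter_partial vs f x))" if "set vs \<subseteq> Basis" for vs
    using that
  proof (induction vs)
    case (Cons v vs)
    then have IH: "iter_partial vs (\<lambda>x. L (f x)) = (\<lambda>x. L (iter_partial vs f x))" by simp
    have "((\<lambda>x. L (iter_partial vs f x)) has_derivative (\<lambda>v. L (frechet_derivative (iter_partial vs f) (at x) v))) (at x)" for x
      using Cons.prems by (intro bounded_linear.has_derivative[OF L] frechet_derivative_works[THEN iffD1] D) auto
    from frechet_derivative_at[OF this, symmetric] show ?case
      by (simp add: IH)
  qed simp
  show ?thesis
    unfolding schwartz_def
  proof (intro allI impI conjI)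
    fix vs :: "'a list" and x and N :: nat
    assume vs: "set vs \<subseteq> Basis"
    show "iter_partial vs (\<lambda>x. L (f x)) differentiable at x"
      unfolding eq[OF vs] using D[OF vs]
      by (metis L bounded_linear.has_derivative differentiable_def)
    have "bounded (L ` range (\<lambda>x. (1 + norm x) ^ N *\<^sub>R iter_partial vs f x))"
      by (rule bounded_linear_image[OF _ L]) (use f vs in \<open>simp add: schwartz_def\<close>)
    moreover have "L ` range (\<lambda>x. (1 + norm x) ^ N *\<^sub>R iter_partial vs f x)
        = range (\<lambda>x. (1 + norm x) ^ N *\<^sub>R iter_partial vs (\<lambda>x. L (f x)) x)"
      unfolding eq[OF vs] by (simp add: image_image linear_cmul[OF bounded_linear.linear[OF L]])
    ultimately show "bounded (range (\<lambda>x. (1 + norm x) ^ N *\<^sub>R iter_partial vs (\<lambda>x. L (f x)) x))"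
      by simp
  qed
qed

lemma integrable_inverse_1_plus_square_real: "integrable lborel (\<lambda>x::real. 1 / (1 + x\<^sup>2))"
  using integrable_inverse_1_plus_square
  by (simp add: set_integrable_def inverse_eq_divide)

lemma integrable_prod_inverse_1_plus_square:
  "integrable lborel (\<lambda>z::'a::euclidean_space. \<Prod>b\<in>Basis. 1 / (1 + (z \<bullet> b)\<^sup>2))"
  by (intro integrable_lborel_prod_Basis integrable_inverse_1_plus_square_real)

text \<open>Each of the \<open>DIM('a)\<close> factors \<open>1 + (z \<bullet> b)\<^sup>2\<close> is
  at most \<open>(1 + norm z)\<^sup>2\<close>, which explains the exponent. Integrability of this
  power of the norm thus reduces to one-dimensional integrals.\<close>

lemma inverse_norm_power_le_prod:
  fixes z :: "'a::euclidean_space"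
  shows "1 / (1 + norm z) ^ (2 * DIM('a)) \<le> (\<Prod>b\<in>Basis. 1 / (1 + (z \<bullet> b)\<^sup>2))"
proof -
  have "(\<Prod>b\<in>Basis. 1 + (z \<bullet> b)\<^sup>2) \<le> (\<Prod>b\<in>(Basis::'a set). (1 + norm z)\<^sup>2)"
  proof (intro prod_mono conjI)
    fix b :: 'a assume "b \<in> Basis"
    then have "(z \<bullet> b)\<^sup>2 \<le> (norm z)\<^sup>2"
      using Basis_le_norm[of b z] by (metis abs_ge_zero power2_abs power_mono)
    then show "1 + (z \<bullet> b)\<^sup>2 \<le> (1 + norm z)\<^sup>2"
      by (simp add: power2_sum add_increasing2)
  qed auto
  also have "\<dots> = (1 + norm z) ^ (2 * DIM('a))"
    by (simp add: power_mult)
  finally have "(\<Prod>b\<in>Basis. 1 + (z \<bullet> b)\<^sup>2) \<le> (1 + norm z) ^ (2 * DIM('a))" .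
  moreover have "(\<Prod>b\<in>Basis. 1 + (z \<bullet> b)\<^sup>2) > 0"
    by (intro prod_pos) (simp add: add_pos_nonneg)
  ultimately show ?thesis
    by (simp add: prod_dividef frac_le)
qed

lemma inv_fourier_decay_power:
  fixes f :: "'a::euclidean_space \<Rightarrow> real"
  assumes f: "test_fun f"
  obtains C where "\<And>z. norm (inv_fourier (\<lambda>x. of_real (f x)) z) \<le> C / (1 + norm z) ^ N"
proof -
  obtain C where C: "\<And>z. (1 + norm z) ^ N * norm (inv_fourier (\<lambda>x. of_real (f x)) z) \<le> C"
    using inv_fourier_rapid_decay[OF f] by blast
  have pos: "(1 + norm z) ^ N > 0" for z :: 'a
    by (intro zero_less_power) (simp add: add_pos_nonneg)
  show thesis
    by (rule that[of C]) (use C pos in \<open>simp add: pos_le_divide_eq mult.commute\<close>)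
qed

lemma borel_measurable_inv_fourier:
  "test_fun f \<Longrightarrow> inv_fourier (\<lambda>x. of_real (f x)) \<in> borel_measurable borel"
  by (intro borel_measurable_continuous_onI continuous_at_imp_continuous_on ballI
      has_derivative_continuous[OF inv_fourier_has_derivative])

lemma integrable_inv_fourier:
  fixes f :: "'a::euclidean_space \<Rightarrow> real"
  assumes f: "test_fun f"
  shows "integrable lborel (inv_fourier (\<lambda>x. of_real (f x)))"
proof -
  obtain C where C: "\<And>z. norm (inv_fourier (\<lambda>x. of_real (f x)) z) \<le> C / (1 + norm z) ^ (2 * DIM('a))"
    using inv_fourier_decay_power[OF f] by blast
  have C0: "C \<ge> 0"
    using order_trans[OF norm_ge_zero C[of 0]] by simp
  show ?thesis
  proof (rule Bochner_Integration.integrable_bound)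
    show "integrable lborel (\<lambda>z::'a. C * (\<Prod>b\<in>Basis. 1 / (1 + (z \<bullet> b)\<^sup>2)))"
      by (intro integrable_mult_right integrable_prod_inverse_1_plus_square)
    have "norm (inv_fourier (\<lambda>x. of_real (f x)) z) \<le> norm (C * (\<Prod>b\<in>Basis. 1 / (1 + (z \<bullet> b)\<^sup>2)))" for z
    proof -
      have "norm (inv_fourier (\<lambda>x. of_real (f x)) z) \<le> C * (1 / (1 + norm z) ^ (2 * DIM('a)))"
        using C[of z] by simp
      also have "\<dots> \<le> C * (\<Prod>b\<in>Basis. 1 / (1 + (z \<bullet> b)\<^sup>2))"
        by (intro mult_left_mono inverse_norm_power_le_prod C0)
      finally show ?thesis by simp
    qed
    then show "AE z in lborel. norm (inv_fourier (\<lambda>x. of_real (f x)) z) \<le> norm (C * (\<Prod>b\<in>Basis. 1 / (1 + (z \<bullet> b)\<^sup>2)))"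
      by (rule AE_I2)
  qed (use borel_measurable_inv_fourier[OF f] in simp)
qed

lemma fourier_inv_fourier_test_fun:
  assumes "test_fun f"
  shows "fourier (inv_fourier (\<lambda>x. of_real (f x))) = (\<lambda>x. of_real (f x))"
proof -
  obtain M where "\<And>x. \<bar>f x\<bar> \<le> M"
    using test_fun_bounded[OF assms] by blast
  then show ?thesis
    using assms
    by (intro ext fourier_inversion integrable_inv_fourier integrable_complex_test_fun)
       (auto intro!: continuous_intros continuous_on_test_fun)
qed

section \<open>Products and partial Fourier transforms\<close>

lemma borel_measurable_cnj [measurable (raw)]:
  assumes "f \<in> borel_measurable M"
  shows "(\<lambda>x. cnj (f x)) \<in> borel_measurable M"
  using assms by (rule measurable_compose) (intro borel_measurable_continuous_onI continuous_intros)

lemma borel_measurable_inv_fourier_integrable: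
  fixes G :: "'a::euclidean_space \<Rightarrow> complex"
  assumes "integrable lborel G"
  shows "inv_fourier G \<in> borel_measurable borel"
proof -
  have [measurable]: "G \<in> borel_measurable borel"
    using borel_measurable_integrable[OF assms] by simp
  show ?thesis
    unfolding inv_fourier_def[abs_def] by measurable
qed

lemma continuous_on_parametric_integral:
  fixes f :: "'a::metric_space \<Rightarrow> 'b \<Rightarrow> 'c::{banach,second_countable_topology}"
  assumes cont: "\<And>y. continuous_on UNIV (\<lambda>x. f x y)"
    and meas: "\<And>x. f x \<in> borel_measurable M"
    and w: "integrable M w" and bound: "\<And>x y. norm (f x y) \<le> w y"
  shows "continuous_on UNIV (\<lambda>x. \<integral>y. f x y \<partial>M)"
  unfolding continuous_on_sequentially
proof (intro allI ballI impI, elim conjE)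
  fix X :: "nat \<Rightarrow> 'a" and x assume "X \<longlonglongrightarrow> x"
  show "(((\<lambda>x. \<integral>y. f x y \<partial>M) \<circ> X) \<longlonglongrightarrow> (\<integral>y. f x y \<partial>M))"
    unfolding o_def
  proof (rule integral_dominated_convergence[where w=w])
    show "AE y in M. (\<lambda>n. f (X n) y) \<longlonglongrightarrow> f x y"
      using cont \<open>X \<longlonglongrightarrow> x\<close> by (intro AE_I2) (auto simp: continuous_on_sequentially o_def)
  qed (use meas w bound in auto)
qed

text \<open>By Fubini the product is itself the inverse transform of the correlation
  \<open>K\<close>, so the inversion theorem applied to \<open>K\<close> gives the claim. The
  hypotheses are asymmetric on purpose: continuity and boundedness of \<open>J\<close> pass to
  \<open>K\<close>, while \<open>H\<close> may carry the jump of the projection symbol.\<close>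

lemma fourier_mult_cnj:
  fixes J H :: "'a::euclidean_space \<Rightarrow> complex"
  assumes J: "integrable lborel J" "continuous_on UNIV J" "\<And>x. norm (J x) \<le> M"
    and H: "integrable lborel H"
    and prod: "integrable lborel (\<lambda>z. inv_fourier J z * cnj (inv_fourier H z))"
  shows "fourier (\<lambda>z. inv_fourier J z * cnj (inv_fourier H z)) \<zeta>
    = (1 / (2 * pi) ^ DIM('a)) *\<^sub>R (\<integral>\<eta>. J (\<zeta> + \<eta>) * cnj (H \<eta>) \<partial>lborel)"
proof -
  let ?c = "1 / (2 * pi) ^ DIM('a)"
  have [measurable]: "J \<in> borel_measurable borel" "H \<in> borel_measurable borel"
    using borel_measurable_integrable[OF J(1)] borel_measurable_integrable[OF H] by simp_all
  have Jshift: "integrable lborel (\<lambda>\<zeta>. J (\<zeta> + \<eta>))" "(\<integral>\<zeta>. norm (J (\<zeta> + \<eta>)) \<partial>lborel) = (\<integral>\<zeta>. norm (J \<zeta>) \<partial>lborel)" for \<eta>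
    using J(1) integrable_lborel_affine[of J 1 \<eta>] integral_lborel_affine[of "\<lambda>x. norm (J x)" 1 \<eta>]
    by (simp_all add: add.commute)
  define K where "K \<zeta> = ?c *\<^sub>R (\<integral>\<eta>. J (\<zeta> + \<eta>) * cnj (H \<eta>) \<partial>lborel)" for \<zeta>
  have intP: "integrable (lborel \<Otimes>\<^sub>M lborel) (\<lambda>(\<eta>, \<zeta>). J (\<zeta> + \<eta>) * cnj (H \<eta>))"
  proof (rule lborel_pair.Fubini_integrable)
    show "integrable lborel (\<lambda>\<eta>. \<integral>\<zeta>. norm (case (\<eta>, \<zeta>) of (\<eta>, \<zeta>) \<Rightarrow> J (\<zeta> + \<eta>) * cnj (H \<eta>)) \<partial>lborel)"
      using H by (simp add: norm_mult Jshift)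
    show "AE \<eta> in lborel. integrable lborel (\<lambda>\<zeta>. case (\<eta>, \<zeta>) of (\<eta>, \<zeta>) \<Rightarrow> J (\<zeta> + \<eta>) * cnj (H \<eta>))"
      using Jshift by simp
  qed measurable
  have intK: "integrable lborel K"
    unfolding K_def using lborel_pair.integrable_snd[OF intP] by (intro integrable_scaleR_right) simp
  \<comment> \<open>After exchanging the integrals, the shift by \<open>\<eta>\<close> splits the
    phase into one factor for \<open>J\<close> and a conjugate one for \<open>H\<close>.\<close>
  have eq: "inv_fourier J z * cnj (inv_fourier H z) = inv_fourier K z" for z
  proof -
    have intP': "integrable (lborel \<Otimes>\<^sub>M lborel) (\<lambda>(\<eta>, \<zeta>). exp (\<i> * of_real (z \<bullet> \<zeta>)) * (J (\<zeta> + \<eta>) * cnj (H \<eta>)))"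
      by (rule Bochner_Integration.integrable_bound[OF intP]) (auto simp: norm_mult)
    have "inv_fourier K z = ?c *\<^sub>R (\<integral>\<zeta>. ?c *\<^sub>R (\<integral>\<eta>. exp (\<i> * of_real (z \<bullet> \<zeta>)) * (J (\<zeta> + \<eta>) * cnj (H \<eta>)) \<partial>lborel) \<partial>lborel)"
      unfolding inv_fourier_def K_def by (simp only: integral_mult_right_zero mult_scaleR_right)
    also have "\<dots> = ?c *\<^sub>R ?c *\<^sub>R (\<integral>\<eta>. (\<integral>\<zeta>. exp (\<i> * of_real (z \<bullet> \<zeta>)) * (J (\<zeta> + \<eta>) * cnj (H \<eta>)) \<partial>lborel) \<partial>lborel)"
      using lborel_pair.Fubini_integral[OF intP'] by (simp only: integral_scaleR_right)
    also have "(\<lambda>\<eta>. \<integral>\<zeta>. exp (\<i> * of_real (z \<bullet> \<zeta>)) * (J (\<zeta> + \<eta>) * cnj (H \<eta>)) \<partial>lborel)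
        = (\<lambda>\<eta>. (\<integral>\<zeta>. exp (\<i> * of_real (z \<bullet> \<zeta>)) * J \<zeta> \<partial>lborel) * cnj (exp (\<i> * of_real (z \<bullet> \<eta>)) * H \<eta>))"
    proof
      fix \<eta> :: 'a
      have "(\<lambda>\<zeta>. exp (\<i> * of_real (z \<bullet> \<zeta>)) * (J (\<zeta> + \<eta>) * cnj (H \<eta>)))
        = (\<lambda>\<zeta>. (exp (\<i> * of_real (z \<bullet> (\<eta> + 1 *\<^sub>R \<zeta>))) * J (\<eta> + 1 *\<^sub>R \<zeta>)) * cnj (exp (\<i> * of_real (z \<bullet> \<eta>)) * H \<eta>))"
      proof
        fix \<zeta>
        let ?E = "exp (\<i> * of_real (z \<bullet> \<eta>))"
        have "?E * cnj ?E = 1"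
          by (simp flip: complex_norm_square)
        moreover have "exp (\<i> * of_real (z \<bullet> (\<eta> + 1 *\<^sub>R \<zeta>))) = ?E * exp (\<i> * of_real (z \<bullet> \<zeta>))"
          by (simp add: inner_add_right distrib_left exp_add)
        moreover have "E * X * j * (Ec * h) = (E * Ec) * (X * (j * h))" for E X j Ec h :: complex
          by (simp only: mult_ac)
        ultimately show "exp (\<i> * of_real (z \<bullet> \<zeta>)) * (J (\<zeta> + \<eta>) * cnj (H \<eta>))
          = (exp (\<i> * of_real (z \<bullet> (\<eta> + 1 *\<^sub>R \<zeta>))) * J (\<eta> + 1 *\<^sub>R \<zeta>)) * cnj (?E * H \<eta>)"
          by (simp only: complex_cnj_mult) (simp add: add.commute)
      qed
      then have "(\<integral>\<zeta>. exp (\<i> * of_real (z \<bullet> \<zeta>)) * (J (\<zeta> + \<eta>) * cnj (H \<eta>)) \<partial>lborel)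
        = (\<integral>\<zeta>. exp (\<i> * of_real (z \<bullet> (\<eta> + 1 *\<^sub>R \<zeta>))) * J (\<eta> + 1 *\<^sub>R \<zeta>) \<partial>lborel) * cnj (exp (\<i> * of_real (z \<bullet> \<eta>)) * H \<eta>)"
        by (simp only: integral_mult_left_zero)
      also have "(\<integral>\<zeta>. exp (\<i> * of_real (z \<bullet> (\<eta> + 1 *\<^sub>R \<zeta>))) * J (\<eta> + 1 *\<^sub>R \<zeta>) \<partial>lborel)
        = (\<integral>\<zeta>. exp (\<i> * of_real (z \<bullet> \<zeta>)) * J \<zeta> \<partial>lborel)"
        by (subst (2) integral_lborel_affine[of _ 1 \<eta>]) simp_all
      finally show "(\<integral>\<zeta>. exp (\<i> * of_real (z \<bullet> \<zeta>)) * (J (\<zeta> + \<eta>) * cnj (H \<eta>)) \<partial>lborel)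
        = (\<integral>\<zeta>. exp (\<i> * of_real (z \<bullet> \<zeta>)) * J \<zeta> \<partial>lborel) * cnj (exp (\<i> * of_real (z \<bullet> \<eta>)) * H \<eta>)" .
    qed
    finally have "inv_fourier K z = ?c *\<^sub>R ?c *\<^sub>R ((\<integral>\<zeta>. exp (\<i> * of_real (z \<bullet> \<zeta>)) * J \<zeta> \<partial>lborel)
        * cnj (\<integral>\<eta>. exp (\<i> * of_real (z \<bullet> \<eta>)) * H \<eta> \<partial>lborel))"
      by (simp only: integral_mult_right_zero Bochner_Integration.integral_cnj)
    then show ?thesis
      by (simp only: inv_fourier_def[of J] inv_fourier_def[of H] complex_cnj_scaleR mult_scaleR_left mult_scaleR_right)
  qed
  \<comment> \<open>The variable of \<open>K\<close> occurs in \<open>J\<close> only, so dominated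
    convergence with majorant \<open>M * norm (H y)\<close> needs no regularity of
    \<open>H\<close>.\<close>
  have contK: "continuous_on UNIV K"
    unfolding K_def
  proof (intro continuous_on_scaleR continuous_on_const continuous_on_parametric_integral[where w="\<lambda>y. M * norm (H y)"])
    show "continuous_on UNIV (\<lambda>x. J (x + y) * cnj (H y))" for y
      by (intro continuous_intros continuous_on_compose2[OF J(2)]) auto
    show "norm (J (x + y) * cnj (H y)) \<le> M * norm (H y)" for x y
      using J(3) by (simp add: norm_mult mult_right_mono)
  qed (use H in auto)
  have bddK: "norm (K x) \<le> ?c * (\<integral>y. M * norm (H y) \<partial>lborel)" for x
  proof -
    have "norm (\<integral>\<eta>. J (x + \<eta>) * cnj (H \<eta>) \<partial>lborel) \<le> (\<integral>y. M * norm (H y) \<partial>lborel)"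
    proof (rule Bochner_Integration.integral_norm_bound_integral)
      show "integrable lborel (\<lambda>\<eta>. J (x + \<eta>) * cnj (H \<eta>))"
        by (rule Bochner_Integration.integrable_bound[of _ "\<lambda>y. M * norm (H y)"])
           (use H J(3) in \<open>auto simp: norm_mult intro!: AE_I2 order_trans[OF mult_right_mono abs_ge_self]\<close>)
      show "norm (J (x + y) * cnj (H y)) \<le> M * norm (H y)" for y
        using J(3) by (simp add: norm_mult mult_right_mono)
    qed (use H in auto)
    then show ?thesis
      unfolding K_def norm_scaleR by (simp add: divide_right_mono)
  qed
  show ?thesis
    unfolding eq
    by (rule trans[OF fourier_inversion[OF _ intK contK bddK]]) (use prod in \<open>simp only: eq\<close>, simp only: K_def)
qed

text \<open>The partial inverse transform in the time frequency. It will be identified with the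
  spatial transform, at time \<open>t\<close>, of the function whose space-time transform is
  \<open>F\<close>; that is the object on which \<open>x_multiplier\<close> acts.\<close>

definition time_slice :: "(real \<times> 'b::euclidean_space \<Rightarrow> real) \<Rightarrow> real \<Rightarrow> 'b \<Rightarrow> complex" where
  "time_slice F t \<xi> = (1 / (2 * pi)) *\<^sub>R (\<integral>\<tau>. exp (\<i> * of_real (t * \<tau>)) * of_real (F (\<tau>, \<xi>)) \<partial>lborel)"

context
  fixes F :: "real \<times> 'b::euclidean_space \<Rightarrow> real"
  assumes F: "test_fun F"
begin

lemma test_fun_slice_measurable [measurable]: "F \<in> borel_measurable borel"
  by (rule borel_measurable_test_fun[OF F])

text \<open>The majorant depends on \<open>\<tau>\<close> alone, as dominated convergence with
  \<open>\<xi>\<close> varying requires.\<close>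

lemma test_fun_slice_bound:
  obtains M R where "M > 0" "\<And>\<tau> \<xi>. \<bar>F (\<tau>, \<xi>)\<bar> \<le> indicator {-R..R} \<tau> * M"
    "\<And>\<tau> \<xi>. norm \<xi> > R \<Longrightarrow> F (\<tau>, \<xi>) = 0"
proof -
  obtain R where R: "\<And>x. F x \<noteq> 0 \<Longrightarrow> norm x \<le> R"
    using F unfolding test_fun_def by auto
  obtain M where M: "M > 0" "\<And>x. \<bar>F x\<bar> \<le> M"
    using test_fun_bounded[OF F] by blast
  show thesis
  proof (rule that[OF M(1)])
    show "\<bar>F (\<tau>, \<xi>)\<bar> \<le> indicator {-R..R} \<tau> * M" for \<tau> \<xi>
      using M(2)[of "(\<tau>, \<xi>)"] R[of "(\<tau>, \<xi>)"] norm_fst_le[of \<tau> \<xi>]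
      by (cases "F (\<tau>, \<xi>) = 0") (auto simp: indicator_def M(1) less_imp_le)
    show "norm \<xi> > R \<Longrightarrow> F (\<tau>, \<xi>) = 0" for \<tau> \<xi>
      using R[of "(\<tau>, \<xi>)"] norm_snd_le[of \<xi> \<tau>] by force
  qed
qed

lemma continuous_on_time_slice: "continuous_on UNIV (time_slice F t)"
proof -
  obtain M R where M: "\<And>\<tau> \<xi>. \<bar>F (\<tau>, \<xi>)\<bar> \<le> indicator {-R..R} \<tau> * M"
    using test_fun_slice_bound by metis
  show ?thesis
    unfolding time_slice_def[abs_def]
  proof (intro continuous_on_scaleR continuous_on_const continuous_on_parametric_integral)
    show "continuous_on UNIV (\<lambda>\<xi>. exp (\<i> * of_real (t * \<tau>)) * of_real (F (\<tau>, \<xi>)))" for \<tau>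
      by (intro continuous_intros continuous_on_compose2[OF continuous_on_test_fun[OF F]]) auto
    show "norm (exp (\<i> * of_real (t * \<tau>)) * of_real (F (\<tau>, \<xi>))) \<le> indicator {-R..R} \<tau> * M" for \<tau> \<xi>
      using M by (simp only: norm_mult norm_exp_i_times norm_of_real mult_1)
    show "integrable lborel (\<lambda>\<tau>. indicator {-R..R} \<tau> * M)"
      by (intro integrable_mult_left integrable_real_indicator) (auto simp: emeasure_lborel_Icc_eq)
  qed auto
qed

lemma norm_time_slice_bounded: "\<exists>M. \<forall>\<xi>. norm (time_slice F t \<xi>) \<le> M"
proof -
  obtain M R where M: "M > 0" "\<And>\<tau> \<xi>. \<bar>F (\<tau>, \<xi>)\<bar> \<le> indicator {-R..R} \<tau> * M"
    using test_fun_slice_bound by metis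
  have "norm (time_slice F t \<xi>) \<le> (1 / (2 * pi)) * (\<integral>\<tau>. indicator {-R..R} \<tau> * M \<partial>lborel)" for \<xi>
    unfolding time_slice_def norm_scaleR
  proof (intro mult_mono Bochner_Integration.integral_norm_bound_integral)
    have le: "norm (exp (\<i> * of_real (t * \<tau>)) * of_real (F (\<tau>, \<xi>))) \<le> indicator {-R..R} \<tau> * M" for \<tau>
      using M by (simp only: norm_mult norm_exp_i_times norm_of_real mult_1)
    then show "norm (exp (\<i> * of_real (t * \<tau>)) * of_real (F (\<tau>, \<xi>))) \<le> indicator {-R..R} \<tau> * M" for \<tau> .
    show int: "integrable lborel (\<lambda>\<tau>. indicator {-R..R} \<tau> * M)"
      by (intro integrable_mult_left integrable_real_indicator) (auto simp: emeasure_lborel_Icc_eq)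
    show "integrable lborel (\<lambda>\<tau>. exp (\<i> * of_real (t * \<tau>)) * complex_of_real (F (\<tau>, \<xi>)))"
      by (rule Bochner_Integration.integrable_bound[OF int])
         (use le in \<open>auto intro!: AE_I2 intro: order_trans[OF _ abs_ge_self]\<close>)
  qed auto
  then show ?thesis by blast
qed

text \<open>Fubini: invert in \<open>\<tau>\<close> first, then in \<open>\<xi>\<close>; the
  multiplier passes through the first step because it depends on \<open>\<xi>\<close> only. It is
  assumed merely bounded and measurable since the entries of \<open>dirac_proj\<close> jump at
  0.\<close>

lemma
  assumes m[measurable]: "m \<in> borel_measurable borel" and m1: "\<And>\<xi>. norm (m \<xi>) \<le> c"
  shows integrable_mult_time_slice: "integrable lborel (\<lambda>\<xi>. m \<xi> * time_slice F t \<xi>)"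
    and inv_fourier_mult_test_fun:
      "inv_fourier (\<lambda>(\<tau>, \<xi>). m \<xi> * complex_of_real (F (\<tau>, \<xi>))) (t, x)
        = inv_fourier (\<lambda>\<xi>. m \<xi> * time_slice F t \<xi>) x"
proof -
  have int: "integrable lborel (\<lambda>(\<tau>, \<xi>). m \<xi> * complex_of_real (F (\<tau>, \<xi>)))"
  proof (rule Bochner_Integration.integrable_bound)
    show "integrable lborel (\<lambda>z. c * F z)"
      by (intro integrable_mult_right integrable_test_fun F)
    have "norm (m \<xi>) * \<bar>F (\<tau>, \<xi>)\<bar> \<le> \<bar>c\<bar> * \<bar>F (\<tau>, \<xi>)\<bar>" for \<tau> \<xi>
      using m1[of \<xi>] by (intro mult_right_mono) auto
    then show "AE z in lborel. norm (case z of (\<tau>, \<xi>) \<Rightarrow> m \<xi> * complex_of_real (F (\<tau>, \<xi>))) \<le> norm (c * F z)"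
      by (intro AE_I2) (auto simp: norm_mult abs_mult)
  qed (simp add: borel_prod[symmetric])
  have int2: "integrable (lborel \<Otimes>\<^sub>M lborel)
      (\<lambda>(\<tau>, \<xi>). exp (\<i> * of_real (t * \<tau> + x \<bullet> \<xi>)) * (m \<xi> * complex_of_real (F (\<tau>, \<xi>))))" for x
    unfolding lborel_prod
    by (rule Bochner_Integration.integrable_bound[OF int])
       (auto simp: norm_mult split_beta borel_prod[symmetric])
  have slice: "(\<integral>\<tau>. exp (\<i> * of_real (t * \<tau> + x \<bullet> \<xi>)) * (m \<xi> * complex_of_real (F (\<tau>, \<xi>))) \<partial>lborel)
      = (2 * pi) *\<^sub>R (exp (\<i> * of_real (x \<bullet> \<xi>)) * (m \<xi> * time_slice F t \<xi>))" for x \<xi>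
  proof -
    have "(\<lambda>\<tau>. exp (\<i> * of_real (t * \<tau> + x \<bullet> \<xi>)) * (m \<xi> * complex_of_real (F (\<tau>, \<xi>))))
      = (\<lambda>\<tau>. exp (\<i> * of_real (x \<bullet> \<xi>)) * m \<xi> * (exp (\<i> * of_real (t * \<tau>)) * complex_of_real (F (\<tau>, \<xi>))))"
      by (rule ext) (simp add: distrib_left exp_add)
    then show ?thesis
      by (simp only: integral_mult_right_zero) (simp add: time_slice_def)
  qed
  have "integrable lborel (\<lambda>\<xi>. (1 / (2 * pi)) *\<^sub>R ((2 * pi) *\<^sub>R (exp (\<i> * of_real (0 \<bullet> \<xi>)) * (m \<xi> * time_slice F t \<xi>))))"
    using lborel_pair.integrable_snd[OF int2[of 0]] unfolding slice by (rule integrable_scaleR_right)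
  then show "integrable lborel (\<lambda>\<xi>. m \<xi> * time_slice F t \<xi>)"
    by simp
  have "(\<integral>\<zeta>. exp (\<i> * of_real ((t, x) \<bullet> \<zeta>)) * (case \<zeta> of (\<tau>, \<xi>) \<Rightarrow> m \<xi> * complex_of_real (F (\<tau>, \<xi>))) \<partial>lborel)
     = (\<integral>\<zeta>. (case \<zeta> of (\<tau>, \<xi>) \<Rightarrow> exp (\<i> * of_real (t * \<tau> + x \<bullet> \<xi>)) * (m \<xi> * complex_of_real (F (\<tau>, \<xi>)))) \<partial>(lborel \<Otimes>\<^sub>M lborel))"
    unfolding lborel_prod by (intro Bochner_Integration.integral_cong refl) (auto simp: inner_prod_def)
  also have "\<dots> = (\<integral>\<xi>. (2 * pi) *\<^sub>R (exp (\<i> * of_real (x \<bullet> \<xi>)) * (m \<xi> * time_slice F t \<xi>)) \<partial>lborel)"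
    using lborel_pair.integral_snd[OF int2[of x]] unfolding slice by simp
  finally show "inv_fourier (\<lambda>(\<tau>, \<xi>). m \<xi> * complex_of_real (F (\<tau>, \<xi>))) (t, x)
        = inv_fourier (\<lambda>\<xi>. m \<xi> * time_slice F t \<xi>) x"
    unfolding inv_fourier_def by simp
qed

text \<open>Space-time integrability says nothing about one particular time, so the pointwise decay
  is used, together with \<open>norm x \<le> norm (t, x)\<close>.\<close>

lemma integrable_inv_fourier_slice:
  "integrable lborel (\<lambda>x. inv_fourier (\<lambda>z. complex_of_real (F z)) (t, x))"
proof -
  obtain C where C: "\<And>z. norm (inv_fourier (\<lambda>x. of_real (F x)) z) \<le> C / (1 + norm z) ^ (2 * DIM('b))"
    using inv_fourier_decay_power[OF F] by blast
  have C0: "C \<ge> 0"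
    using order_trans[OF norm_ge_zero C[of 0]] by simp
  have [measurable]: "inv_fourier (\<lambda>z. complex_of_real (F z)) \<in> borel_measurable borel"
    by (rule borel_measurable_inv_fourier[OF F])
  show ?thesis
  proof (rule Bochner_Integration.integrable_bound)
    show "integrable lborel (\<lambda>z::'b. C * (\<Prod>b\<in>Basis. 1 / (1 + (z \<bullet> b)\<^sup>2)))"
      by (intro integrable_mult_right integrable_prod_inverse_1_plus_square)
    have "norm (inv_fourier (\<lambda>x. of_real (F x)) (t, x)) \<le> norm (C * (\<Prod>b\<in>Basis. 1 / (1 + (x \<bullet> b)\<^sup>2)))" for x
    proof -
      have "norm (inv_fourier (\<lambda>x. of_real (F x)) (t, x)) \<le> C / (1 + norm (t, x)) ^ (2 * DIM('b))"
        by (rule C)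
      also have "\<dots> \<le> C / (1 + norm x) ^ (2 * DIM('b))"
        using norm_snd_le[of x t] C0
        by (intro divide_left_mono power_mono mult_pos_pos zero_less_power) (auto simp: add_pos_nonneg)
      also have "\<dots> = C * (1 / (1 + norm x) ^ (2 * DIM('b)))"
        by simp
      also have "\<dots> \<le> C * (\<Prod>b\<in>Basis. 1 / (1 + (x \<bullet> b)\<^sup>2))"
        by (intro mult_left_mono inverse_norm_power_le_prod C0)
      finally show ?thesis by simp
    qed
    then show "AE x in lborel. norm (inv_fourier (\<lambda>x. of_real (F x)) (t, x)) \<le> norm (C * (\<Prod>b\<in>Basis. 1 / (1 + (x \<bullet> b)\<^sup>2)))"
      by (rule AE_I2)
  qed simp
qed

text \<open>With the trivial multiplier 1, the time slice is exhibited as an inverse transform in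
  space alone, to which the inversion theorem applies.\<close>

lemma fourier_inv_fourier_slice:
  "fourier (\<lambda>x. inv_fourier (\<lambda>z. complex_of_real (F z)) (t, x)) = time_slice F t"
proof -
  have eq: "inv_fourier (\<lambda>z. complex_of_real (F z)) (t, x) = inv_fourier (time_slice F t) x" for x
    using inv_fourier_mult_test_fun[of "\<lambda>_. 1" 1 t x] by (simp add: case_prod_unfold)
  have int: "integrable lborel (time_slice F t)"
    using integrable_mult_time_slice[of "\<lambda>_. 1" 1 t] by simp
  obtain M where M: "\<And>\<xi>. norm (time_slice F t \<xi>) \<le> M"
    using norm_time_slice_bounded by blast
  show ?thesis
    using fourier_inversion[OF _ int continuous_on_time_slice M] integrable_inv_fourier_slice[of t]
    unfolding eq by auto
qed

end

section \<open>The Dirac product of two waves\<close>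

lemma bounded_linear_axis: "bounded_linear (axis k :: complex \<Rightarrow> complex ^ 'n)"
  unfolding linear_conv_bounded_linear[symmetric]
  by (rule linearI) (simp_all add: vec_eq_iff axis_def)

lemma integrable_vecI:
  fixes f :: "'a \<Rightarrow> complex ^ 'n"
  assumes "\<And>k. integrable M (\<lambda>x. f x $ k)"
  shows "integrable M f"
proof -
  have "f x = (\<Sum>k\<in>UNIV. axis k (f x $ k))" for x
    by (simp add: vec_eq_iff axis_def)
  then have "f = (\<lambda>x. \<Sum>k\<in>UNIV. axis k (f x $ k))" ..
  moreover have "integrable M (\<lambda>x. \<Sum>k\<in>UNIV. axis k (f x $ k))"
    by (intro Bochner_Integration.integrable_sum integrable_bounded_linear[OF bounded_linear_axis] assms)
  ultimately show ?thesis by simp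
qed

lemma integral_vec_nth:
  fixes f :: "'a \<Rightarrow> complex ^ 'n"
  assumes "integrable M f"
  shows "(\<integral>x. f x \<partial>M) $ k = (\<integral>x. f x $ k \<partial>M)"
  using integral_bounded_linear[OF bounded_linear_vec_nth assms] by simp

lemma vector_scalar_mult_axis: "c *s axis k d = axis k (c * d :: complex)"
  by (simp add: vec_eq_iff axis_def)

lemma matrix_vector_mult_axis: "(m *v axis k c) $ l = m $ l $ k * (c :: complex)"
  by (simp add: matrix_vector_mult_def axis_def if_distrib if_distribR cong: if_cong)

text \<open>Prescribed on the Fourier side, so that the \<open>X_norm\<close> is an integral of the
  weights against \<open>F\<close> itself.\<close>

definition wave :: "4 \<Rightarrow> (spacetime \<Rightarrow> real) \<Rightarrow> spacetime \<Rightarrow> spinor" where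
  "wave k F = (\<lambda>z. axis k (inv_fourier (\<lambda>\<zeta>. complex_of_real (F \<zeta>)) z))"

lemma st_fourier_eq_fourier: "st_fourier u = fourier u"
  by (auto simp: st_fourier_def fourier_def fun_eq_iff inner_prod_def case_prod_unfold)

context
  fixes F :: "spacetime \<Rightarrow> real"
  assumes F: "test_fun F"
begin

lemma schwartz_wave: "schwartz (wave k F)"
  unfolding wave_def by (intro schwartz_bounded_linear[OF bounded_linear_axis] schwartz_inv_fourier F)

lemma st_fourier_spinor_wave: "st_fourier_spinor (wave k F) \<zeta> = axis k (complex_of_real (F \<zeta>))"
proof -
  have "st_fourier (\<lambda>z. wave k F z $ l) \<zeta> = (if l = k then of_real (F \<zeta>) else 0)" for l
    unfolding st_fourier_eq_fourier wave_def
    using fun_cong[OF fourier_inv_fourier_test_fun[OF F], of \<zeta>]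
    by (auto simp: axis_def fourier_def)
  then show ?thesis
    by (simp add: st_fourier_spinor_def vec_eq_iff axis_def)
qed

lemma x_fourier_wave: "x_fourier (wave k F) t \<xi> = axis k (time_slice F t \<xi>)"
proof -
  have "x_fourier (wave k F) t \<xi>
    = (\<integral>x. axis k (exp (- (\<i> * of_real (x \<bullet> \<xi>))) * inv_fourier (\<lambda>\<zeta>. complex_of_real (F \<zeta>)) (t, x)) \<partial>lborel)"
    by (simp add: x_fourier_def wave_def vector_scalar_mult_axis)
  also have "\<dots> = axis k (fourier (\<lambda>x. inv_fourier (\<lambda>\<zeta>. complex_of_real (F \<zeta>)) (t, x)) \<xi>)"
    unfolding fourier_def
    by (intro integral_bounded_linear[OF bounded_linear_axis] integrable_iexp_mult integrable_inv_fourier_slice F)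
  finally show ?thesis
    by (simp add: fourier_inv_fourier_slice[OF F])
qed

text \<open>\<open>x_multiplier\<close> acts on the spatial transform at each time separately;
  because its symbol is independent of \<open>\<tau>\<close>, this amounts to multiplying the
  space-time transform. Only column \<open>k\<close> of the symbol is met, as the wave has a single
  component.\<close>

lemma x_multiplier_wave:
  assumes m: "\<And>l. (\<lambda>\<xi>. m \<xi> $ l $ k) \<in> borel_measurable borel" "\<And>l \<xi>. norm (m \<xi> $ l $ k) \<le> c"
  shows "x_multiplier m (wave k F) z $ l
    = inv_fourier (\<lambda>(\<tau>, \<xi>). m \<xi> $ l $ k * complex_of_real (F (\<tau>, \<xi>))) z"
proof (cases z)
  case (Pair t x)
  let ?f = "\<lambda>\<xi>. exp (\<i> * of_real (x \<bullet> \<xi>)) *s (m \<xi> *v x_fourier (wave k F) t \<xi>)"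
  have comp: "?f \<xi> $ l = exp (\<i> * of_real (x \<bullet> \<xi>)) * (m \<xi> $ l $ k * time_slice F t \<xi>)" for \<xi> l
    by (simp add: x_fourier_wave matrix_vector_mult_axis)
  have int: "integrable lborel ?f"
    by (rule integrable_vecI, unfold comp) (intro integrable_iexp_mult integrable_mult_time_slice[OF F m])
  show ?thesis
    by (simp only: Pair x_multiplier_def case_prod_conv vector_scaleR_component integral_vec_nth[OF int] comp
        inv_fourier_mult_test_fun[OF F m]) (simp add: inv_fourier_def)
qed

end

section \<open>Matrix entries of the projections and the null symbol\<close>

lemma dirac_proj_nth:
  "dirac_proj e \<xi> $ l $ k
    = (1/2) *\<^sub>R (mat 1 $ l $ k + e *\<^sub>R (\<Sum>j\<in>UNIV. (\<xi> $ j / norm \<xi>) *\<^sub>R dirac_alpha j $ l $ k))"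
  by (simp add: dirac_proj_def)

lemma borel_measurable_nth_div_norm [measurable]:
  "(\<lambda>\<xi>::real^3. \<xi> $ j / norm \<xi>) \<in> borel_measurable borel"
  by (intro borel_measurable_divide borel_measurable_continuous_onI continuous_intros)

lemma dirac_proj_measurable: "(\<lambda>\<xi>. dirac_proj e \<xi> $ l $ k) \<in> borel_measurable borel"
  unfolding dirac_proj_nth by measurable

lemma nth_div_norm_le_1: "\<bar>\<xi> $ j / norm \<xi>\<bar> \<le> 1" for \<xi> :: "real^3"
  using component_le_norm_cart[of \<xi> j] by (cases "\<xi> = 0") (auto simp: divide_le_eq_1)

lemma dirac_proj_bounded: "\<exists>c. \<forall>\<xi> l. norm (dirac_proj e \<xi> $ l $ k) \<le> c"
proof -
  let ?A = "\<lambda>l. norm (mat 1 $ l $ k :: complex) + \<bar>e\<bar> * (\<Sum>j\<in>UNIV. norm (dirac_alpha j $ l $ k))"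
  have *: "norm (dirac_proj e \<xi> $ l $ k) \<le> ?A l" for \<xi> l
  proof -
    have "norm (\<Sum>j\<in>UNIV. (\<xi> $ j / norm \<xi>) *\<^sub>R dirac_alpha j $ l $ k) \<le> (\<Sum>j\<in>UNIV. norm (dirac_alpha j $ l $ k))"
      by (intro sum_norm_le) (simp only: norm_scaleR real_norm_def nth_div_norm_le_1 mult_left_le_one_le norm_ge_zero abs_ge_zero)
    then have "norm (mat 1 $ l $ k + e *\<^sub>R (\<Sum>j\<in>UNIV. (\<xi> $ j / norm \<xi>) *\<^sub>R dirac_alpha j $ l $ k)) \<le> ?A l"
      by (intro order_trans[OF norm_triangle_ineq] add_left_mono) (simp add: mult_left_mono)
    moreover have "norm ((1/2) *\<^sub>R x) \<le> norm x" for x :: complex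
      by simp
    ultimately show ?thesis
      unfolding dirac_proj_nth by (meson order_trans)
  qed
  have "?A l \<le> (\<Sum>l\<in>UNIV. ?A l)" for l
    by (intro member_le_sum) (auto intro!: add_nonneg_nonneg mult_nonneg_nonneg sum_nonneg)
  with * show ?thesis
    by (meson order_trans)
qed

lemma vector_4:
  "(vector [a, b, c, d] :: 'a::zero ^ 4) $ 1 = a" "(vector [a, b, c, d] :: 'a::zero ^ 4) $ 2 = b"
  "(vector [a, b, c, d] :: 'a::zero ^ 4) $ 3 = c" "(vector [a, b, c, d] :: 'a::zero ^ 4) $ 4 = d"
  unfolding vector_def by simp_all

text \<open>These entries suffice for the pairing of column 3 with column 1: the complex entries, in
  row 4 of column 1 and row 2 of column 3, are each multiplied by one of the zeros listed
  here.\<close>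

lemma dirac_proj_entries:
  "dirac_proj e \<xi> $ 1 $ 1 = 1/2" "dirac_proj e \<xi> $ 2 $ 1 = 0"
  "dirac_proj e \<xi> $ 3 $ 1 = of_real (e / 2 * (\<xi> $ 3 / norm \<xi>))"
  "dirac_proj e \<xi> $ 1 $ 3 = of_real (e / 2 * (\<xi> $ 3 / norm \<xi>))"
  "dirac_proj e \<xi> $ 3 $ 3 = 1/2" "dirac_proj e \<xi> $ 4 $ 3 = 0"
  unfolding dirac_proj_nth
  by (simp_all add: sum_3 dirac_alpha_def block_matrix_def pauli_def vector_4 mat_def scaleR_conv_of_real)

lemma dirac_beta_mult: "dirac_beta *v u = vector [u $ 1, u $ 2, - u $ 3, - u $ 4]"
  by (simp add: vec_eq_iff forall_4 vector_4 matrix_vector_mult_def sum_4 dirac_beta_def block_matrix_def mat_def)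

definition dir3 :: "spacetime \<Rightarrow> real" where
  "dir3 \<zeta> = snd \<zeta> $ 3 / norm (snd \<zeta>)"

lemma dir3_le_1: "\<bar>dir3 \<zeta>\<bar> \<le> 1"
  unfolding dir3_def by (rule nth_div_norm_le_1)

lemma borel_measurable_dir3 [measurable]: "dir3 \<in> borel_measurable borel"
  unfolding dir3_def[abs_def]
  by (intro borel_measurable_divide borel_measurable_continuous_onI continuous_intros)

lemma dirac_proj_D_wave:
  assumes F: "test_fun F"
  shows "dirac_proj_D e (wave k F) z $ l
    = inv_fourier (\<lambda>(\<tau>, \<xi>). dirac_proj e \<xi> $ l $ k * complex_of_real (F (\<tau>, \<xi>))) z"
proof -
  obtain c where "\<And>\<xi> l. norm (dirac_proj e \<xi> $ l $ k) \<le> c"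
    using dirac_proj_bounded[of e k] by blast
  from x_multiplier_wave[OF F dirac_proj_measurable this] show ?thesis .
qed

lemma inv_fourier_0 [simp]: "inv_fourier (\<lambda>_. 0) z = 0"
  by (simp add: inv_fourier_def)

text \<open>Only rows 1 and 3 contribute, one half-entry against one directional entry in each. The
  minus sign is that of \<open>dirac_beta\<close> on row 3; it is what makes the symbol a difference
  of directions.\<close>

lemma dirac_product_wave:
  assumes F: "test_fun F" and G: "test_fun G"
  shows "dirac_product e e' (wave 3 F) (wave 1 G) z
    = inv_fourier (\<lambda>\<zeta>. of_real (e / 2 * dir3 \<zeta> * F \<zeta>)) z * cnj (inv_fourier (\<lambda>\<zeta>. of_real (G \<zeta> / 2)) z)
    - inv_fourier (\<lambda>\<zeta>. of_real (F \<zeta> / 2)) z * cnj (inv_fourier (\<lambda>\<zeta>. of_real (e' / 2 * dir3 \<zeta> * G \<zeta>)) z)"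
  by (simp add: dirac_product_def dirac_beta_mult spinor_inner_def sum_4 vector_4
      dirac_proj_D_wave[OF F] dirac_proj_D_wave[OF G] dirac_proj_entries dir3_def case_prod_unfold mult.commute)

text \<open>\<open>dir3\<close> jumps at frequency 0, but where \<open>F\<close> is nonzero the
  denominator \<open>norm (snd \<zeta>)\<close> agrees with its maximum with 1, which is continuous
  and never 0.\<close>

lemma continuous_on_dir3_mult:
  assumes F: "test_fun F" and F0: "\<And>\<tau> \<xi>. norm \<xi> < 1 \<Longrightarrow> F (\<tau>, \<xi>) = 0"
  shows "continuous_on UNIV (\<lambda>\<zeta>. dir3 \<zeta> * F \<zeta>)"
proof -
  have "(\<lambda>\<zeta>. dir3 \<zeta> * F \<zeta>) = (\<lambda>\<zeta>. snd \<zeta> $ 3 / max (norm (snd \<zeta>)) 1 * F \<zeta>)"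
  proof
    fix \<zeta> :: spacetime
    show "dir3 \<zeta> * F \<zeta> = snd \<zeta> $ 3 / max (norm (snd \<zeta>)) 1 * F \<zeta>"
      using F0[of "snd \<zeta>" "fst \<zeta>"] by (cases "norm (snd \<zeta>) < 1") (auto simp: dir3_def max_def)
  qed
  moreover have "continuous_on UNIV (\<lambda>\<zeta>. snd \<zeta> $ 3 / max (norm (snd \<zeta>)) 1 * F \<zeta>)"
    by (intro continuous_intros continuous_on_test_fun F) (auto simp: max_def)
  ultimately show ?thesis by (simp only:)
qed

lemma integrable_dir3_mult: "test_fun F \<Longrightarrow> integrable lborel (\<lambda>\<zeta>. dir3 \<zeta> * F \<zeta>)"
  using dir3_le_1 borel_measurable_test_fun
  by (intro Bochner_Integration.integrable_bound[OF integrable_test_fun[of F]])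
     (auto simp: abs_mult mult_left_le_one_le)

text \<open>\<open>J\<close> may contain \<open>dir3\<close>, and then only the boundedness of its
  inverse transform is at hand; integrability comes entirely from the other factor.\<close>

lemma integrable_inv_fourier_mult:
  assumes J: "integrable lborel J" and G: "integrable lborel (inv_fourier H)"
  shows "integrable lborel (\<lambda>z. inv_fourier J z * cnj (inv_fourier H z))"
    and "integrable lborel (\<lambda>z. inv_fourier H z * cnj (inv_fourier J z))"
proof -
  have [measurable]: "inv_fourier J \<in> borel_measurable borel" "inv_fourier H \<in> borel_measurable borel"
    using borel_measurable_inv_fourier_integrable[OF J] borel_measurable_integrable[OF G] by simp_all
  let ?c = "(\<integral>\<zeta>. norm (J \<zeta>) \<partial>lborel) / (2 * pi) ^ DIM('a)"
  have int: "integrable lborel (\<lambda>z. ?c * norm (inv_fourier H z))"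
    by (intro integrable_mult_right integrable_norm G)
  have le: "norm (inv_fourier J z) * norm (inv_fourier H z) \<le> ?c * norm (inv_fourier H z)" for z
    by (intro mult_right_mono norm_inv_fourier_le) auto
  have le': "norm (inv_fourier J z * cnj (inv_fourier H z)) \<le> norm (?c * norm (inv_fourier H z))"
    "norm (inv_fourier H z * cnj (inv_fourier J z)) \<le> norm (?c * norm (inv_fourier H z))" for z
    using order_trans[OF le abs_ge_self, of z] by (simp_all add: norm_mult mult.commute)
  show "integrable lborel (\<lambda>z. inv_fourier J z * cnj (inv_fourier H z))"
    "integrable lborel (\<lambda>z. inv_fourier H z * cnj (inv_fourier J z))"
    by (rule Bochner_Integration.integrable_bound[OF int]; use le' in auto)+
qed

text \<open>The Fourier transform of the product without its normalisation, written as a real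
  integral so that it can be bounded below through the sign of the integrand.\<close>

definition correlation :: "real \<Rightarrow> real \<Rightarrow> (spacetime \<Rightarrow> real) \<Rightarrow> (spacetime \<Rightarrow> real) \<Rightarrow> spacetime \<Rightarrow> real" where
  "correlation e e' F G \<zeta> = (\<integral>\<eta>. (e * dir3 (\<zeta> + \<eta>) - e' * dir3 \<eta>) * (F (\<zeta> + \<eta>) * G \<eta>) \<partial>lborel)"

lemma
  assumes F: "test_fun F" and G: "test_fun G"
  shows integrable_correlation1: "integrable lborel (\<lambda>\<eta>. dir3 (\<zeta> + \<eta>) * (F (\<zeta> + \<eta>) * G \<eta>))"
    and integrable_correlation2: "integrable lborel (\<lambda>\<eta>. dir3 \<eta> * (F (\<zeta> + \<eta>) * G \<eta>))"
    and integrable_correlation: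
      "integrable lborel (\<lambda>\<eta>. (e * dir3 (\<zeta> + \<eta>) - e' * dir3 \<eta>) * (F (\<zeta> + \<eta>) * G \<eta>))"
proof -
  obtain M where M: "\<And>x. \<bar>F x\<bar> \<le> M"
    using test_fun_bounded[OF F] by blast
  have [measurable]: "F \<in> borel_measurable borel" "G \<in> borel_measurable borel"
    by (rule borel_measurable_test_fun; fact)+
  have int: "integrable lborel (\<lambda>\<eta>. M * \<bar>G \<eta>\<bar>)"
    using integrable_test_fun[OF G] by auto
  have "\<bar>dir3 \<zeta>' * (F \<zeta>'' * G \<eta>)\<bar> \<le> M * \<bar>G \<eta>\<bar>" for \<zeta>' \<zeta>'' \<eta>
  proof -
    have "\<bar>dir3 \<zeta>'\<bar> * (\<bar>F \<zeta>''\<bar> * \<bar>G \<eta>\<bar>) \<le> 1 * (M * \<bar>G \<eta>\<bar>)"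
      using M[of 0] by (intro mult_mono dir3_le_1 M mult_nonneg_nonneg) auto
    then show ?thesis by (simp add: abs_mult)
  qed
  then have le: "norm (dir3 \<zeta>' * (F \<zeta>'' * G \<eta>)) \<le> norm (M * \<bar>G \<eta>\<bar>)" for \<zeta>' \<zeta>'' \<eta>
    by (metis abs_ge_self order_trans real_norm_def)
  show 1: "integrable lborel (\<lambda>\<eta>. dir3 (\<zeta> + \<eta>) * (F (\<zeta> + \<eta>) * G \<eta>))"
    by (rule Bochner_Integration.integrable_bound[OF int _ AE_I2[OF le]]) measurable
  show 2: "integrable lborel (\<lambda>\<eta>. dir3 \<eta> * (F (\<zeta> + \<eta>) * G \<eta>))"
    by (rule Bochner_Integration.integrable_bound[OF int _ AE_I2[OF le]]) measurable
  have "integrable lborel (\<lambda>\<eta>. e * (dir3 (\<zeta> + \<eta>) * (F (\<zeta> + \<eta>) * G \<eta>)) - e' * (dir3 \<eta> * (F (\<zeta> + \<eta>) * G \<eta>)))"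
    by (intro Bochner_Integration.integrable_diff integrable_mult_right 1 2)
  then show "integrable lborel (\<lambda>\<eta>. (e * dir3 (\<zeta> + \<eta>) - e' * dir3 \<eta>) * (F (\<zeta> + \<eta>) * G \<eta>))"
    by (simp add: left_diff_distrib mult.assoc)
qed

text \<open>Each term of the product carries two halves from the projections, hence the 4; the power
  of \<open>2 * pi\<close> is that of the correlation formula. In both terms \<open>F\<close>
  belongs to the factor that must be continuous, and this is what \<open>F0\<close> secures.\<close>

theorem st_fourier_dirac_product:
  assumes F: "test_fun F" and F0: "\<And>\<tau> \<xi>. norm \<xi> < 1 \<Longrightarrow> F (\<tau>, \<xi>) = 0" and G: "test_fun G"
  shows "st_fourier (dirac_product e e' (wave 3 F) (wave 1 G)) \<zeta>
    = of_real (correlation e e' F G \<zeta> / (4 * (2 * pi) ^ 4))"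
proof -
  let ?c = "1 / (2 * pi) ^ 4"
  let ?J1 = "\<lambda>\<zeta>. complex_of_real (e / 2 * dir3 \<zeta> * F \<zeta>)"
  let ?H1 = "\<lambda>\<zeta>. complex_of_real (G \<zeta> / 2)"
  let ?J2 = "\<lambda>\<zeta>. complex_of_real (F \<zeta> / 2)"
  let ?H2 = "\<lambda>\<zeta>. complex_of_real (e' / 2 * dir3 \<zeta> * G \<zeta>)"
  obtain M where M: "\<And>x. \<bar>F x\<bar> \<le> M"
    using test_fun_bounded[OF F] by blast
  have J1: "integrable lborel ?J1" and H2: "integrable lborel ?H2"
    using integrable_dir3_mult[OF F] integrable_dir3_mult[OF G]
    by (auto intro!: integrable_of_real simp: mult.assoc simp del: of_real_mult of_real_divide)
  have tF: "test_fun (\<lambda>\<zeta>. (1/2) * F \<zeta>)" "test_fun (\<lambda>\<zeta>. (1/2) * G \<zeta>)"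
    by (intro test_fun_mult_left smooth_alg_const F G)+
  have J2: "integrable lborel ?J2" and H1: "integrable lborel ?H1"
    using integrable_complex_test_fun[OF tF(1)] integrable_complex_test_fun[OF tF(2)] by auto
  have iJ2: "integrable lborel (inv_fourier ?J2)" and iH1: "integrable lborel (inv_fourier ?H1)"
    using integrable_inv_fourier[OF tF(1)] integrable_inv_fourier[OF tF(2)] by auto
  have p1: "integrable lborel (\<lambda>z. inv_fourier ?J1 z * cnj (inv_fourier ?H1 z))"
    by (rule integrable_inv_fourier_mult(1)[OF J1 iH1])
  have p2: "integrable lborel (\<lambda>z. inv_fourier ?J2 z * cnj (inv_fourier ?H2 z))"
    by (rule integrable_inv_fourier_mult(2)[OF H2 iJ2])
  have dim: "DIM(spacetime) = 4" by simp
  have "continuous_on UNIV (\<lambda>\<zeta>. e / 2 * (dir3 \<zeta> * F \<zeta>))"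
    by (intro continuous_intros continuous_on_dir3_mult F F0)
  then have cJ1: "continuous_on UNIV ?J1"
    by (intro continuous_on_of_real) (simp add: mult.assoc)
  have cJ2: "continuous_on UNIV ?J2"
    by (intro continuous_on_of_real continuous_on_divide continuous_on_const continuous_on_test_fun F) auto
  have bJ1: "norm (?J1 x) \<le> \<bar>e\<bar> / 2 * (1 * M)" for x
    unfolding norm_of_real abs_mult abs_divide mult.assoc
    by (intro mult_mono dir3_le_1 M) auto
  have bJ2: "norm (?J2 x) \<le> M / 2" for x
    using M[of x] by simp
  have f1: "fourier (\<lambda>z. inv_fourier ?J1 z * cnj (inv_fourier ?H1 z)) \<zeta>
     = of_real (?c * (e / 4 * (\<integral>\<eta>. dir3 (\<zeta> + \<eta>) * (F (\<zeta> + \<eta>) * G \<eta>) \<partial>lborel)))"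
  proof -
    have "fourier (\<lambda>z. inv_fourier ?J1 z * cnj (inv_fourier ?H1 z)) \<zeta>
        = ?c *\<^sub>R (\<integral>\<eta>. ?J1 (\<zeta> + \<eta>) * cnj (?H1 \<eta>) \<partial>lborel)"
      by (rule fourier_mult_cnj[OF J1 cJ1 bJ1 H1 p1, unfolded dim])
    also have "(\<lambda>\<eta>. ?J1 (\<zeta> + \<eta>) * cnj (?H1 \<eta>)) = (\<lambda>\<eta>. of_real (e / 4 * (dir3 (\<zeta> + \<eta>) * (F (\<zeta> + \<eta>) * G \<eta>))))"
      by (simp add: mult_ac)
    finally show ?thesis
      by (simp only: integral_complex_of_real integral_mult_right_zero) (simp add: scaleR_conv_of_real)
  qed
  have f2: "fourier (\<lambda>z. inv_fourier ?J2 z * cnj (inv_fourier ?H2 z)) \<zeta>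
     = of_real (?c * (e' / 4 * (\<integral>\<eta>. dir3 \<eta> * (F (\<zeta> + \<eta>) * G \<eta>) \<partial>lborel)))"
  proof -
    have "fourier (\<lambda>z. inv_fourier ?J2 z * cnj (inv_fourier ?H2 z)) \<zeta>
        = ?c *\<^sub>R (\<integral>\<eta>. ?J2 (\<zeta> + \<eta>) * cnj (?H2 \<eta>) \<partial>lborel)"
      by (rule fourier_mult_cnj[OF J2 cJ2 bJ2 H2 p2, unfolded dim])
    also have "(\<lambda>\<eta>. ?J2 (\<zeta> + \<eta>) * cnj (?H2 \<eta>)) = (\<lambda>\<eta>. of_real (e' / 4 * (dir3 \<eta> * (F (\<zeta> + \<eta>) * G \<eta>))))"
      by (simp add: mult_ac)
    finally show ?thesis
      by (simp only: integral_complex_of_real integral_mult_right_zero) (simp add: scaleR_conv_of_real)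
  qed
  have cor: "correlation e e' F G \<zeta> = e * (\<integral>\<eta>. dir3 (\<zeta> + \<eta>) * (F (\<zeta> + \<eta>) * G \<eta>) \<partial>lborel)
      - e' * (\<integral>\<eta>. dir3 \<eta> * (F (\<zeta> + \<eta>) * G \<eta>) \<partial>lborel)"
    unfolding correlation_def
    by (subst integral_mult_right_zero[symmetric])+
       (simp add: left_diff_distrib mult.assoc Bochner_Integration.integral_diff integrable_correlation1[OF F G] integrable_correlation2[OF F G])
  have "st_fourier (dirac_product e e' (wave 3 F) (wave 1 G)) \<zeta>
     = fourier (\<lambda>z. inv_fourier ?J1 z * cnj (inv_fourier ?H1 z)) \<zeta> - fourier (\<lambda>z. inv_fourier ?J2 z * cnj (inv_fourier ?H2 z)) \<zeta>"
    unfolding st_fourier_eq_fourier fourier_def dirac_product_wave[OF F G] right_diff_distrib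
    by (intro Bochner_Integration.integral_diff integrable_iexp_mult p1 p2)
  then show ?thesis
    unfolding f1 f2 cor by (simp add: field_simps)
qed

section \<open>Testing the estimate: from norms to weights and measures\<close>

lemma norm_axis_complex: "norm (axis k c :: complex ^ 'n) = norm c"
proof -
  have "(\<Sum>i\<in>UNIV. (norm ((axis k c :: complex ^ 'n) $ i))\<^sup>2) = (\<Sum>i\<in>UNIV. if i = k then (norm c)\<^sup>2 else 0)"
    by (intro sum.cong) (auto simp: axis_def)
  then show ?thesis
    by (simp add: norm_vec_def L2_set_def)
qed

lemma L2_enorm_ge:
  assumes C: "C \<in> sets borel" "emeasure lborel C < top" and c: "c \<ge> 0"
    and f: "\<And>z. z \<in> C \<Longrightarrow> c \<le> norm (f z)"
  shows "ennreal (c * sqrt (measure lborel C)) \<le> L2_enorm f"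
proof -
  let ?I = "\<integral>\<^sup>+ z. ennreal ((norm (f z))\<^sup>2) \<partial>lborel"
  have "ennreal (c\<^sup>2 * measure lborel C) = (\<integral>\<^sup>+ z. ennreal (c\<^sup>2) * indicator C z \<partial>lborel)"
    using C by (simp add: nn_integral_cmult_indicator emeasure_eq_ennreal_measure ennreal_mult less_top)
  also have "\<dots> \<le> ?I"
    using f c by (intro nn_integral_mono) (auto simp: indicator_def intro!: ennreal_leI power_mono)
  finally have le: "ennreal (c\<^sup>2 * measure lborel C) \<le> ?I" .
  show ?thesis
  proof (cases "?I = top")
    case False
    then have "c\<^sup>2 * measure lborel C \<le> enn2real ?I"
      using le by (metis enn2real_ennreal enn2real_mono less_top measure_nonneg mult_nonneg_nonneg zero_le_power2)
    then have "sqrt (c\<^sup>2 * measure lborel C) \<le> sqrt (enn2real ?I)"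
      by simp
    with False c show ?thesis
      by (simp add: L2_enorm_def Let_def real_sqrt_mult ennreal_leI)
  qed (simp add: L2_enorm_def)
qed

lemma L2_enorm_le:
  assumes A: "A \<in> sets borel" "emeasure lborel A < top" and c: "c \<ge> 0"
    and f: "\<And>z. f z \<noteq> 0 \<Longrightarrow> z \<in> A \<and> norm (f z) \<le> c"
  shows "L2_enorm f \<le> ennreal (c * sqrt (measure lborel A))"
proof -
  let ?I = "\<integral>\<^sup>+ z. ennreal ((norm (f z))\<^sup>2) \<partial>lborel"
  have "?I \<le> (\<integral>\<^sup>+ z. ennreal (c\<^sup>2) * indicator A z \<partial>lborel)"
  proof (intro nn_integral_mono)
    fix z
    show "ennreal ((norm (f z))\<^sup>2) \<le> ennreal (c\<^sup>2) * indicator A z"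
      using f[of z] by (cases "f z = 0") (auto simp: indicator_def intro!: ennreal_leI power_mono)
  qed
  also have "\<dots> = ennreal (c\<^sup>2 * measure lborel A)"
    using A by (simp add: nn_integral_cmult_indicator emeasure_eq_ennreal_measure ennreal_mult less_top)
  finally have le: "?I \<le> ennreal (c\<^sup>2 * measure lborel A)" .
  then have ne: "?I \<noteq> top"
    by (metis ennreal_less_top leD less_top)
  have "enn2real ?I \<le> c\<^sup>2 * measure lborel A"
    using le by (simp add: enn2real_leI)
  then have "sqrt (enn2real ?I) \<le> sqrt (c\<^sup>2 * measure lborel A)"
    by simp
  with ne c show ?thesis
    by (simp add: L2_enorm_def Let_def real_sqrt_mult ennreal_leI)
qed

text \<open>Here \<open>A\<close> and \<open>B\<close> contain the supports of the two factors, and for output frequencies in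
  \<open>C\<close> every input in \<open>B'\<close> contributes to the correlation.\<close>

lemma dirac_estimate_test:
  assumes est: "dirac_estimate a b a1 b1 a2 b2" and e: "e \<in> {1, -1}" "e' \<in> {1, -1}"
  obtains K where "K > 0" and
    "\<And>F G A B B' C WA WB w0 \<theta> \<kappa>.
      test_fun F \<Longrightarrow> test_fun G \<Longrightarrow> (\<And>\<tau> \<xi>. norm \<xi> < 1 \<Longrightarrow> F (\<tau>, \<xi>) = 0) \<Longrightarrow>
      (\<And>\<zeta>. 0 \<le> F \<zeta> \<and> F \<zeta> \<le> 1) \<Longrightarrow> (\<And>\<zeta>. 0 \<le> G \<zeta> \<and> G \<zeta> \<le> 1) \<Longrightarrow>
      A \<in> sets borel \<Longrightarrow> emeasure lborel A < top \<Longrightarrow> B \<in> sets borel \<Longrightarrow> emeasure lborel B < top \<Longrightarrow>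
      B' \<in> sets borel \<Longrightarrow> emeasure lborel B' < top \<Longrightarrow> C \<in> sets borel \<Longrightarrow> emeasure lborel C < top \<Longrightarrow>
      (\<And>\<tau> \<xi>. F (\<tau>, \<xi>) \<noteq> 0 \<Longrightarrow> (\<tau>, \<xi>) \<in> A \<and> jbr \<xi> powr a1 * jbr (\<tau> + e * norm \<xi>) powr b1 \<le> WA) \<Longrightarrow>
      (\<And>\<tau> \<xi>. G (\<tau>, \<xi>) \<noteq> 0 \<Longrightarrow> (\<tau>, \<xi>) \<in> B \<and> jbr \<xi> powr a2 * jbr (\<tau> + e' * norm \<xi>) powr b2 \<le> WB) \<Longrightarrow>
      (\<And>\<zeta> \<eta>. F (\<zeta> + \<eta>) \<noteq> 0 \<Longrightarrow> G \<eta> \<noteq> 0 \<Longrightarrow> \<theta> \<le> e * dir3 (\<zeta> + \<eta>) - e' * dir3 \<eta>) \<Longrightarrow>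
      (\<And>\<zeta> \<eta>. \<zeta> \<in> C \<Longrightarrow> \<eta> \<in> B' \<Longrightarrow> \<kappa> \<le> F (\<zeta> + \<eta>) \<and> \<kappa> \<le> G \<eta>) \<Longrightarrow>
      (\<And>\<tau> \<xi>. (\<tau>, \<xi>) \<in> C \<Longrightarrow> w0 \<le> jbr \<xi> powr a * jbr (\<bar>\<tau>\<bar> - norm \<xi>) powr b) \<Longrightarrow>
      0 \<le> \<theta> \<Longrightarrow> 0 < \<kappa> \<Longrightarrow> 0 \<le> w0 \<Longrightarrow> 0 \<le> WA \<Longrightarrow> 0 \<le> WB \<Longrightarrow>
      w0 * (\<theta> * \<kappa>\<^sup>2 * measure lborel B') * sqrt (measure lborel C)
        \<le> K * (WA * sqrt (measure lborel A)) * (WB * sqrt (measure lborel B))"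
proof -
  let ?c = "4 * (2 * pi) ^ 4"
  from est e obtain K where K: "K > 0" and bound: "\<And>\<psi> \<psi>'. schwartz \<psi> \<Longrightarrow> schwartz \<psi>' \<Longrightarrow>
      H_norm a b (dirac_product e e' \<psi> \<psi>') \<le> ennreal K * X_norm e a1 b1 \<psi> * X_norm e' a2 b2 \<psi>'"
    unfolding dirac_estimate_def by blast
  have c: "?c > 0" by simp
  show thesis
  proof (rule that[of "K * ?c"])
    show "K * ?c > 0" using K c by (rule mult_pos_pos)
  next
    fix F G :: "spacetime \<Rightarrow> real" and A B B' C :: "spacetime set" and WA WB w0 \<theta> \<kappa> :: real
    assume F: "test_fun F" and G: "test_fun G" and F0: "\<And>\<tau> \<xi>. norm \<xi> < 1 \<Longrightarrow> F (\<tau>, \<xi>) = 0"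
      and F1: "\<And>\<zeta>. 0 \<le> F \<zeta> \<and> F \<zeta> \<le> 1" and G1: "\<And>\<zeta>. 0 \<le> G \<zeta> \<and> G \<zeta> \<le> 1"
      and A: "A \<in> sets borel" "emeasure lborel A < top" and B: "B \<in> sets borel" "emeasure lborel B < top"
      and B': "B' \<in> sets borel" "emeasure lborel B' < top" and C: "C \<in> sets borel" "emeasure lborel C < top"
      and FA: "\<And>\<tau> \<xi>. F (\<tau>, \<xi>) \<noteq> 0 \<Longrightarrow> (\<tau>, \<xi>) \<in> A \<and> jbr \<xi> powr a1 * jbr (\<tau> + e * norm \<xi>) powr b1 \<le> WA"
      and GB: "\<And>\<tau> \<xi>. G (\<tau>, \<xi>) \<noteq> 0 \<Longrightarrow> (\<tau>, \<xi>) \<in> B \<and> jbr \<xi> powr a2 * jbr (\<tau> + e' * norm \<xi>) powr b2 \<le> WB"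
      and \<theta>: "\<And>\<zeta> \<eta>. F (\<zeta> + \<eta>) \<noteq> 0 \<Longrightarrow> G \<eta> \<noteq> 0 \<Longrightarrow> \<theta> \<le> e * dir3 (\<zeta> + \<eta>) - e' * dir3 \<eta>"
      and \<kappa>: "\<And>\<zeta> \<eta>. \<zeta> \<in> C \<Longrightarrow> \<eta> \<in> B' \<Longrightarrow> \<kappa> \<le> F (\<zeta> + \<eta>) \<and> \<kappa> \<le> G \<eta>"
      and w0: "\<And>\<tau> \<xi>. (\<tau>, \<xi>) \<in> C \<Longrightarrow> w0 \<le> jbr \<xi> powr a * jbr (\<bar>\<tau>\<bar> - norm \<xi>) powr b"
      and nn: "0 \<le> \<theta>" "0 < \<kappa>" "0 \<le> w0" "0 \<le> WA" "0 \<le> WB"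
    let ?\<psi> = "wave 3 F" and ?\<psi>' = "wave 1 G"
    \<comment> \<open>The integrand is at least \<open>\<theta> * \<kappa>\<^sup>2\<close> on
      \<open>B'\<close> and nonnegative elsewhere: the symbol is at least
      \<open>\<theta> \<ge> 0\<close> wherever both factors are nonzero, and the integrand is 0
      otherwise.\<close>
    have cor: "\<theta> * \<kappa>\<^sup>2 * measure lborel B' \<le> correlation e e' F G \<zeta>" if "\<zeta> \<in> C" for \<zeta>
    proof -
      have "\<theta> * \<kappa>\<^sup>2 * measure lborel B' = (\<integral>\<eta>. \<theta> * \<kappa>\<^sup>2 * indicator B' \<eta> \<partial>lborel)"
        using B' by simp
      also have "\<dots> \<le> correlation e e' F G \<zeta>"
        unfolding correlation_def
      proof (rule integral_mono)
        show "integrable lborel (\<lambda>\<eta>. \<theta> * \<kappa>\<^sup>2 * indicator B' \<eta>)"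
          using B' by (intro integrable_mult_right integrable_real_indicator) (auto simp: infinity_ennreal_def)
        show "integrable lborel (\<lambda>\<eta>. (e * dir3 (\<zeta> + \<eta>) - e' * dir3 \<eta>) * (F (\<zeta> + \<eta>) * G \<eta>))"
          by (rule integrable_correlation[OF F G])
        fix \<eta>
        show "\<theta> * \<kappa>\<^sup>2 * indicator B' \<eta> \<le> (e * dir3 (\<zeta> + \<eta>) - e' * dir3 \<eta>) * (F (\<zeta> + \<eta>) * G \<eta>)"
        proof (cases "F (\<zeta> + \<eta>) = 0 \<or> G \<eta> = 0")
          case True
          then have "\<eta> \<notin> B'" using \<kappa>[OF that, of \<eta>] nn by fastforce
          with True show ?thesis by auto
        next
          case False
          then have t: "\<theta> \<le> e * dir3 (\<zeta> + \<eta>) - e' * dir3 \<eta>" using \<theta> by blast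
          have "\<kappa>\<^sup>2 * indicator B' \<eta> \<le> F (\<zeta> + \<eta>) * G \<eta>"
            using \<kappa>[OF that, of \<eta>] nn F1 G1
            by (cases "\<eta> \<in> B'") (auto simp: power2_eq_square intro!: mult_mono)
          with t nn show ?thesis
            unfolding mult.assoc by - (rule mult_mono, auto)
        qed
      qed
      finally show ?thesis .
    qed
    have "ennreal (w0 * (\<theta> * \<kappa>\<^sup>2 * measure lborel B') / ?c * sqrt (measure lborel C)) \<le> H_norm a b (dirac_product e e' ?\<psi> ?\<psi>')"
      unfolding H_norm_def
    proof (rule L2_enorm_ge[OF C])
      show "0 \<le> w0 * (\<theta> * \<kappa>\<^sup>2 * measure lborel B') / ?c"
        using nn by simp
      fix z assume z: "z \<in> C"
      obtain \<tau> \<xi> where zeq: "z = (\<tau>, \<xi>)" by (cases z)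
      have "w0 * (\<theta> * \<kappa>\<^sup>2 * measure lborel B' / ?c) \<le> (jbr \<xi> powr a * jbr (\<bar>\<tau>\<bar> - norm \<xi>) powr b) * (\<bar>correlation e e' F G z\<bar> / ?c)"
        using w0[of \<tau> \<xi>] z zeq nn order_trans[OF cor[OF z] abs_ge_self]
        by (intro mult_mono divide_right_mono) auto
      moreover have st: "st_fourier (dirac_product e e' ?\<psi> ?\<psi>') (\<tau>, \<xi>) = of_real (correlation e e' F G (\<tau>, \<xi>) / ?c)"
        by (rule st_fourier_dirac_product[OF F F0 G])
      ultimately show "w0 * (\<theta> * \<kappa>\<^sup>2 * measure lborel B') / ?c
         \<le> norm (case z of (\<tau>, \<xi>) \<Rightarrow> (jbr \<xi> powr a * jbr (\<bar>\<tau>\<bar> - norm \<xi>) powr b) *\<^sub>R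
              st_fourier (dirac_product e e' ?\<psi> ?\<psi>') (\<tau>, \<xi>))"
        using c unfolding zeq case_prod_conv st norm_scaleR norm_of_real abs_divide abs_mult
        by simp
    qed
    also have "\<dots> \<le> ennreal K * X_norm e a1 b1 ?\<psi> * X_norm e' a2 b2 ?\<psi>'"
      by (intro bound schwartz_wave F G)
    also have "X_norm e a1 b1 ?\<psi> \<le> ennreal (WA * sqrt (measure lborel A))"
      unfolding X_norm_def
    proof (rule L2_enorm_le[OF A nn(4)])
      fix z assume "(case z of (\<tau>, \<xi>) \<Rightarrow> (jbr \<xi> powr a1 * jbr (\<tau> + e * norm \<xi>) powr b1) *\<^sub>R st_fourier_spinor ?\<psi> (\<tau>, \<xi>)) \<noteq> 0"
      moreover obtain \<tau> \<xi> where zeq: "z = (\<tau>, \<xi>)" by (cases z)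
      ultimately have "F (\<tau>, \<xi>) \<noteq> 0"
        by (auto simp: st_fourier_spinor_wave[OF F] axis_def vec_eq_iff split: if_splits)
      from FA[OF this] have z: "(\<tau>, \<xi>) \<in> A" "jbr \<xi> powr a1 * jbr (\<tau> + e * norm \<xi>) powr b1 \<le> WA" by auto
      have "jbr \<xi> powr a1 * jbr (\<tau> + e * norm \<xi>) powr b1 * F (\<tau>, \<xi>) \<le> WA * 1"
        using z F1 nn by (intro mult_mono) auto
      with z F1[of "(\<tau>, \<xi>)"] show "z \<in> A \<and> norm (case z of (\<tau>, \<xi>) \<Rightarrow> (jbr \<xi> powr a1 * jbr (\<tau> + e * norm \<xi>) powr b1) *\<^sub>R st_fourier_spinor ?\<psi> (\<tau>, \<xi>)) \<le> WA"
        by (simp add: zeq st_fourier_spinor_wave[OF F] norm_axis_complex)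
    qed
    also have "X_norm e' a2 b2 ?\<psi>' \<le> ennreal (WB * sqrt (measure lborel B))"
      unfolding X_norm_def
    proof (rule L2_enorm_le[OF B nn(5)])
      fix z assume "(case z of (\<tau>, \<xi>) \<Rightarrow> (jbr \<xi> powr a2 * jbr (\<tau> + e' * norm \<xi>) powr b2) *\<^sub>R st_fourier_spinor ?\<psi>' (\<tau>, \<xi>)) \<noteq> 0"
      moreover obtain \<tau> \<xi> where zeq: "z = (\<tau>, \<xi>)" by (cases z)
      ultimately have "G (\<tau>, \<xi>) \<noteq> 0"
        by (auto simp: st_fourier_spinor_wave[OF G] axis_def vec_eq_iff split: if_splits)
      from GB[OF this] have z: "(\<tau>, \<xi>) \<in> B" "jbr \<xi> powr a2 * jbr (\<tau> + e' * norm \<xi>) powr b2 \<le> WB" by auto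
      have "jbr \<xi> powr a2 * jbr (\<tau> + e' * norm \<xi>) powr b2 * G (\<tau>, \<xi>) \<le> WB * 1"
        using z G1 nn by (intro mult_mono) auto
      with z G1[of "(\<tau>, \<xi>)"] show "z \<in> B \<and> norm (case z of (\<tau>, \<xi>) \<Rightarrow> (jbr \<xi> powr a2 * jbr (\<tau> + e' * norm \<xi>) powr b2) *\<^sub>R st_fourier_spinor ?\<psi>' (\<tau>, \<xi>)) \<le> WB"
        by (simp add: zeq st_fourier_spinor_wave[OF G] norm_axis_complex)
    qed
    finally have "ennreal (w0 * (\<theta> * \<kappa>\<^sup>2 * measure lborel B') / ?c * sqrt (measure lborel C))
        \<le> ennreal K * ennreal (WA * sqrt (measure lborel A)) * ennreal (WB * sqrt (measure lborel B))"
      by (simp add: mult_left_mono mult_right_mono)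
    also have "\<dots> = ennreal (K * (WA * sqrt (measure lborel A)) * (WB * sqrt (measure lborel B)))"
      using K nn by (simp add: ennreal_mult[symmetric])
    finally have "w0 * (\<theta> * \<kappa>\<^sup>2 * measure lborel B') / ?c * sqrt (measure lborel C)
        \<le> K * (WA * sqrt (measure lborel A)) * (WB * sqrt (measure lborel B))"
      using K nn by (subst (asm) ennreal_le_iff) auto
    then have "w0 * (\<theta> * \<kappa>\<^sup>2 * measure lborel B') / ?c * sqrt (measure lborel C) * ?c
        \<le> K * (WA * sqrt (measure lborel A)) * (WB * sqrt (measure lborel B)) * ?c"
      using c by (intro mult_right_mono) auto
    then show "w0 * (\<theta> * \<kappa>\<^sup>2 * measure lborel B') * sqrt (measure lborel C)
        \<le> K * ?c * (WA * sqrt (measure lborel A)) * (WB * sqrt (measure lborel B))"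
      using c by (simp add: mult_ac)
  qed
qed

section \<open>Symmetry of the estimate in its two factors\<close>

lemma dirac_product_swap: "dirac_product e e' \<psi> \<psi>' z = cnj (dirac_product e' e \<psi>' \<psi> z)"
  by (simp add: dirac_product_def dirac_beta_mult spinor_inner_def sum_4 vector_4 mult.commute)

text \<open>Integrability is unaffected by the unimodular phase, so for a non-integrable
  \<open>u\<close> every value is the default 0 of the integral. Measurability for arbitrary
  \<open>u\<close> permits the reflection of variables in \<open>H_norm_cnj\<close>.\<close>

lemma borel_measurable_fourier [measurable]: "fourier u \<in> borel_measurable borel"
proof (cases "integrable lborel u")
  case True
  then have [measurable]: "u \<in> borel_measurable borel"
    using borel_measurable_integrable by force
  show ?thesis
    unfolding fourier_def[abs_def] by measurable
next
  case False
  have "\<not> integrable lborel (\<lambda>z. exp (- (\<i> * of_real (z \<bullet> \<zeta>))) * u z)" for \<zeta>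
  proof
    assume "integrable lborel (\<lambda>z. exp (- (\<i> * of_real (z \<bullet> \<zeta>))) * u z)"
    then have "integrable lborel (\<lambda>z. exp (\<i> * of_real (\<zeta> \<bullet> z)) * (exp (- (\<i> * of_real (z \<bullet> \<zeta>))) * u z))"
      by (rule integrable_iexp_mult(1))
    then show False
      using False by (simp add: mult.assoc[symmetric] exp_add[symmetric] inner_commute)
  qed
  then have "fourier u = (\<lambda>_. 0)"
    by (simp add: fourier_def fun_eq_iff not_integrable_integral_eq)
  then show ?thesis by simp
qed

text \<open>Conjugation reflects the transform through the origin, and the weights depend on
  \<open>\<bar>\<tau>\<bar>\<close> and \<open>norm \<xi>\<close> only.\<close>

lemma H_norm_cnj: "H_norm a b (\<lambda>z. cnj (u z)) = H_norm a b u"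
proof -
  have st: "fourier (\<lambda>z. cnj (u z)) \<zeta> = cnj (fourier u (- \<zeta>))" for \<zeta>
    unfolding fourier_def
    by (subst Bochner_Integration.integral_cnj[symmetric]) (simp add: exp_cnj)
  let ?g = "\<lambda>\<zeta>::spacetime. ennreal ((norm ((jbr (snd \<zeta>) powr a * jbr (\<bar>fst \<zeta>\<bar> - norm (snd \<zeta>)) powr b) *\<^sub>R fourier u \<zeta>))\<^sup>2)"
  have [measurable]: "(\<lambda>\<zeta>::spacetime. jbr (snd \<zeta>)) \<in> borel_measurable borel"
    "(\<lambda>\<zeta>::spacetime. jbr (\<bar>fst \<zeta>\<bar> - norm (snd \<zeta>))) \<in> borel_measurable borel"
    unfolding jbr_def by (intro borel_measurable_continuous_onI continuous_intros)+
  have "(\<integral>\<^sup>+ \<zeta>. ?g (- \<zeta>) \<partial>lborel) = (\<integral>\<^sup>+ \<zeta>. ?g \<zeta> \<partial>lborel)"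
    by (subst (2) lborel_affine[of "-1" 0], simp) (simp add: nn_integral_density nn_integral_distr)
  moreover have "ennreal ((norm ((jbr (snd \<zeta>) powr a * jbr (\<bar>fst \<zeta>\<bar> - norm (snd \<zeta>)) powr b) *\<^sub>R st_fourier (\<lambda>z. cnj (u z)) \<zeta>))\<^sup>2) = ?g (- \<zeta>)" for \<zeta>
    by (simp add: st st_fourier_eq_fourier jbr_def)
  ultimately show ?thesis
    by (simp only: H_norm_def L2_enorm_def case_prod_unfold st_fourier_eq_fourier prod.collapse)
qed

text \<open>\<open>dirac_beta\<close> is Hermitian, so exchanging the factors conjugates the product
  and exchanges the two signs; the estimate covers all pairs of signs. For estimate (i), whose
  inputs have different exponents, this doubles the available conditions.\<close>

lemma dirac_estimate_swap:
  assumes "dirac_estimate a b a1 b1 a2 b2"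
  shows "dirac_estimate a b a2 b2 a1 b1"
  unfolding dirac_estimate_def
proof (intro ballI)
  fix e e' :: real assume "e \<in> {1, -1}" "e' \<in> {1, -1}"
  with assms obtain K where K: "K > 0" and bound: "\<And>\<psi> \<psi>'. schwartz \<psi> \<Longrightarrow> schwartz \<psi>' \<Longrightarrow>
      H_norm a b (dirac_product e' e \<psi> \<psi>') \<le> ennreal K * X_norm e' a1 b1 \<psi> * X_norm e a2 b2 \<psi>'"
    unfolding dirac_estimate_def by blast
  have eq: "dirac_product e e' \<psi> \<psi>' = (\<lambda>z. cnj (dirac_product e' e \<psi>' \<psi> z))" for \<psi> \<psi>'
    by (rule ext) (rule dirac_product_swap)
  show "\<exists>C>0. \<forall>\<psi> \<psi>'. schwartz \<psi> \<longrightarrow> schwartz \<psi>' \<longrightarrow>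
      H_norm a b (dirac_product e e' \<psi> \<psi>') \<le> ennreal C * X_norm e a2 b2 \<psi> * X_norm e' a1 b1 \<psi>'"
  proof (intro exI[of _ K] conjI K allI impI)
    fix \<psi> \<psi>' :: "spacetime \<Rightarrow> spinor" assume "schwartz \<psi>" "schwartz \<psi>'"
    then have "H_norm a b (dirac_product e' e \<psi>' \<psi>) \<le> ennreal K * X_norm e' a1 b1 \<psi>' * X_norm e a2 b2 \<psi>"
      by (intro bound)
    also have "\<dots> = ennreal K * X_norm e a2 b2 \<psi> * X_norm e' a1 b1 \<psi>'"
      by (simp only: mult_ac)
    finally show "H_norm a b (dirac_product e e' \<psi> \<psi>') \<le> ennreal K * X_norm e a2 b2 \<psi> * X_norm e' a1 b1 \<psi>'"
      unfolding eq[of \<psi>] H_norm_cnj .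
  qed
qed

section \<open>Wave packets\<close>

definition bump :: "real \<Rightarrow> real" where
  "bump t = flat_exp 0 (1 + t) * flat_exp 0 (1 - t)"

lemma flat_0_le_1: "flat_exp 0 t \<le> 1"
  by (simp add: flat_exp_def)

lemma bump_nonneg: "0 \<le> bump t" and bump_le_1: "bump t \<le> 1"
  unfolding bump_def by (auto intro!: mult_le_one mult_nonneg_nonneg flat_0_le_1 flat_nonneg)

lemma bump_nonzero: "bump t \<noteq> 0 \<Longrightarrow> \<bar>t\<bar> \<le> 1"
  by (auto simp: bump_def flat_exp_def split: if_splits)

lemma bump_ge: "\<bar>t\<bar> \<le> 1/2 \<Longrightarrow> exp (-4) \<le> bump t"
proof -
  assume t: "\<bar>t\<bar> \<le> 1/2"
  have "exp (-2) \<le> flat_exp 0 s" if "s \<ge> 1/2" for s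
    using that by (simp add: flat_exp_def field_simps)
  from mult_mono[OF this this, of "1 + t" "1 - t"] t show ?thesis
    by (simp add: bump_def exp_add[symmetric] flat_nonneg)
qed

lemma smooth_alg_cmult: "f \<in> smooth_alg \<Longrightarrow> (\<lambda>x. c * f x) \<in> smooth_alg"
  by (intro smooth_alg.intros)

lemma smooth_alg_affine: "f \<in> smooth_alg \<Longrightarrow> (\<lambda>x. (f x - c) / d) \<in> smooth_alg"
  using smooth_alg_cmult[OF smooth_alg_add[OF _ smooth_alg_const[of "- c"]], of f "1 / d"] by simp

lemma smooth_alg_bump:
  assumes "f \<in> smooth_alg" shows "(\<lambda>x. bump (f x)) \<in> smooth_alg"
proof -
  have "(\<lambda>x. flat_exp 0 (1 + f x) * flat_exp 0 (1 + (-1) * f x)) \<in> smooth_alg"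
    by (intro smooth_alg.intros assms)
  then show ?thesis by (simp add: bump_def)
qed

lemma smooth_alg_fst: "(\<lambda>\<zeta>::spacetime. fst \<zeta>) \<in> smooth_alg"
  using smooth_alg_inner[of "(1, 0) :: spacetime"] by (simp add: inner_prod_def)

lemma smooth_alg_snd_nth: "(\<lambda>\<zeta>::spacetime. snd \<zeta> $ j) \<in> smooth_alg"
  using smooth_alg_inner[of "(0, axis j 1) :: spacetime"] by (simp add: inner_prod_def inner_axis)

text \<open>A smooth box with one further cutoff: \<open>q\<close> restricts the support to a thin
  neighbourhood of a hypersurface, the cone or a plane tangent to it. The choice
  \<open>q = 0\<close> imposes no restriction.\<close>

definition packet :: "(spacetime \<Rightarrow> real) \<Rightarrow> real \<Rightarrow> real \<Rightarrow> real^3 \<Rightarrow> real^3 \<Rightarrow> spacetime \<Rightarrow> real" where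
  "packet q p0 r0 p r \<zeta> = bump (q \<zeta>) * bump ((fst \<zeta> - p0) / r0) *
     (bump ((snd \<zeta> $ 1 - p $ 1) / r $ 1) * bump ((snd \<zeta> $ 2 - p $ 2) / r $ 2) * bump ((snd \<zeta> $ 3 - p $ 3) / r $ 3))"

lemma packet_bounds: "0 \<le> packet q p0 r0 p r \<zeta> \<and> packet q p0 r0 p r \<zeta> \<le> 1"
  unfolding packet_def by (intro conjI mult_nonneg_nonneg mult_le_one bump_nonneg bump_le_1)

lemma packet_nonzero:
  assumes "packet q p0 r0 p r (\<tau>, \<xi>) \<noteq> 0" "r0 > 0" "\<And>j. r $ j > 0"
  shows "\<bar>q (\<tau>, \<xi>)\<bar> \<le> 1" "\<bar>\<tau> - p0\<bar> \<le> r0" "\<bar>\<xi> $ j - p $ j\<bar> \<le> r $ j"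
proof -
  have *: "\<bar>x\<bar> \<le> y" if "bump (x / y) \<noteq> 0" "y > 0" for x y
    using bump_nonzero[OF that(1)] that(2) by (simp add: abs_divide)
  show "\<bar>q (\<tau>, \<xi>)\<bar> \<le> 1" "\<bar>\<tau> - p0\<bar> \<le> r0"
    using assms bump_nonzero * by (auto simp: packet_def)
  show "\<bar>\<xi> $ j - p $ j\<bar> \<le> r $ j"
    using assms * exhaust_3[of j] by (auto simp: packet_def)
qed

text \<open>There are five bump factors, and each is at least \<open>exp (-4)\<close> on the
  half-size set.\<close>

lemma packet_ge:
  assumes "\<bar>q (\<tau>, \<xi>)\<bar> \<le> 1/2" "\<bar>\<tau> - p0\<bar> \<le> r0 / 2" "\<And>j. \<bar>\<xi> $ j - p $ j\<bar> \<le> r $ j / 2"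
    "r0 > 0" "\<And>j. r $ j > 0"
  shows "exp (-20) \<le> packet q p0 r0 p r (\<tau>, \<xi>)"
proof -
  have *: "exp (-4) \<le> bump (x / y)" if "\<bar>x\<bar> \<le> y / 2" "y > 0" for x y
    using that by (intro bump_ge) (simp add: abs_divide field_simps)
  have "exp (-20 :: real) = exp (-4) * exp (-4) * (exp (-4) * exp (-4) * exp (-4))"
    by (simp add: exp_add[symmetric])
  also have "\<dots> \<le> packet q p0 r0 p r (\<tau>, \<xi>)"
    unfolding packet_def fst_conv snd_conv
    by (intro mult_mono bump_ge[OF assms(1)] *[OF assms(2,4)] *[OF assms(3,5)] mult_nonneg_nonneg bump_nonneg) auto
  finally show ?thesis .
qed

lemma test_fun_packet:
  assumes q: "q \<in> smooth_alg" and r: "r0 > 0" "\<And>j. r $ j > 0"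
  shows "test_fun (packet q p0 r0 p r)"
  unfolding test_fun_def
proof (intro conjI exI allI impI)
  show "packet q p0 r0 p r \<in> smooth_alg"
    unfolding packet_def[abs_def]
    by (intro smooth_alg_mult smooth_alg_bump smooth_alg_affine smooth_alg_fst smooth_alg_snd_nth q)
next
  fix \<zeta> assume nz: "packet q p0 r0 p r \<zeta> \<noteq> 0"
  obtain \<tau> \<xi> where \<zeta>: "\<zeta> = (\<tau>, \<xi>)" by (cases \<zeta>)
  note nz = packet_nonzero[OF nz[unfolded \<zeta>] r]
  have "norm \<zeta> \<le> \<bar>\<tau>\<bar> + norm \<xi>"
    unfolding \<zeta> using norm_Pair_le[of \<tau> \<xi>] by simp
  also have "norm \<xi> \<le> (\<Sum>j\<in>UNIV. \<bar>\<xi> $ j\<bar>)"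
    by (rule norm_le_l1_cart)
  also have "\<dots> \<le> (\<Sum>j\<in>UNIV. \<bar>p $ j\<bar> + r $ j)"
    by (intro sum_mono) (use nz(3) in \<open>smt (verit)\<close>)
  also have "\<bar>\<tau>\<bar> \<le> \<bar>p0\<bar> + r0"
    using nz(2) by linarith
  finally show "norm \<zeta> \<le> \<bar>p0\<bar> + r0 + (\<Sum>j\<in>UNIV. \<bar>p $ j\<bar> + r $ j)"
    by simp
qed

text \<open>A vertical thickening of a graph: integrating in \<open>\<tau>\<close> first, the
  measure does not depend on \<open>f\<close>. The same formula thus serves boxes, planks and curved
  shells.\<close>

definition slab :: "(real^3 \<Rightarrow> real) \<Rightarrow> real \<Rightarrow> real^3 \<Rightarrow> real^3 \<Rightarrow> spacetime set" where
  "slab f h p r = {(\<tau>, \<xi>). \<bar>\<tau> - f \<xi>\<bar> \<le> h \<and> (\<forall>j. \<bar>\<xi> $ j - p $ j\<bar> \<le> r $ j)}"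

lemma
  assumes f: "continuous_on UNIV f" and h: "h \<ge> 0" and r: "\<And>j. r $ j \<ge> 0"
  shows slab_in_borel: "slab f h p r \<in> sets borel"
    and emeasure_slab_finite: "emeasure lborel (slab f h p r) < top"
    and measure_slab: "measure lborel (slab f h p r) = 2 * h * (\<Prod>j\<in>UNIV. 2 * r $ j)"
proof -
  let ?Q = "cbox (p - r) (p + r)"
  have Q: "\<xi> \<in> ?Q \<longleftrightarrow> (\<forall>j. \<bar>\<xi> $ j - p $ j\<bar> \<le> r $ j)" for \<xi>
    by (simp add: mem_box_cart abs_le_iff diff_le_eq le_diff_eq add.commute conj_commute)
  have "continuous_on UNIV (\<lambda>\<zeta>::spacetime. f (snd \<zeta>))"
    by (rule continuous_on_compose2[OF f]) (auto intro: continuous_on_snd continuous_on_id)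
  then have "closed {\<zeta>::spacetime. \<bar>fst \<zeta> - f (snd \<zeta>)\<bar> \<le> h}"
    by (intro closed_Collect_le continuous_on_rabs continuous_on_diff continuous_on_fst continuous_on_id continuous_on_const)
  moreover have "closed {\<zeta>::spacetime. \<forall>j. \<bar>snd \<zeta> $ j - p $ j\<bar> \<le> r $ j}"
    by (intro closed_Collect_all closed_Collect_le) (intro continuous_intros)+
  moreover have eq: "slab f h p r = {\<zeta>. \<bar>fst \<zeta> - f (snd \<zeta>)\<bar> \<le> h} \<inter> {\<zeta>. \<forall>j. \<bar>snd \<zeta> $ j - p $ j\<bar> \<le> r $ j}"
    by (auto simp: slab_def)
  ultimately show sets: "slab f h p r \<in> sets borel"
    unfolding eq by (intro borel_closed closed_Int)
  have slice: "(\<lambda>\<tau>. (\<tau>, \<xi>)) -` slab f h p r = (if \<xi> \<in> ?Q then {f \<xi> - h .. f \<xi> + h} else {})" for \<xi>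
    unfolding Q by (auto simp: slab_def abs_le_iff algebra_simps)
  have content: "emeasure lborel ?Q = ennreal (\<Prod>j\<in>UNIV. 2 * r $ j)"
  proof -
    have "p \<in> ?Q" using r by (simp add: Q)
    then have "measure lborel ?Q = (\<Prod>j\<in>UNIV. (p + r) $ j - (p - r) $ j)"
      by (intro content_cbox_cart) auto
    also have "\<dots> = (\<Prod>j\<in>UNIV. 2 * r $ j)"
      by simp
    finally show ?thesis
      using emeasure_eq_ennreal_measure[of lborel ?Q] emeasure_lborel_cbox_finite[of "p - r" "p + r"] by simp
  qed
  have "emeasure lborel (slab f h p r) = emeasure (lborel \<Otimes>\<^sub>M lborel) (slab f h p r)"
    by (simp add: lborel_prod)
  also have "\<dots> = (\<integral>\<^sup>+ \<xi>. emeasure lborel ((\<lambda>\<tau>. (\<tau>, \<xi>)) -` slab f h p r) \<partial>lborel)"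
    by (rule lborel_pair.emeasure_pair_measure_alt2) (unfold lborel_prod sets_lborel, rule sets)
  also have "\<dots> = (\<integral>\<^sup>+ \<xi>. ennreal (2 * h) * indicator ?Q \<xi> \<partial>lborel)"
    using h by (intro nn_integral_cong) (simp add: slice indicator_def)
  also have "\<dots> = ennreal (2 * h * (\<Prod>j\<in>UNIV. 2 * r $ j))"
    using h r by (simp add: nn_integral_cmult_indicator content ennreal_mult prod_nonneg)
  finally have em: "emeasure lborel (slab f h p r) = ennreal (2 * h * (\<Prod>j\<in>UNIV. 2 * r $ j))" .
  then show "emeasure lborel (slab f h p r) < top" by simp
  have "0 \<le> 2 * h * (\<Prod>j\<in>UNIV. 2 * r $ j)"
    using h r by (intro mult_nonneg_nonneg prod_nonneg) auto
  with em show "measure lborel (slab f h p r) = 2 * h * (\<Prod>j\<in>UNIV. 2 * r $ j)"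
    by (simp add: measure_def)
qed

text \<open>One generous constant for all configurations. The final conditions compare rates of
  growth, so only its independence of the scale matters.\<close>

definition comparable :: "real \<Rightarrow> real \<Rightarrow> bool" where
  "comparable x y \<longleftrightarrow> x \<le> 10 ^ 6 * y \<and> y \<le> 10 ^ 6 * x"

lemma comparable_sym: "comparable x y \<Longrightarrow> comparable y x"
  by (auto simp: comparable_def)

text \<open>The modulus in \<open>\<bar>p\<bar>\<close> covers both directions of monotonicity of
  the power.\<close>

lemma comparable_powr:
  assumes "comparable x y" "x > 0" "y > 0"
  shows "x powr p \<le> (10 ^ 6) powr \<bar>p\<bar> * y powr p"
proof (cases "p \<ge> 0")
  case True
  then have "x powr p \<le> (10 ^ 6 * y) powr p"
    using assms by (intro powr_mono2) (auto simp: comparable_def)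
  with True assms show ?thesis
    by (simp add: powr_mult)
next
  case False
  have "x powr p \<le> (y / 10 ^ 6) powr p"
    using assms False by (intro powr_mono2') (auto simp: comparable_def field_simps)
  also have "\<dots> = y powr p * (10 ^ 6) powr (- p)"
    using assms by (simp add: powr_divide powr_minus field_simps)
  finally show ?thesis
    using False by (simp add: mult.commute)
qed

lemma jbr_pos: "jbr x > 0"
  by (simp add: jbr_def add_pos_nonneg)

text \<open>The scale \<open>X\<close> is the order of magnitude of the frequency and \<open>Y\<close> that of the
  distance to the cone \<open>\<tau> = - e \<cdot> norm \<xi>\<close>.\<close>

definition packet_at ::
    "real \<Rightarrow> (spacetime \<Rightarrow> real) \<Rightarrow> real \<Rightarrow> real \<Rightarrow> real^3 \<Rightarrow> real^3 \<Rightarrow> (real^3 \<Rightarrow> real) \<Rightarrow> real \<Rightarrow> real \<Rightarrow> real \<Rightarrow> bool" where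
  "packet_at e q p0 r0 p r f h X Y \<longleftrightarrow>
     q \<in> smooth_alg \<and> 0 < r0 \<and> (\<forall>j. 0 < r $ j) \<and> continuous_on UNIV f \<and> 0 \<le> h \<and> 0 < X \<and> 0 < Y \<and>
     (\<forall>\<tau> \<xi>. \<bar>q (\<tau>, \<xi>)\<bar> \<le> 1 \<longrightarrow> \<bar>\<tau> - p0\<bar> \<le> r0 \<longrightarrow> (\<forall>j. \<bar>\<xi> $ j - p $ j\<bar> \<le> r $ j) \<longrightarrow>
        1 \<le> norm \<xi> \<and> \<bar>\<tau> - f \<xi>\<bar> \<le> h \<and> comparable (jbr \<xi>) X \<and> comparable (jbr (\<tau> + e * norm \<xi>)) Y)"

lemma packet_at_bound:
  assumes at: "packet_at e q p0 r0 p r f h X Y" and nz: "packet q p0 r0 p r (\<tau>, \<xi>) \<noteq> 0"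
  shows "(\<tau>, \<xi>) \<in> slab f h p r"
    and "jbr \<xi> powr a * jbr (\<tau> + e * norm \<xi>) powr b \<le> (10 ^ 6) powr (\<bar>a\<bar> + \<bar>b\<bar>) * (X powr a * Y powr b)"
    and "1 \<le> norm \<xi>"
proof -
  from at have r: "0 < r0" "\<And>j. 0 < r $ j" and XY: "0 < X" "0 < Y"
    by (auto simp: packet_at_def)
  note n = packet_nonzero[OF nz r]
  from at n have *: "1 \<le> norm \<xi>" "\<bar>\<tau> - f \<xi>\<bar> \<le> h" "comparable (jbr \<xi>) X" "comparable (jbr (\<tau> + e * norm \<xi>)) Y"
    by (auto simp: packet_at_def)
  from * n show "(\<tau>, \<xi>) \<in> slab f h p r" "1 \<le> norm \<xi>"
    by (auto simp: slab_def)
  have "jbr \<xi> powr a * jbr (\<tau> + e * norm \<xi>) powr b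
      \<le> ((10 ^ 6) powr \<bar>a\<bar> * X powr a) * ((10 ^ 6) powr \<bar>b\<bar> * Y powr b)"
    using * XY by (intro mult_mono comparable_powr jbr_pos) auto
  then show "jbr \<xi> powr a * jbr (\<tau> + e * norm \<xi>) powr b \<le> (10 ^ 6) powr (\<bar>a\<bar> + \<bar>b\<bar>) * (X powr a * Y powr b)"
    by (simp add: powr_add mult_ac)
qed

text \<open>The packets \<open>F\<close> and \<open>G\<close> live at the scales \<open>X1, Y1\<close> and \<open>X2, Y2\<close>, in sets of measure at
  most \<open>V\<close> and \<open>W\<close>. The output is tested on a slab at the scale \<open>X0, Y0\<close>, to which a slab of
  inputs contributes, both of measure about \<open>W\<close>, and \<open>\<theta>\<close> bounds the null symbol from below.\<close>

definition packet_config ::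
    "real \<Rightarrow> real \<Rightarrow> real \<Rightarrow> real \<Rightarrow> real \<Rightarrow> real \<Rightarrow> real \<Rightarrow> real \<Rightarrow> real \<Rightarrow> real \<Rightarrow> real \<Rightarrow> bool" where
  "packet_config e e' X1 Y1 X2 Y2 X0 Y0 \<theta> V W \<longleftrightarrow>
    (\<exists>qF \<tau>F dF pF rF fA hA qG \<tau>G dG pG rG fB hB fB' hB' pB' rB' fC hC pC rC.
      packet_at e qF \<tau>F dF pF rF fA hA X1 Y1 \<and>
      packet_at e' qG \<tau>G dG pG rG fB hB X2 Y2 \<and>
      continuous_on UNIV fB' \<and> 0 \<le> hB' \<and> (\<forall>j. 0 \<le> rB' $ j) \<and>
      continuous_on UNIV fC \<and> 0 \<le> hC \<and> (\<forall>j. 0 \<le> rC $ j) \<and>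
      0 < X0 \<and> 0 < Y0 \<and> 0 \<le> \<theta> \<and> 0 < V \<and> 0 < W \<and>
      (\<forall>\<xi>1 \<xi>2. (\<forall>j. \<bar>\<xi>1 $ j - pF $ j\<bar> \<le> rF $ j) \<longrightarrow> (\<forall>j. \<bar>\<xi>2 $ j - pG $ j\<bar> \<le> rG $ j) \<longrightarrow>
        \<theta> \<le> e * (\<xi>1 $ 3 / norm \<xi>1) - e' * (\<xi>2 $ 3 / norm \<xi>2)) \<and>
      (\<forall>\<tau>0 \<xi>0 \<tau>2 \<xi>2. (\<tau>0, \<xi>0) \<in> slab fC hC pC rC \<longrightarrow> (\<tau>2, \<xi>2) \<in> slab fB' hB' pB' rB' \<longrightarrow>
        \<bar>qF (\<tau>0 + \<tau>2, \<xi>0 + \<xi>2)\<bar> \<le> 1/2 \<and> \<bar>\<tau>0 + \<tau>2 - \<tau>F\<bar> \<le> dF / 2 \<and> (\<forall>j. \<bar>(\<xi>0 + \<xi>2) $ j - pF $ j\<bar> \<le> rF $ j / 2)) \<and>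
      (\<forall>\<tau>2 \<xi>2. (\<tau>2, \<xi>2) \<in> slab fB' hB' pB' rB' \<longrightarrow>
        \<bar>qG (\<tau>2, \<xi>2)\<bar> \<le> 1/2 \<and> \<bar>\<tau>2 - \<tau>G\<bar> \<le> dG / 2 \<and> (\<forall>j. \<bar>\<xi>2 $ j - pG $ j\<bar> \<le> rG $ j / 2)) \<and>
      (\<forall>\<tau> \<xi>. (\<tau>, \<xi>) \<in> slab fC hC pC rC \<longrightarrow> comparable (jbr \<xi>) X0 \<and> comparable (jbr (\<bar>\<tau>\<bar> - norm \<xi>)) Y0) \<and>
      2 * hA * (\<Prod>j\<in>UNIV. 2 * rF $ j) \<le> 10 ^ 6 * V \<and> 2 * hB * (\<Prod>j\<in>UNIV. 2 * rG $ j) \<le> 10 ^ 6 * W \<and>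
      W \<le> 10 ^ 6 * (2 * hB' * (\<Prod>j\<in>UNIV. 2 * rB' $ j)) \<and> W \<le> 10 ^ 6 * (2 * hC * (\<Prod>j\<in>UNIV. 2 * rC $ j)))"

text \<open>The three sets \<open>B\<close>, \<open>B'\<close>, \<open>C\<close> all have measure of
  order \<open>W\<close>. The tested inequality then has \<open>W * sqrt W\<close> on the left and
  \<open>sqrt V * sqrt W\<close> on the right, and \<open>sqrt W\<close> cancels. The constant
  depends on the estimate and its exponents, but on no configuration.\<close>

lemma dirac_estimate_packets:
  assumes est: "dirac_estimate a b a1 b1 a2 b2" and e: "e \<in> {1, -1}" "e' \<in> {1, -1}"
  obtains K where "K > 0" and
    "\<And>X1 Y1 X2 Y2 X0 Y0 \<theta> V W. packet_config e e' X1 Y1 X2 Y2 X0 Y0 \<theta> V W \<Longrightarrow>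
      X0 powr a * Y0 powr b * \<theta> * W \<le> K * ((X1 powr a1 * Y1 powr b1) * (X2 powr a2 * Y2 powr b2) * sqrt V)"
proof (rule dirac_estimate_test[OF est e])
  fix K0 :: real
  assume K0: "K0 > 0" and test: "\<And>F G A B B' C WA WB w0 \<theta> \<kappa>.
      test_fun F \<Longrightarrow> test_fun G \<Longrightarrow> (\<And>\<tau> \<xi>. norm \<xi> < 1 \<Longrightarrow> F (\<tau>, \<xi>) = 0) \<Longrightarrow>
      (\<And>\<zeta>. 0 \<le> F \<zeta> \<and> F \<zeta> \<le> 1) \<Longrightarrow> (\<And>\<zeta>. 0 \<le> G \<zeta> \<and> G \<zeta> \<le> 1) \<Longrightarrow>
      A \<in> sets borel \<Longrightarrow> emeasure lborel A < top \<Longrightarrow> B \<in> sets borel \<Longrightarrow> emeasure lborel B < top \<Longrightarrow>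
      B' \<in> sets borel \<Longrightarrow> emeasure lborel B' < top \<Longrightarrow> C \<in> sets borel \<Longrightarrow> emeasure lborel C < top \<Longrightarrow>
      (\<And>\<tau> \<xi>. F (\<tau>, \<xi>) \<noteq> 0 \<Longrightarrow> (\<tau>, \<xi>) \<in> A \<and> jbr \<xi> powr a1 * jbr (\<tau> + e * norm \<xi>) powr b1 \<le> WA) \<Longrightarrow>
      (\<And>\<tau> \<xi>. G (\<tau>, \<xi>) \<noteq> 0 \<Longrightarrow> (\<tau>, \<xi>) \<in> B \<and> jbr \<xi> powr a2 * jbr (\<tau> + e' * norm \<xi>) powr b2 \<le> WB) \<Longrightarrow>
      (\<And>\<zeta> \<eta>. F (\<zeta> + \<eta>) \<noteq> 0 \<Longrightarrow> G \<eta> \<noteq> 0 \<Longrightarrow> \<theta> \<le> e * dir3 (\<zeta> + \<eta>) - e' * dir3 \<eta>) \<Longrightarrow>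
      (\<And>\<zeta> \<eta>. \<zeta> \<in> C \<Longrightarrow> \<eta> \<in> B' \<Longrightarrow> \<kappa> \<le> F (\<zeta> + \<eta>) \<and> \<kappa> \<le> G \<eta>) \<Longrightarrow>
      (\<And>\<tau> \<xi>. (\<tau>, \<xi>) \<in> C \<Longrightarrow> w0 \<le> jbr \<xi> powr a * jbr (\<bar>\<tau>\<bar> - norm \<xi>) powr b) \<Longrightarrow>
      0 \<le> \<theta> \<Longrightarrow> 0 < \<kappa> \<Longrightarrow> 0 \<le> w0 \<Longrightarrow> 0 \<le> WA \<Longrightarrow> 0 \<le> WB \<Longrightarrow>
      w0 * (\<theta> * \<kappa>\<^sup>2 * measure lborel B') * sqrt (measure lborel C)
        \<le> K0 * (WA * sqrt (measure lborel A)) * (WB * sqrt (measure lborel B))"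
  define D :: real where "D = 10 ^ 6"
  have D: "D > 0" by (simp add: D_def)
  define \<kappa> :: real where "\<kappa> = exp (-20)"
  have \<kappa>: "\<kappa> > 0" by (simp add: \<kappa>_def)
  define c0 where "c0 = D powr - (\<bar>a\<bar> + \<bar>b\<bar>)"
  define c1 where "c1 = D powr (\<bar>a1\<bar> + \<bar>b1\<bar>)"
  define c2 where "c2 = D powr (\<bar>a2\<bar> + \<bar>b2\<bar>)"
  have c: "c0 > 0" "c1 > 0" "c2 > 0"
    using D by (simp_all add: c0_def c1_def c2_def)
  \<comment> \<open>All losses on the left side: \<open>c0\<close> from the output weights,
    \<open>\<kappa>\<^sup>2\<close> from the two packets, \<open>1 / D\<close> and its root from the
    measures of \<open>B'\<close> and \<open>C\<close>.\<close>
  define L where "L = c0 * (\<kappa>\<^sup>2 * (1 / D) * sqrt (1 / D))"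
  have L: "L > 0"
    using c D \<kappa> by (simp add: L_def)
  show thesis
  proof (rule that[of "K0 * c1 * c2 * D / L"])
    show "K0 * c1 * c2 * D / L > 0"
      using K0 c D L by simp
  next
    fix X1 Y1 X2 Y2 X0 Y0 \<theta> V W
    assume config: "packet_config e e' X1 Y1 X2 Y2 X0 Y0 \<theta> V W"
    let ?P = "X0 powr a * Y0 powr b" and ?Q1 = "X1 powr a1 * Y1 powr b1" and ?Q2 = "X2 powr a2 * Y2 powr b2"
    from config show "?P * \<theta> * W \<le> K0 * c1 * c2 * D / L * (?Q1 * ?Q2 * sqrt V)"
      unfolding packet_config_def
    proof (elim exE conjE)
      fix qF \<tau>F dF pF rF fA hA qG \<tau>G dG pG rG fB hB fB' hB' pB' rB' fC hC pC rC
      assume F: "packet_at e qF \<tau>F dF pF rF fA hA X1 Y1" and G: "packet_at e' qG \<tau>G dG pG rG fB hB X2 Y2"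
        and B'0: "continuous_on UNIV fB'" "0 \<le> hB'" "\<forall>j. 0 \<le> rB' $ j"
        and C0: "continuous_on UNIV fC" "0 \<le> hC" "\<forall>j. 0 \<le> rC $ j"
        and pos: "0 < X0" "0 < Y0" "0 \<le> \<theta>" "0 < V" "0 < W"
        and angle: "\<forall>\<xi>1 \<xi>2. (\<forall>j. \<bar>\<xi>1 $ j - pF $ j\<bar> \<le> rF $ j) \<longrightarrow> (\<forall>j. \<bar>\<xi>2 $ j - pG $ j\<bar> \<le> rG $ j) \<longrightarrow>
          \<theta> \<le> e * (\<xi>1 $ 3 / norm \<xi>1) - e' * (\<xi>2 $ 3 / norm \<xi>2)"
        and inF: "\<forall>\<tau>0 \<xi>0 \<tau>2 \<xi>2. (\<tau>0, \<xi>0) \<in> slab fC hC pC rC \<longrightarrow> (\<tau>2, \<xi>2) \<in> slab fB' hB' pB' rB' \<longrightarrow>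
          \<bar>qF (\<tau>0 + \<tau>2, \<xi>0 + \<xi>2)\<bar> \<le> 1/2 \<and> \<bar>\<tau>0 + \<tau>2 - \<tau>F\<bar> \<le> dF / 2 \<and> (\<forall>j. \<bar>(\<xi>0 + \<xi>2) $ j - pF $ j\<bar> \<le> rF $ j / 2)"
        and inG: "\<forall>\<tau>2 \<xi>2. (\<tau>2, \<xi>2) \<in> slab fB' hB' pB' rB' \<longrightarrow>
          \<bar>qG (\<tau>2, \<xi>2)\<bar> \<le> 1/2 \<and> \<bar>\<tau>2 - \<tau>G\<bar> \<le> dG / 2 \<and> (\<forall>j. \<bar>\<xi>2 $ j - pG $ j\<bar> \<le> rG $ j / 2)"
        and out: "\<forall>\<tau> \<xi>. (\<tau>, \<xi>) \<in> slab fC hC pC rC \<longrightarrow> comparable (jbr \<xi>) X0 \<and> comparable (jbr (\<bar>\<tau>\<bar> - norm \<xi>)) Y0"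
        and V: "2 * hA * (\<Prod>j\<in>UNIV. 2 * rF $ j) \<le> 10 ^ 6 * V" and W: "2 * hB * (\<Prod>j\<in>UNIV. 2 * rG $ j) \<le> 10 ^ 6 * W"
        and WB': "W \<le> 10 ^ 6 * (2 * hB' * (\<Prod>j\<in>UNIV. 2 * rB' $ j))" and WC: "W \<le> 10 ^ 6 * (2 * hC * (\<Prod>j\<in>UNIV. 2 * rC $ j))"
      note B' = B'0(1,2) B'0(3)[rule_format] and C = C0(1,2) C0(3)[rule_format]
      from F have F': "qF \<in> smooth_alg" "0 < dF" "\<And>j. 0 < rF $ j" "continuous_on UNIV fA" "0 \<le> hA" "0 < X1" "0 < Y1"
        by (auto simp: packet_at_def)
      from G have G': "qG \<in> smooth_alg" "0 < dG" "\<And>j. 0 < rG $ j" "continuous_on UNIV fB" "0 \<le> hB" "0 < X2" "0 < Y2"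
        by (auto simp: packet_at_def)
      have rF: "\<And>j. 0 \<le> rF $ j" and rG: "\<And>j. 0 \<le> rG $ j"
        using F'(3) G'(3) by (auto intro: less_imp_le)
      let ?A = "slab fA hA pF rF" and ?B = "slab fB hB pG rG" and ?B' = "slab fB' hB' pB' rB'" and ?C = "slab fC hC pC rC"
      have "c0 * ?P * (\<theta> * \<kappa>\<^sup>2 * measure lborel ?B') * sqrt (measure lborel ?C)
          \<le> K0 * (c1 * ?Q1 * sqrt (measure lborel ?A)) * (c2 * ?Q2 * sqrt (measure lborel ?B))"
      proof (rule test[where F="packet qF \<tau>F dF pF rF" and G="packet qG \<tau>G dG pG rG"])
        show "test_fun (packet qF \<tau>F dF pF rF)" "test_fun (packet qG \<tau>G dG pG rG)"
          by (intro test_fun_packet F' G')+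
        show "packet qF \<tau>F dF pF rF (\<tau>, \<xi>) = 0" if "norm \<xi> < 1" for \<tau> \<xi>
          using packet_at_bound(3)[OF F, of \<tau> \<xi>] that by force
        show "(\<tau>, \<xi>) \<in> ?A \<and> jbr \<xi> powr a1 * jbr (\<tau> + e * norm \<xi>) powr b1 \<le> c1 * ?Q1"
          if "packet qF \<tau>F dF pF rF (\<tau>, \<xi>) \<noteq> 0" for \<tau> \<xi>
          using packet_at_bound(1)[OF F that] packet_at_bound(2)[OF F that, of a1 b1] by (simp add: c1_def D_def)
        show "(\<tau>, \<xi>) \<in> ?B \<and> jbr \<xi> powr a2 * jbr (\<tau> + e' * norm \<xi>) powr b2 \<le> c2 * ?Q2"
          if "packet qG \<tau>G dG pG rG (\<tau>, \<xi>) \<noteq> 0" for \<tau> \<xi>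
          using packet_at_bound(1)[OF G that] packet_at_bound(2)[OF G that, of a2 b2] by (simp add: c2_def D_def)
        show "\<theta> \<le> e * dir3 (\<zeta> + \<eta>) - e' * dir3 \<eta>"
          if "packet qF \<tau>F dF pF rF (\<zeta> + \<eta>) \<noteq> 0" "packet qG \<tau>G dG pG rG \<eta> \<noteq> 0" for \<zeta> \<eta>
        proof -
          have "\<bar>snd (\<zeta> + \<eta>) $ j - pF $ j\<bar> \<le> rF $ j" for j
            by (rule packet_nonzero(3)[OF _ F'(2,3), where q=qF and ?p0.0=\<tau>F and \<tau>="fst (\<zeta> + \<eta>)"]) (simp only: prod.collapse that not_False_eq_True)
          moreover have "\<bar>snd \<eta> $ j - pG $ j\<bar> \<le> rG $ j" for j
            by (rule packet_nonzero(3)[OF _ G'(2,3), where q=qG and ?p0.0=\<tau>G and \<tau>="fst \<eta>"]) (simp only: prod.collapse that not_False_eq_True)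
          ultimately show ?thesis
            unfolding dir3_def using angle by blast
        qed
        show "\<kappa> \<le> packet qF \<tau>F dF pF rF (\<zeta> + \<eta>) \<and> \<kappa> \<le> packet qG \<tau>G dG pG rG \<eta>"
          if "\<zeta> \<in> ?C" "\<eta> \<in> ?B'" for \<zeta> \<eta>
        proof -
          obtain \<tau>0 \<xi>0 \<tau>2 \<xi>2 where z: "\<zeta> = (\<tau>0, \<xi>0)" "\<eta> = (\<tau>2, \<xi>2)" by (cases \<zeta>, cases \<eta>)
          note 1 = inF[rule_format, OF that[unfolded z]] and 2 = inG[rule_format, OF that(2)[unfolded z]]
          show ?thesis
            unfolding z \<kappa>_def add_Pair
          proof
            show "exp (-20) \<le> packet qF \<tau>F dF pF rF (\<tau>0 + \<tau>2, \<xi>0 + \<xi>2)"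
              by (rule packet_ge[OF _ _ _ F'(2,3)]) (use 1 in blast)+
            show "exp (-20) \<le> packet qG \<tau>G dG pG rG (\<tau>2, \<xi>2)"
              by (rule packet_ge[OF _ _ _ G'(2,3)]) (use 2 in blast)+
          qed
        qed
        show "c0 * ?P \<le> jbr \<xi> powr a * jbr (\<bar>\<tau>\<bar> - norm \<xi>) powr b" if "(\<tau>, \<xi>) \<in> ?C" for \<tau> \<xi>
        proof -
          from out[rule_format, OF that] have "comparable X0 (jbr \<xi>)" "comparable Y0 (jbr (\<bar>\<tau>\<bar> - norm \<xi>))"
            by (auto intro: comparable_sym)
          then have "?P \<le> (D powr \<bar>a\<bar> * jbr \<xi> powr a) * (D powr \<bar>b\<bar> * jbr (\<bar>\<tau>\<bar> - norm \<xi>) powr b)"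
            unfolding D_def using pos by (intro mult_mono comparable_powr jbr_pos) auto
          then have "c0 * ?P \<le> c0 * ((D powr \<bar>a\<bar> * jbr \<xi> powr a) * (D powr \<bar>b\<bar> * jbr (\<bar>\<tau>\<bar> - norm \<xi>) powr b))"
            using c by (intro mult_left_mono) auto
          also have "\<dots> = (c0 * (D powr \<bar>a\<bar> * D powr \<bar>b\<bar>)) * (jbr \<xi> powr a * jbr (\<bar>\<tau>\<bar> - norm \<xi>) powr b)"
            by (simp only: mult_ac)
          also have "c0 * (D powr \<bar>a\<bar> * D powr \<bar>b\<bar>) = 1"
            using D unfolding c0_def powr_add[symmetric] by simp
          finally show ?thesis by simp
        qed
      qed (use F' G' B' C rF rG pos c \<kappa> in \<open>auto intro!: packet_bounds slab_in_borel emeasure_slab_finite\<close>)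
      moreover have "L * (?P * \<theta> * W) * sqrt W
          \<le> c0 * ?P * (\<theta> * \<kappa>\<^sup>2 * measure lborel ?B') * sqrt (measure lborel ?C)"
      proof -
        have "W / D \<le> measure lborel ?B'" "W / D \<le> measure lborel ?C"
          using WB'[folded D_def] WC[folded D_def] D
          unfolding measure_slab[OF B'] measure_slab[OF C] by (simp_all only: pos_divide_le_eq mult.commute[of _ D])
        then have "c0 * ?P * (\<theta> * \<kappa>\<^sup>2 * (W / D)) * sqrt (W / D)
          \<le> c0 * ?P * (\<theta> * \<kappa>\<^sup>2 * measure lborel ?B') * sqrt (measure lborel ?C)"
          using c pos D \<kappa> by (intro mult_mono mult_left_mono real_sqrt_le_mono mult_nonneg_nonneg) auto
        moreover have "sqrt (W / D) = sqrt (1 / D) * sqrt W"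
          by (simp add: real_sqrt_mult[symmetric])
        ultimately show ?thesis
          by (simp add: L_def mult_ac)
      qed
      moreover have "K0 * (c1 * ?Q1 * sqrt (measure lborel ?A)) * (c2 * ?Q2 * sqrt (measure lborel ?B))
          \<le> K0 * (c1 * ?Q1 * sqrt (D * V)) * (c2 * ?Q2 * sqrt (D * W))"
      proof -
        have "measure lborel ?A \<le> D * V" "measure lborel ?B \<le> D * W"
          using V[folded D_def] W[folded D_def]
          unfolding measure_slab[OF F'(4,5) rF] measure_slab[OF G'(4,5) rG] by simp_all
        then show ?thesis
          using K0 c pos D by (intro mult_mono mult_left_mono real_sqrt_le_mono mult_nonneg_nonneg) auto
      qed
      moreover have "K0 * (c1 * ?Q1 * sqrt (D * V)) * (c2 * ?Q2 * sqrt (D * W))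
          = (K0 * c1 * c2 * D) * (?Q1 * ?Q2 * sqrt V) * sqrt W"
      proof -
        have "sqrt (D * V) * sqrt (D * W) = D * (sqrt V * sqrt W)"
          using D by (simp add: real_sqrt_mult mult_ac)
        then have "K0 * (c1 * ?Q1) * (c2 * ?Q2) * (sqrt (D * V) * sqrt (D * W)) = K0 * (c1 * ?Q1) * (c2 * ?Q2) * (D * (sqrt V * sqrt W))"
          by (simp only:)
        then show ?thesis
          by (simp only: mult_ac)
      qed
      ultimately have "L * (?P * \<theta> * W) * sqrt W \<le> (K0 * c1 * c2 * D) * (?Q1 * ?Q2 * sqrt V) * sqrt W"
        by linarith
      then have "L * (?P * \<theta> * W) \<le> (K0 * c1 * c2 * D) * (?Q1 * ?Q2 * sqrt V)"
        using pos by simp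
      then show "?P * \<theta> * W \<le> K0 * c1 * c2 * D / L * (?Q1 * ?Q2 * sqrt V)"
        using L by (simp add: field_simps)
    qed
  qed
qed

section \<open>Necessary conditions\<close>

lemma powr_growth_le:
  assumes "\<And>l::real. l \<ge> l0 \<Longrightarrow> l powr p \<le> K * l powr q"
  shows "p \<le> q"
proof (rule ccontr)
  assume "\<not> p \<le> q"
  then have pq: "p - q > 0" by simp
  \<comment> \<open>The second summand makes \<open>l powr (p - q)\<close> at least
    \<open>\<bar>K\<bar> + 1\<close>, which exceeds \<open>K\<close>; the first keeps
    \<open>l\<close> in the admissible range and positive.\<close>
  define l where "l = max l0 1 + (\<bar>K\<bar> + 1) powr (1 / (p - q))"
  have r: "(\<bar>K\<bar> + 1) powr (1 / (p - q)) \<ge> 0"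
    by (rule powr_ge_zero)
  then have l: "l \<ge> l0" "l \<ge> 1"
    unfolding l_def by linarith+
  have "\<bar>K\<bar> + 1 = ((\<bar>K\<bar> + 1) powr (1 / (p - q))) powr (p - q)"
    using pq by (simp add: powr_powr)
  also have "\<dots> \<le> l powr (p - q)"
    using pq r by (intro powr_mono2) (linarith | simp add: l_def)+
  also have "l powr (p - q) \<le> K"
    using assms[OF l(1)] l unfolding powr_diff by (simp add: pos_divide_le_eq)
  finally show False by simp
qed

section \<open>The three frequency configurations\<close>

lemma norm3_le: "norm \<xi> \<le> \<bar>\<xi> $ 1\<bar> + \<bar>\<xi> $ 2\<bar> + \<bar>\<xi> $ 3\<bar>" for \<xi> :: "real^3"
  using norm_le_l1_cart[of \<xi>] by (simp add: sum_3)

lemma norm3_power2: "(norm \<xi>)\<^sup>2 = (\<xi> $ 1)\<^sup>2 + (\<xi> $ 2)\<^sup>2 + (\<xi> $ 3)\<^sup>2" for \<xi> :: "real^3"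
  unfolding power2_norm_eq_inner by (simp add: inner_vec_def sum_3 power2_eq_square)

lemma prod_3: "(\<Prod>j\<in>UNIV. f j) = f 1 * f 2 * f (3::3)"
  unfolding UNIV_3 by (simp add: mult.assoc)

lemma comparable_jbr_1: "norm x \<le> 1000 \<Longrightarrow> comparable (jbr x) 1"
  by (simp add: comparable_def jbr_def)

lemma comparable_jbr: "1 \<le> l \<Longrightarrow> l \<le> 1000 * norm x \<Longrightarrow> norm x \<le> 1000 * l \<Longrightarrow> comparable (jbr x) l"
  by (simp add: comparable_def jbr_def)

text \<open>Introduction form of the definition, in which unification with the facts about the
  packets and slabs supplies the existential witnesses.\<close>

lemma packet_configI:
  assumes "packet_at e qF \<tau>F dF pF rF fA hA X1 Y1"
    and "packet_at e' qG \<tau>G dG pG rG fB hB X2 Y2"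
    and "continuous_on UNIV fB'"
    and "0 \<le> hB'"
    and "(\<forall>j. 0 \<le> rB' $ j)"
    and "continuous_on UNIV fC"
    and "0 \<le> hC"
    and "(\<forall>j. 0 \<le> rC $ j)"
    and "0 < X0"
    and "0 < Y0"
    and "0 \<le> \<theta>"
    and "0 < V"
    and "0 < W"
    and "(\<forall>\<xi>1 \<xi>2. (\<forall>j. \<bar>\<xi>1 $ j - pF $ j\<bar> \<le> rF $ j) \<longrightarrow> (\<forall>j. \<bar>\<xi>2 $ j - pG $ j\<bar> \<le> rG $ j) \<longrightarrow>
        \<theta> \<le> e * (\<xi>1 $ 3 / norm \<xi>1) - e' * (\<xi>2 $ 3 / norm \<xi>2))"
    and "(\<forall>\<tau>0 \<xi>0 \<tau>2 \<xi>2. (\<tau>0, \<xi>0) \<in> slab fC hC pC rC \<longrightarrow> (\<tau>2, \<xi>2) \<in> slab fB' hB' pB' rB' \<longrightarrow>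
        \<bar>qF (\<tau>0 + \<tau>2, \<xi>0 + \<xi>2)\<bar> \<le> 1/2 \<and> \<bar>\<tau>0 + \<tau>2 - \<tau>F\<bar> \<le> dF / 2 \<and> (\<forall>j. \<bar>(\<xi>0 + \<xi>2) $ j - pF $ j\<bar> \<le> rF $ j / 2))"
    and "(\<forall>\<tau>2 \<xi>2. (\<tau>2, \<xi>2) \<in> slab fB' hB' pB' rB' \<longrightarrow>
        \<bar>qG (\<tau>2, \<xi>2)\<bar> \<le> 1/2 \<and> \<bar>\<tau>2 - \<tau>G\<bar> \<le> dG / 2 \<and> (\<forall>j. \<bar>\<xi>2 $ j - pG $ j\<bar> \<le> rG $ j / 2))"
    and "(\<forall>\<tau> \<xi>. (\<tau>, \<xi>) \<in> slab fC hC pC rC \<longrightarrow> comparable (jbr \<xi>) X0 \<and> comparable (jbr (\<bar>\<tau>\<bar> - norm \<xi>)) Y0)"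
    and "2 * hA * (\<Prod>j\<in>UNIV. 2 * rF $ j) \<le> 10 ^ 6 * V"
    and "2 * hB * (\<Prod>j\<in>UNIV. 2 * rG $ j) \<le> 10 ^ 6 * W"
    and "W \<le> 10 ^ 6 * (2 * hB' * (\<Prod>j\<in>UNIV. 2 * rB' $ j))"
    and "W \<le> 10 ^ 6 * (2 * hC * (\<Prod>j\<in>UNIV. 2 * rC $ j))"
  shows "packet_config e e' X1 Y1 X2 Y2 X0 Y0 \<theta> V W"
  unfolding packet_config_def
  by (rule exI[of _ qF], rule exI[of _ \<tau>F], rule exI[of _ dF], rule exI[of _ pF], rule exI[of _ rF], rule exI[of _ fA], rule exI[of _ hA],
      rule exI[of _ qG], rule exI[of _ \<tau>G], rule exI[of _ dG], rule exI[of _ pG], rule exI[of _ rG], rule exI[of _ fB], rule exI[of _ hB],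
      rule exI[of _ fB'], rule exI[of _ hB'], rule exI[of _ pB'], rule exI[of _ rB'], rule exI[of _ fC], rule exI[of _ hC], rule exI[of _ pC], rule exI[of _ rC],
      intro conjI; fact assms)

text \<open>The second packet sits on its cone at \<open>(l; 0, 0, l)\<close> and the first at
  bounded frequency, so the difference is again within bounded distance of the cone, at frequency of
  order \<open>l\<close>. Opposite signs turn the symbol into a sum of two nonnegative direction
  components, so there is no null gain.\<close>

lemma low_high_config:
  assumes l: "l \<ge> (20::real)"
  shows "packet_config 1 (-1) 1 1 l 1 l 1 (1/4) 1 1"
proof -
  \<comment> \<open>The slabs \<open>B'\<close> and \<open>C\<close> have radius 1, so their sums
    lie within 2, half of the radius 4. The centre 10 keeps the whole packet at frequency at least
    6.\<close>
  have F: "packet_at 1 (\<lambda>_. 0) 0 4 (vector [0, 0, 10]) (vector [4, 4, 4]) (\<lambda>_. 0) 4 1 1"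
  proof -
    have "1 \<le> norm \<xi> \<and> comparable (jbr \<xi>) 1 \<and> comparable (jbr (\<tau> + norm \<xi>)) 1"
      if "\<bar>\<tau>\<bar> \<le> 4" "\<bar>\<xi> $ 1\<bar> \<le> 4" "\<bar>\<xi> $ 2\<bar> \<le> 4" "\<bar>\<xi> $ 3 - 10\<bar> \<le> 4" for \<tau> and \<xi> :: "real^3"
    proof -
      have x: "6 \<le> \<xi> $ 3" "\<bar>\<xi> $ 3\<bar> \<le> 14" using that(4) by linarith+
      have n: "6 \<le> norm \<xi>" "norm \<xi> \<le> 22"
        using component_le_norm_cart[of \<xi> 3] norm3_le[of \<xi>] that(2,3) x by linarith+
      have "\<bar>\<tau> + norm \<xi>\<bar> \<le> 1000"
        using n that(1) by linarith
      with n show ?thesis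
        by (intro conjI comparable_jbr_1) auto
    qed
    then show ?thesis
      unfolding packet_at_def by (simp add: forall_3 smooth_alg_const)
  qed
  have G: "packet_at (-1) (\<lambda>_. 0) l 2 (vector [0, 0, l]) (vector [2, 2, 2]) (\<lambda>_. l) 2 l 1"
  proof -
    have "1 \<le> norm \<xi> \<and> comparable (jbr \<xi>) l \<and> comparable (jbr (\<tau> - norm \<xi>)) 1"
      if "\<bar>\<tau> - l\<bar> \<le> 2" "\<bar>\<xi> $ 1\<bar> \<le> 2" "\<bar>\<xi> $ 2\<bar> \<le> 2" "\<bar>\<xi> $ 3 - l\<bar> \<le> 2" for \<tau> and \<xi> :: "real^3"
    proof -
      have x: "l - 2 \<le> \<xi> $ 3" "\<bar>\<xi> $ 3\<bar> \<le> l + 2" using that(4) l by linarith+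
      have n: "l - 2 \<le> norm \<xi>" "norm \<xi> \<le> l + 6"
        using component_le_norm_cart[of \<xi> 3] norm3_le[of \<xi>] that(2,3) x by linarith+
      have "\<bar>\<tau> - norm \<xi>\<bar> \<le> 1000"
        using n that(1) by linarith
      with n l show ?thesis
        by (intro conjI comparable_jbr_1 comparable_jbr) auto
    qed
    then show ?thesis
      unfolding packet_at_def using l by (simp add: forall_3 smooth_alg_const)
  qed
  have angle: "\<forall>(\<xi>1 :: real^3) (\<xi>2 :: real^3). (\<forall>j. \<bar>\<xi>1 $ j - vector [0, 0, 10] $ j\<bar> \<le> vector [4, 4, 4] $ j) \<longrightarrow>
      (\<forall>j. \<bar>\<xi>2 $ j - vector [0, 0, l] $ j\<bar> \<le> vector [2, 2, 2] $ j) \<longrightarrow>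
      1/4 \<le> 1 * (\<xi>1 $ 3 / norm \<xi>1) - (-1) * (\<xi>2 $ 3 / norm \<xi>2)"
  proof (intro allI impI)
    fix \<xi>1 \<xi>2 :: "real^3"
    assume that: "\<forall>j. \<bar>\<xi>1 $ j - vector [0, 0, 10] $ j\<bar> \<le> vector [4, 4, 4] $ j" "\<forall>j. \<bar>\<xi>2 $ j - vector [0, 0, l] $ j\<bar> \<le> vector [2, 2, 2] $ j"
    from that have c: "\<bar>\<xi>1 $ 1\<bar> \<le> 4" "\<bar>\<xi>1 $ 2\<bar> \<le> 4" "\<bar>\<xi>1 $ 3 - 10\<bar> \<le> 4" "\<bar>\<xi>2 $ 3 - l\<bar> \<le> 2"
      by (simp_all add: forall_3)
    have x: "6 \<le> \<xi>1 $ 3" "\<bar>\<xi>1 $ 3\<bar> = \<xi>1 $ 3" "0 \<le> \<xi>2 $ 3" using c(3,4) l by linarith+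
    have "norm \<xi>1 \<le> 4 * \<xi>1 $ 3" "0 < norm \<xi>1"
      using component_le_norm_cart[of \<xi>1 3] norm3_le[of \<xi>1] c(1,2) x by linarith+
    then have "1/4 \<le> \<xi>1 $ 3 / norm \<xi>1" "0 \<le> \<xi>2 $ 3 / norm \<xi>2"
      using x by (auto simp: field_simps)
    then show "1/4 \<le> 1 * (\<xi>1 $ 3 / norm \<xi>1) - (-1) * (\<xi>2 $ 3 / norm \<xi>2)" by linarith
  qed
  have out: "\<forall>\<tau> \<xi>. (\<tau>, \<xi>) \<in> slab (\<lambda>_. - l) 1 (vector [0, 0, 10 - l]) (vector [1, 1, 1]) \<longrightarrow>
      comparable (jbr \<xi>) l \<and> comparable (jbr (\<bar>\<tau>\<bar> - norm \<xi>)) 1"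
  proof (intro allI impI)
    fix \<tau> \<xi>
    assume that: "(\<tau>, \<xi>) \<in> slab (\<lambda>_. - l) 1 (vector [0, 0, 10 - l]) (vector [1, 1, 1])"
    from that have c: "\<bar>\<tau> + l\<bar> \<le> 1" "\<bar>\<xi> $ 1\<bar> \<le> 1" "\<bar>\<xi> $ 2\<bar> \<le> 1" "\<bar>\<xi> $ 3 - (10 - l)\<bar> \<le> 1"
      by (simp_all add: slab_def forall_3)
    have x: "l - 11 \<le> \<bar>\<xi> $ 3\<bar>" "\<bar>\<xi> $ 3\<bar> \<le> l - 9" using c(4) l by linarith+
    have n: "l - 11 \<le> norm \<xi>" "norm \<xi> \<le> l"
      using component_le_norm_cart[of \<xi> 3] norm3_le[of \<xi>] c(2,3) x by linarith+
    have "\<bar>\<bar>\<tau>\<bar> - norm \<xi>\<bar> \<le> 1000"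
      using n c(1) l by linarith
    with n l show "comparable (jbr \<xi>) l \<and> comparable (jbr (\<bar>\<tau>\<bar> - norm \<xi>)) 1"
      by (intro conjI comparable_jbr_1 comparable_jbr) auto
  qed
  let ?inF = "\<lambda>\<tau> \<xi>::real^3. \<bar>0::real\<bar> \<le> 1/2 \<and> \<bar>\<tau> - 0\<bar> \<le> 4 / 2 \<and> (\<forall>j. \<bar>\<xi> $ j - vector [0, 0, 10] $ j\<bar> \<le> vector [4, 4, 4] $ j / 2)"
  have inF: "\<forall>\<tau>0 \<xi>0 \<tau>2 \<xi>2. (\<tau>0, \<xi>0) \<in> slab (\<lambda>_. - l) 1 (vector [0, 0, 10 - l]) (vector [1, 1, 1]) \<longrightarrow>
      (\<tau>2, \<xi>2) \<in> slab (\<lambda>_. l) 1 (vector [0, 0, l]) (vector [1, 1, 1]) \<longrightarrow> ?inF (\<tau>0 + \<tau>2) (\<xi>0 + \<xi>2)"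
  proof (intro allI impI)
    fix \<tau>0 \<xi>0 \<tau>2 \<xi>2
    assume that: "(\<tau>0, \<xi>0) \<in> slab (\<lambda>_. - l) 1 (vector [0, 0, 10 - l]) (vector [1, 1, 1])"
      "(\<tau>2, \<xi>2) \<in> slab (\<lambda>_. l) 1 (vector [0, 0, l]) (vector [1, 1, 1])"
    from that have c: "\<bar>\<tau>0 + l\<bar> \<le> 1" "\<bar>\<xi>0 $ 1\<bar> \<le> 1" "\<bar>\<xi>0 $ 2\<bar> \<le> 1" "\<bar>\<xi>0 $ 3 - (10 - l)\<bar> \<le> 1"
      "\<bar>\<tau>2 - l\<bar> \<le> 1" "\<bar>\<xi>2 $ 1\<bar> \<le> 1" "\<bar>\<xi>2 $ 2\<bar> \<le> 1" "\<bar>\<xi>2 $ 3 - l\<bar> \<le> 1"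
      by (simp_all add: slab_def forall_3)
    have "\<bar>\<tau>0 + \<tau>2\<bar> \<le> 2" using c(1,5) by linarith
    moreover have "\<bar>\<xi>0 $ 1 + \<xi>2 $ 1\<bar> \<le> 2" using c(2,6) by linarith
    moreover have "\<bar>\<xi>0 $ 2 + \<xi>2 $ 2\<bar> \<le> 2" using c(3,7) by linarith
    moreover have "\<bar>\<xi>0 $ 3 + \<xi>2 $ 3 - 10\<bar> \<le> 2" using c(4,8) by linarith
    ultimately show "?inF (\<tau>0 + \<tau>2) (\<xi>0 + \<xi>2)" by (simp add: forall_3)
  qed
  have inG: "\<forall>\<tau>2 \<xi>2. (\<tau>2, \<xi>2) \<in> slab (\<lambda>_. l) 1 (vector [0, 0, l]) (vector [1, 1, 1]) \<longrightarrow>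
      \<bar>0::real\<bar> \<le> 1/2 \<and> \<bar>\<tau>2 - l\<bar> \<le> 2 / 2 \<and> (\<forall>j. \<bar>\<xi>2 $ j - vector [0, 0, l] $ j\<bar> \<le> vector [2, 2, 2] $ j / 2)"
    by (simp add: slab_def forall_3)
  show ?thesis
    by (rule packet_configI[OF F G _ _ _ _ _ _ _ _ _ _ _ angle inF inG out])
       (use l in \<open>simp_all add: forall_3 prod_3\<close>)
qed

text \<open>Both \<open>B'\<close> and \<open>C\<close> lie near the forward cone, so their sums
  have \<open>\<tau>\<close> of order \<open>l\<close> and positive, hence are at distance of order
  \<open>l\<close> from the cone \<open>\<tau> = - norm \<xi>\<close> that belongs to the first
  sign. This is how \<open>b1\<close> enters. All frequencies point roughly along the third axis,
  and with opposite signs the symbol is at least 1/2.\<close>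

lemma shell_config:
  assumes l: "l \<ge> (100::real)"
  shows "packet_config 1 (-1) l l l 1 l 1 (1/2) (l ^ 4) (l ^ 3)"
proof -
  \<comment> \<open>A polynomial substitute for the distance to the cone: it equals
    \<open>\<tau> - norm \<xi>\<close> times \<open>(\<tau> + norm \<xi>) / l\<close>, and the
    second factor has size about 1 on the packet.\<close>
  define q :: "spacetime \<Rightarrow> real" where "q = (\<lambda>\<zeta>. ((fst \<zeta>)\<^sup>2 - (norm (snd \<zeta>))\<^sup>2) / l)"
  have q: "q \<in> smooth_alg"
  proof -
    have "(\<lambda>\<zeta>::spacetime. (fst \<zeta> * fst \<zeta> + (-1) * (snd \<zeta> $ 1 * snd \<zeta> $ 1 + snd \<zeta> $ 2 * snd \<zeta> $ 2 + snd \<zeta> $ 3 * snd \<zeta> $ 3) - 0) / l) \<in> smooth_alg"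
      by (intro smooth_alg_affine smooth_alg_add smooth_alg_mult smooth_alg_const smooth_alg_fst smooth_alg_snd_nth)
    moreover have "((fst \<zeta>)\<^sup>2 - (norm (snd \<zeta>))\<^sup>2) / l = (fst \<zeta> * fst \<zeta> + (-1) * (snd \<zeta> $ 1 * snd \<zeta> $ 1 + snd \<zeta> $ 2 * snd \<zeta> $ 2 + snd \<zeta> $ 3 * snd \<zeta> $ 3) - 0) / l" for \<zeta> :: spacetime
      unfolding norm3_power2 by (simp add: power2_eq_square)
    ultimately show ?thesis
      by (simp only: q_def)
  qed
  have q_eq: "\<bar>q (\<tau>, \<xi>)\<bar> = \<bar>\<tau> - norm \<xi>\<bar> * (\<tau> + norm \<xi>) / l" if "\<tau> \<ge> 0" for \<tau> \<xi>
  proof -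
    have "\<tau>\<^sup>2 - (norm \<xi>)\<^sup>2 = (\<tau> - norm \<xi>) * (\<tau> + norm \<xi>)"
      by (simp add: power2_eq_square algebra_simps)
    then show ?thesis
      using that l by (simp add: q_def abs_mult)
  qed
  have F: "packet_at 1 (\<lambda>_. 0) (2 * l) l (vector [0, 0, 2 * l]) (vector [l / 5, l / 5, l / 5]) (\<lambda>_. 2 * l) l l l"
  proof -
    have "1 \<le> norm \<xi> \<and> comparable (jbr \<xi>) l \<and> comparable (jbr (\<tau> + norm \<xi>)) l"
      if "\<bar>\<tau> - 2 * l\<bar> \<le> l" "\<bar>\<xi> $ 1\<bar> \<le> l / 5" "\<bar>\<xi> $ 2\<bar> \<le> l / 5" "\<bar>\<xi> $ 3 - 2 * l\<bar> \<le> l / 5" for \<tau> and \<xi> :: "real^3"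
    proof -
      have x: "l \<le> \<xi> $ 3" "\<bar>\<xi> $ 3\<bar> \<le> 3 * l" using that(4) l by linarith+
      have n: "l \<le> norm \<xi>" "norm \<xi> \<le> 4 * l"
        using component_le_norm_cart[of \<xi> 3] norm3_le[of \<xi>] that(2,3) x l by linarith+
      have "l \<le> norm (\<tau> + norm \<xi>)" "norm (\<tau> + norm \<xi>) \<le> 7 * l"
        unfolding real_norm_def using n that(1) l by linarith+
      with n l show ?thesis
        by (intro conjI comparable_jbr) linarith+
    qed
    then show ?thesis
      unfolding packet_at_def using l by (simp add: forall_3 smooth_alg_const)
  qed
  have G: "packet_at (-1) q l (l / 2) (vector [0, 0, l]) (vector [l / 10, l / 10, l / 10]) norm 1 l 1"
  proof -
    have "1 \<le> norm \<xi> \<and> \<bar>\<tau> - norm \<xi>\<bar> \<le> 1 \<and> comparable (jbr \<xi>) l \<and> comparable (jbr (\<tau> - norm \<xi>)) 1"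
      if "\<bar>q (\<tau>, \<xi>)\<bar> \<le> 1" "\<bar>\<tau> - l\<bar> \<le> l / 2" "\<bar>\<xi> $ 1\<bar> \<le> l / 10" "\<bar>\<xi> $ 2\<bar> \<le> l / 10" "\<bar>\<xi> $ 3 - l\<bar> \<le> l / 10"
      for \<tau> and \<xi> :: "real^3"
    proof -
      have x: "l / 2 \<le> \<xi> $ 3" "\<bar>\<xi> $ 3\<bar> \<le> 2 * l" using that(5) l by linarith+
      have n: "l / 2 \<le> norm \<xi>" "norm \<xi> \<le> 3 * l"
        using component_le_norm_cart[of \<xi> 3] norm3_le[of \<xi>] that(3,4) x l by linarith+
      have \<tau>: "l / 2 \<le> \<tau>" using that(2) by linarith
      have "\<bar>\<tau> - norm \<xi>\<bar> * l \<le> \<bar>\<tau> - norm \<xi>\<bar> * (\<tau> + norm \<xi>)"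
        using n \<tau> by (intro mult_left_mono) auto
      also have "\<dots> \<le> 1 * l"
        using that(1) q_eq[of \<tau> \<xi>] \<tau> l by (simp add: pos_divide_le_eq)
      finally have "\<bar>\<tau> - norm \<xi>\<bar> \<le> 1"
        using l by simp
      with n l show ?thesis
        by (intro conjI comparable_jbr comparable_jbr_1) auto
    qed
    then show ?thesis
      unfolding packet_at_def using l q by (simp add: forall_3 continuous_on_norm_id)
  qed
  \<comment> \<open>One slab serves as both \<open>B'\<close> and \<open>C\<close>. On it
    \<open>\<tau> + norm \<xi> \<le> 3 * l\<close>, so the thickness 1/8 gives
    \<open>\<bar>q\<bar> \<le> 3/8\<close>, below the required 1/2. The radius \<open>l / 20\<close>
    is half that of \<open>G\<close>, and doubled it is half that of \<open>F\<close>.\<close>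
  let ?S = "slab norm (1/8) (vector [0, 0, l]) (vector [l / 20, l / 20, l / 20])"
  have S: "\<bar>\<tau> - norm \<xi>\<bar> \<le> 1/8" "\<bar>\<tau> - l\<bar> \<le> l / 4" "\<bar>\<xi> $ 1\<bar> \<le> l / 20" "\<bar>\<xi> $ 2\<bar> \<le> l / 20" "\<bar>\<xi> $ 3 - l\<bar> \<le> l / 20"
      "l / 2 \<le> norm \<xi>" "norm \<xi> \<le> 23 / 20 * l"
    if "(\<tau>, \<xi>) \<in> ?S" for \<tau> \<xi>
  proof -
    show c: "\<bar>\<tau> - norm \<xi>\<bar> \<le> 1/8" "\<bar>\<xi> $ 1\<bar> \<le> l / 20" "\<bar>\<xi> $ 2\<bar> \<le> l / 20" "\<bar>\<xi> $ 3 - l\<bar> \<le> l / 20"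
      using that by (simp_all add: slab_def forall_3)
    have x: "19 / 20 * l \<le> \<xi> $ 3" "\<bar>\<xi> $ 3\<bar> \<le> 21 / 20 * l" using c(4) l by linarith+
    have n: "19 / 20 * l \<le> norm \<xi>" "norm \<xi> \<le> 23 / 20 * l"
      using component_le_norm_cart[of \<xi> 3] norm3_le[of \<xi>] c(2,3) x by linarith+
    then show "l / 2 \<le> norm \<xi>" "norm \<xi> \<le> 23 / 20 * l" using l by linarith+
    show "\<bar>\<tau> - l\<bar> \<le> l / 4" using c(1) n l by linarith
  qed
  have angle: "\<forall>(\<xi>1 :: real^3) (\<xi>2 :: real^3). (\<forall>j. \<bar>\<xi>1 $ j - vector [0, 0, 2 * l] $ j\<bar> \<le> vector [l / 5, l / 5, l / 5] $ j) \<longrightarrow>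
      (\<forall>j. \<bar>\<xi>2 $ j - vector [0, 0, l] $ j\<bar> \<le> vector [l / 10, l / 10, l / 10] $ j) \<longrightarrow>
      1/2 \<le> 1 * (\<xi>1 $ 3 / norm \<xi>1) - (-1) * (\<xi>2 $ 3 / norm \<xi>2)"
  proof (intro allI impI)
    fix \<xi>1 \<xi>2 :: "real^3"
    assume that: "\<forall>j. \<bar>\<xi>1 $ j - vector [0, 0, 2 * l] $ j\<bar> \<le> vector [l / 5, l / 5, l / 5] $ j"
      "\<forall>j. \<bar>\<xi>2 $ j - vector [0, 0, l] $ j\<bar> \<le> vector [l / 10, l / 10, l / 10] $ j"
    from that have c: "\<bar>\<xi>1 $ 3 - 2 * l\<bar> \<le> l / 5" "\<bar>\<xi>2 $ 1\<bar> \<le> l / 10" "\<bar>\<xi>2 $ 2\<bar> \<le> l / 10" "\<bar>\<xi>2 $ 3 - l\<bar> \<le> l / 10"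
      by (simp_all add: forall_3)
    have x: "9 / 10 * l \<le> \<xi>2 $ 3" "\<bar>\<xi>2 $ 3\<bar> = \<xi>2 $ 3" "0 \<le> \<xi>1 $ 3" using c(1,4) l by linarith+
    have "norm \<xi>2 \<le> 2 * \<xi>2 $ 3" "0 < norm \<xi>2"
      using component_le_norm_cart[of \<xi>2 3] norm3_le[of \<xi>2] c(2,3) x l by linarith+
    then have "1/2 \<le> \<xi>2 $ 3 / norm \<xi>2" "0 \<le> \<xi>1 $ 3 / norm \<xi>1"
      using x by (auto simp: field_simps)
    then show "1/2 \<le> 1 * (\<xi>1 $ 3 / norm \<xi>1) - (-1) * (\<xi>2 $ 3 / norm \<xi>2)" by linarith
  qed
  have out: "\<forall>\<tau> \<xi>. (\<tau>, \<xi>) \<in> ?S \<longrightarrow> comparable (jbr \<xi>) l \<and> comparable (jbr (\<bar>\<tau>\<bar> - norm \<xi>)) 1"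
  proof (intro allI impI)
    fix \<tau> \<xi> assume "(\<tau>, \<xi>) \<in> ?S"
    note c = S[OF this]
    have "\<bar>\<tau>\<bar> = \<tau>" using c(2) l by linarith
    then have "\<bar>\<bar>\<tau>\<bar> - norm \<xi>\<bar> \<le> 1000" using c(1) by linarith
    with c(6,7) l show "comparable (jbr \<xi>) l \<and> comparable (jbr (\<bar>\<tau>\<bar> - norm \<xi>)) 1"
      by (intro conjI comparable_jbr_1 comparable_jbr) auto
  qed
  let ?inF = "\<lambda>\<tau> \<xi>::real^3. \<bar>0::real\<bar> \<le> 1/2 \<and> \<bar>\<tau> - 2 * l\<bar> \<le> l / 2 \<and> (\<forall>j. \<bar>\<xi> $ j - vector [0, 0, 2 * l] $ j\<bar> \<le> vector [l / 5, l / 5, l / 5] $ j / 2)"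
  have inF: "\<forall>\<tau>0 \<xi>0 \<tau>2 \<xi>2. (\<tau>0, \<xi>0) \<in> ?S \<longrightarrow> (\<tau>2, \<xi>2) \<in> ?S \<longrightarrow> ?inF (\<tau>0 + \<tau>2) (\<xi>0 + \<xi>2)"
  proof (intro allI impI)
    fix \<tau>0 \<xi>0 \<tau>2 \<xi>2 assume "(\<tau>0, \<xi>0) \<in> ?S" "(\<tau>2, \<xi>2) \<in> ?S"
    note c = S[OF this(1)] and d = S[OF this(2)]
    have "\<bar>\<tau>0 + \<tau>2 - 2 * l\<bar> \<le> l / 2" using c(2) d(2) by linarith
    moreover have "\<bar>\<xi>0 $ 1 + \<xi>2 $ 1\<bar> \<le> l / 10" using c(3) d(3) by linarith
    moreover have "\<bar>\<xi>0 $ 2 + \<xi>2 $ 2\<bar> \<le> l / 10" using c(4) d(4) by linarith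
    moreover have "\<bar>\<xi>0 $ 3 + \<xi>2 $ 3 - 2 * l\<bar> \<le> l / 10" using c(5) d(5) by linarith
    ultimately show "?inF (\<tau>0 + \<tau>2) (\<xi>0 + \<xi>2)" by (simp add: forall_3)
  qed
  have inG: "\<forall>\<tau>2 \<xi>2. (\<tau>2, \<xi>2) \<in> ?S \<longrightarrow>
      \<bar>q (\<tau>2, \<xi>2)\<bar> \<le> 1/2 \<and> \<bar>\<tau>2 - l\<bar> \<le> l / 2 / 2 \<and> (\<forall>j. \<bar>\<xi>2 $ j - vector [0, 0, l] $ j\<bar> \<le> vector [l / 10, l / 10, l / 10] $ j / 2)"
  proof (intro allI impI)
    fix \<tau> \<xi> assume "(\<tau>, \<xi>) \<in> ?S"
    note c = S[OF this]
    have \<tau>: "0 \<le> \<tau>" using c(2) l by linarith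
    have "\<bar>\<tau> - norm \<xi>\<bar> * (\<tau> + norm \<xi>) \<le> 1/8 * (3 * l)"
      using c \<tau> l by (intro mult_mono) linarith+
    then have "\<bar>q (\<tau>, \<xi>)\<bar> \<le> 1/2"
      using q_eq[OF \<tau>, of \<xi>] l by (simp add: pos_divide_le_eq)
    with c show "\<bar>q (\<tau>, \<xi>)\<bar> \<le> 1/2 \<and> \<bar>\<tau> - l\<bar> \<le> l / 2 / 2 \<and> (\<forall>j. \<bar>\<xi> $ j - vector [0, 0, l] $ j\<bar> \<le> vector [l / 10, l / 10, l / 10] $ j / 2)"
      by (simp add: forall_3)
  qed
  show ?thesis
    by (rule packet_configI[OF F G _ _ _ _ _ _ _ _ _ _ _ angle inF inG out])
       (use l in \<open>simp_all add: forall_3 prod_3 continuous_on_norm_id power4_eq_xxxx power3_eq_cube\<close>)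
qed

text \<open>The product of \<open>norm \<xi> - \<xi> $ 1\<close> and
  \<open>norm \<xi> + \<xi> $ 1\<close> is the squared transversal part. So for
  \<open>\<xi> $ 1\<close> of order \<open>L\<close> and transversal size \<open>sqrt L\<close> the
  cone stays within bounded distance of its tangent plane, which dictates the proportions of the
  planks.\<close>

lemma norm_minus_first_component:
  fixes \<xi> :: "real^3"
  assumes L: "0 < L" "L \<le> \<xi> $ 1" and c: "(\<xi> $ 2)\<^sup>2 + (\<xi> $ 3)\<^sup>2 \<le> c * L"
  shows "0 \<le> norm \<xi> - \<xi> $ 1" "norm \<xi> - \<xi> $ 1 \<le> c"
proof -
  show nn: "0 \<le> norm \<xi> - \<xi> $ 1"
    using component_le_norm_cart[of \<xi> 1] by linarith
  have "(norm \<xi> - \<xi> $ 1) * L \<le> (norm \<xi> - \<xi> $ 1) * (norm \<xi> + \<xi> $ 1)"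
    using nn L by (intro mult_left_mono) auto
  also have "\<dots> = (norm \<xi>)\<^sup>2 - (\<xi> $ 1)\<^sup>2"
    by (simp add: power2_eq_square algebra_simps)
  also have "\<dots> \<le> c * L"
    using c unfolding norm3_power2 by simp
  finally show "norm \<xi> - \<xi> $ 1 \<le> c"
    using L by simp
qed

text \<open>With equal signs all three planks lie along the plane
  \<open>\<tau> = - \<xi> $ 1\<close>, and addition keeps them there. The parameter \<open>M\<close>
  is the square root of the frequency scale, and each plank has volume of order
  \<open>M\<^sup>2 * M * M * 1\<close>.\<close>

lemma plank_config:
  assumes M: "M \<ge> (100::real)"
  shows "packet_config 1 1 (M\<^sup>2) 1 (M\<^sup>2) 1 (M\<^sup>2) 1 (1 / M) (M ^ 4) (M ^ 4)"
proof -
  define L where "L = M\<^sup>2"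
  have LM: "L = M * M" by (simp add: L_def power2_eq_square)
  have L: "100 * M \<le> L" "10000 \<le> L" "0 < L"
  proof -
    show 1: "100 * M \<le> L" unfolding LM using M by (intro mult_right_mono) auto
    then show "10000 \<le> L" "0 < L" using M by linarith+
  qed
  have sq: "x\<^sup>2 \<le> k\<^sup>2 * L" if "\<bar>x\<bar> \<le> k * M" for x k
    using power_mono[OF that abs_ge_zero, of 2] by (simp add: L_def power_mult_distrib)
  \<comment> \<open>Two slabs of half-thickness 1/2 add up to 1, hence the division by 2. The
    \<open>- 0\<close> fits the pattern of \<open>smooth_alg_affine\<close>. The offset
    \<open>10 * M\<close> in the third component separates the directions of the two inputs.\<close>
  have F: "packet_at 1 (\<lambda>\<zeta>. (fst \<zeta> + snd \<zeta> $ 1 - 0) / 2) (- 2 * L) (2 * L) (vector [2 * L, 0, 10 * M]) (vector [L / 5, 2 * M, 2 * M])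
      (\<lambda>\<xi>. - \<xi> $ 1) 2 L 1"
  proof -
    have "1 \<le> norm \<xi> \<and> comparable (jbr \<xi>) L \<and> comparable (jbr (\<tau> + norm \<xi>)) 1"
      if "\<bar>\<tau> + \<xi> $ 1\<bar> \<le> 2" "\<bar>\<xi> $ 1 - 2 * L\<bar> \<le> L / 5" "\<bar>\<xi> $ 2\<bar> \<le> 2 * M" "\<bar>\<xi> $ 3 - 10 * M\<bar> \<le> 2 * M" for \<tau> and \<xi> :: "real^3"
    proof -
      have x: "L \<le> \<xi> $ 1" "\<xi> $ 1 \<le> 3 * L" using that(2) L by linarith+
      have "(\<xi> $ 2)\<^sup>2 \<le> 2\<^sup>2 * L" using that(3) by (rule sq)
      moreover have "\<bar>\<xi> $ 3\<bar> \<le> 12 * M" using that(4) M by linarith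
      then have "(\<xi> $ 3)\<^sup>2 \<le> 12\<^sup>2 * L" by (rule sq)
      ultimately have "(\<xi> $ 2)\<^sup>2 + (\<xi> $ 3)\<^sup>2 \<le> 148 * L" by simp
      note n = norm_minus_first_component[OF L(3) x(1) this]
      have "\<bar>\<tau> + norm \<xi>\<bar> \<le> 1000" using n that(1) by linarith
      moreover have "1 \<le> norm \<xi>" "L \<le> 1000 * norm \<xi>" "norm \<xi> \<le> 1000 * L"
        using n x L by linarith+
      ultimately show ?thesis
        using L by (intro conjI comparable_jbr comparable_jbr_1) auto
    qed
    moreover have "(\<lambda>\<zeta>::spacetime. (fst \<zeta> + snd \<zeta> $ 1 - 0) / 2) \<in> smooth_alg"
      by (intro smooth_alg_affine smooth_alg_add smooth_alg_fst smooth_alg_snd_nth)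
    moreover have "continuous_on UNIV (\<lambda>\<xi>::real^3. - \<xi> $ 1)"
      by (intro continuous_intros)
    ultimately show ?thesis
      unfolding packet_at_def using L M by (simp add: forall_3)
  qed
  have G: "packet_at 1 (\<lambda>\<zeta>. fst \<zeta> + snd \<zeta> $ 1) (- L) L (vector [L, 0, 0]) (vector [L / 10, M, M]) (\<lambda>\<xi>. - \<xi> $ 1) 1 L 1"
  proof -
    have "1 \<le> norm \<xi> \<and> comparable (jbr \<xi>) L \<and> comparable (jbr (\<tau> + norm \<xi>)) 1"
      if "\<bar>\<tau> + \<xi> $ 1\<bar> \<le> 1" "\<bar>\<xi> $ 1 - L\<bar> \<le> L / 10" "\<bar>\<xi> $ 2\<bar> \<le> M" "\<bar>\<xi> $ 3\<bar> \<le> M" for \<tau> and \<xi> :: "real^3"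
    proof -
      have x: "L / 2 \<le> \<xi> $ 1" "\<xi> $ 1 \<le> 2 * L" using that(2) L by linarith+
      have "(\<xi> $ 2)\<^sup>2 \<le> 1\<^sup>2 * L" "(\<xi> $ 3)\<^sup>2 \<le> 1\<^sup>2 * L" using that(3,4) by (intro sq; simp)+
      then have "(\<xi> $ 2)\<^sup>2 + (\<xi> $ 3)\<^sup>2 \<le> 4 * (L / 2)" by simp
      note n = norm_minus_first_component[OF _ x(1) this]
      have "\<bar>\<tau> + norm \<xi>\<bar> \<le> 1000" using n that(1) L by linarith
      moreover have "1 \<le> norm \<xi>" "L \<le> 1000 * norm \<xi>" "norm \<xi> \<le> 1000 * L"
        using n x L by linarith+
      ultimately show ?thesis
        using L by (intro conjI comparable_jbr comparable_jbr_1) auto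
    qed
    moreover have "(\<lambda>\<zeta>::spacetime. fst \<zeta> + snd \<zeta> $ 1) \<in> smooth_alg"
      by (intro smooth_alg_add smooth_alg_fst smooth_alg_snd_nth)
    moreover have "continuous_on UNIV (\<lambda>\<xi>::real^3. - \<xi> $ 1)"
      by (intro continuous_intros)
    ultimately show ?thesis
      unfolding packet_at_def using L M by (simp add: forall_3)
  qed
  let ?B = "slab (\<lambda>\<xi>. - \<xi> $ 1) (1/2) (vector [L, 0, 0]) (vector [L / 20, M / 2, M / 2])"
  let ?C = "slab (\<lambda>\<xi>. - \<xi> $ 1) (1/2) (vector [L, 0, 10 * M]) (vector [L / 20, M / 2, M / 2])"
  have B: "\<bar>\<tau> + \<xi> $ 1\<bar> \<le> 1/2" "\<bar>\<xi> $ 1 - L\<bar> \<le> L / 20" "\<bar>\<xi> $ 2\<bar> \<le> M / 2" "\<bar>\<xi> $ 3\<bar> \<le> M / 2" if "(\<tau>, \<xi>) \<in> ?B" for \<tau> \<xi>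
    using that by (simp_all add: slab_def forall_3)
  have C: "\<bar>\<tau> + \<xi> $ 1\<bar> \<le> 1/2" "\<bar>\<xi> $ 1 - L\<bar> \<le> L / 20" "\<bar>\<xi> $ 2\<bar> \<le> M / 2" "\<bar>\<xi> $ 3 - 10 * M\<bar> \<le> M / 2" if "(\<tau>, \<xi>) \<in> ?C" for \<tau> \<xi>
    using that by (simp_all add: slab_def forall_3)
  \<comment> \<open>The first direction component is at least \<open>8/3\<close> and the second at
    most \<open>10/9\<close>, in units of \<open>1 / M\<close>. The difference leaves more than one
    unit.\<close>
  have angle: "\<forall>(\<xi>1 :: real^3) (\<xi>2 :: real^3). (\<forall>j. \<bar>\<xi>1 $ j - vector [2 * L, 0, 10 * M] $ j\<bar> \<le> vector [L / 5, 2 * M, 2 * M] $ j) \<longrightarrow>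
      (\<forall>j. \<bar>\<xi>2 $ j - vector [L, 0, 0] $ j\<bar> \<le> vector [L / 10, M, M] $ j) \<longrightarrow>
      1 / M \<le> 1 * (\<xi>1 $ 3 / norm \<xi>1) - 1 * (\<xi>2 $ 3 / norm \<xi>2)"
  proof (intro allI impI)
    fix \<xi>1 \<xi>2 :: "real^3"
    assume that: "\<forall>j. \<bar>\<xi>1 $ j - vector [2 * L, 0, 10 * M] $ j\<bar> \<le> vector [L / 5, 2 * M, 2 * M] $ j"
      "\<forall>j. \<bar>\<xi>2 $ j - vector [L, 0, 0] $ j\<bar> \<le> vector [L / 10, M, M] $ j"
    from that have c: "\<bar>\<xi>1 $ 1 - 2 * L\<bar> \<le> L / 5" "\<bar>\<xi>1 $ 2\<bar> \<le> 2 * M" "\<bar>\<xi>1 $ 3 - 10 * M\<bar> \<le> 2 * M"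
      "\<bar>\<xi>2 $ 1 - L\<bar> \<le> L / 10" "\<bar>\<xi>2 $ 3\<bar> \<le> M"
      by (simp_all add: forall_3)
    have x: "L \<le> \<bar>\<xi>1 $ 1\<bar>" "\<bar>\<xi>1 $ 1\<bar> \<le> 11 / 5 * L" "8 * M \<le> \<xi>1 $ 3" "\<bar>\<xi>1 $ 3\<bar> \<le> 12 * M" "9 / 10 * L \<le> \<bar>\<xi>2 $ 1\<bar>"
      using c(1) L apply linarith
      using c(1) L apply linarith
      using c(3) M apply linarith
      using c(3) M apply linarith
      using c(4) L apply linarith
      done
    have n1: "0 < norm \<xi>1" "norm \<xi>1 \<le> 3 * L"
      using component_le_norm_cart[of \<xi>1 1] norm3_le[of \<xi>1] x(1,2,4) c(2) L by linarith+
    have n2: "9 / 10 * L \<le> norm \<xi>2"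
      using component_le_norm_cart[of \<xi>2 1] x(5) by linarith
    have "8 * M / (3 * L) \<le> \<xi>1 $ 3 / norm \<xi>1"
      using n1 x(3) M by (intro frac_le) auto
    moreover have "\<xi>2 $ 3 / norm \<xi>2 \<le> M / (9 / 10 * L)"
      using n2 c(5) M L by (intro frac_le) auto
    moreover have "8 * M / (3 * L) = 8 / 3 * (1 / M)" "M / (9 / 10 * L) = 10 / 9 * (1 / M)"
      unfolding LM using M by (simp_all add: field_simps)
    moreover have "1 / M > 0" using M by simp
    moreover have "t \<le> 1 * x - 1 * y" if "a \<le> x" "y \<le> b" "a = 8 / 3 * t" "b = 10 / 9 * t" "t > 0" for a b t x y :: real
      using that by linarith
    ultimately show "1 / M \<le> 1 * (\<xi>1 $ 3 / norm \<xi>1) - 1 * (\<xi>2 $ 3 / norm \<xi>2)"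
      by blast
  qed
  have out: "\<forall>\<tau> \<xi>. (\<tau>, \<xi>) \<in> ?C \<longrightarrow> comparable (jbr \<xi>) L \<and> comparable (jbr (\<bar>\<tau>\<bar> - norm \<xi>)) 1"
  proof (intro allI impI)
    fix \<tau> \<xi> assume "(\<tau>, \<xi>) \<in> ?C"
    note c = C[OF this]
    have x: "L / 2 \<le> \<xi> $ 1" "\<xi> $ 1 \<le> 2 * L" using c(2) L by linarith+
    have "\<bar>\<xi> $ 2\<bar> \<le> 1 * M" "\<bar>\<xi> $ 3\<bar> \<le> 11 * M"
      using c(3) M apply linarith
      using c(4) M apply linarith
      done
    from this[THEN sq] have "(\<xi> $ 2)\<^sup>2 + (\<xi> $ 3)\<^sup>2 \<le> 244 * (L / 2)" by simp
    note n = norm_minus_first_component[OF _ x(1) this]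
    have "\<bar>\<tau>\<bar> = - \<tau>" using c(1) x(1) L by linarith
    then have "\<bar>\<bar>\<tau>\<bar> - norm \<xi>\<bar> \<le> 1000" using n c(1) L by linarith
    moreover have "L \<le> 1000 * norm \<xi>" "norm \<xi> \<le> 1000 * L"
      using n x L by linarith+
    ultimately show "comparable (jbr \<xi>) L \<and> comparable (jbr (\<bar>\<tau>\<bar> - norm \<xi>)) 1"
      using L by (intro conjI comparable_jbr_1 comparable_jbr) auto
  qed
  let ?inF = "\<lambda>\<tau> \<xi>::real^3. \<bar>(fst (\<tau>, \<xi>) + snd (\<tau>, \<xi>) $ 1 - 0) / 2\<bar> \<le> 1/2 \<and> \<bar>\<tau> - (- 2 * L)\<bar> \<le> 2 * L / 2 \<and>
      (\<forall>j. \<bar>\<xi> $ j - vector [2 * L, 0, 10 * M] $ j\<bar> \<le> vector [L / 5, 2 * M, 2 * M] $ j / 2)"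
  have inF: "\<forall>\<tau>0 \<xi>0 \<tau>2 \<xi>2. (\<tau>0, \<xi>0) \<in> ?C \<longrightarrow> (\<tau>2, \<xi>2) \<in> ?B \<longrightarrow> ?inF (\<tau>0 + \<tau>2) (\<xi>0 + \<xi>2)"
  proof (intro allI impI)
    fix \<tau>0 \<xi>0 \<tau>2 \<xi>2 assume "(\<tau>0, \<xi>0) \<in> ?C" "(\<tau>2, \<xi>2) \<in> ?B"
    note c = C[OF this(1)] and d = B[OF this(2)]
    have "\<bar>\<tau>0 + \<tau>2 + (\<xi>0 $ 1 + \<xi>2 $ 1)\<bar> \<le> 1" using c(1) d(1) by linarith
    moreover have 1: "\<bar>\<xi>0 $ 1 + \<xi>2 $ 1 - 2 * L\<bar> \<le> L / 10" using c(2) d(2) by linarith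
    moreover have "\<bar>\<tau>0 + \<tau>2 + 2 * L\<bar> \<le> L" using calculation L by linarith
    moreover have "\<bar>\<xi>0 $ 2 + \<xi>2 $ 2\<bar> \<le> M" using c(3) d(3) by linarith
    moreover have "\<bar>\<xi>0 $ 3 + \<xi>2 $ 3 - 10 * M\<bar> \<le> M" using c(4) d(4) by linarith
    ultimately show "?inF (\<tau>0 + \<tau>2) (\<xi>0 + \<xi>2)" by (simp add: forall_3)
  qed
  have inG: "\<forall>\<tau>2 \<xi>2. (\<tau>2, \<xi>2) \<in> ?B \<longrightarrow>
      \<bar>fst (\<tau>2, \<xi>2) + snd (\<tau>2, \<xi>2) $ 1\<bar> \<le> 1/2 \<and> \<bar>\<tau>2 - (- L)\<bar> \<le> L / 2 \<and> (\<forall>j. \<bar>\<xi>2 $ j - vector [L, 0, 0] $ j\<bar> \<le> vector [L / 10, M, M] $ j / 2)"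
  proof (intro allI impI)
    fix \<tau> \<xi> assume "(\<tau>, \<xi>) \<in> ?B"
    note c = B[OF this]
    have "\<bar>\<tau> + L\<bar> \<le> L / 2" using c(1,2) L by linarith
    with c show "\<bar>fst (\<tau>, \<xi>) + snd (\<tau>, \<xi>) $ 1\<bar> \<le> 1/2 \<and> \<bar>\<tau> - (- L)\<bar> \<le> L / 2 \<and> (\<forall>j. \<bar>\<xi> $ j - vector [L, 0, 0] $ j\<bar> \<le> vector [L / 10, M, M] $ j / 2)"
      by (simp add: forall_3)
  qed
  have f: "continuous_on UNIV (\<lambda>\<xi>::real^3. - \<xi> $ 1)"
    by (intro continuous_intros)
  have "packet_config 1 1 L 1 L 1 L 1 (1 / M) (M ^ 4) (M ^ 4)"
    by (rule packet_configI[OF F G f _ _ f _ _ _ _ _ _ _ angle inF inG out])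
       (use L M in \<open>simp_all add: forall_3 prod_3 LM power4_eq_xxxx\<close>)
  then show ?thesis
    by (simp only: L_def)
qed

section \<open>Inequalities between exponents forced by the configurations\<close>

lemma dirac_estimate_low_high:
  assumes est: "dirac_estimate a b a1 b1 a2 b2"
  shows "a \<le> a2"
proof -
  obtain K where K: "\<And>X1 Y1 X2 Y2 X0 Y0 \<theta> V W. packet_config 1 (-1) X1 Y1 X2 Y2 X0 Y0 \<theta> V W \<Longrightarrow>
      X0 powr a * Y0 powr b * \<theta> * W \<le> K * ((X1 powr a1 * Y1 powr b1) * (X2 powr a2 * Y2 powr b2) * sqrt V)"
    using dirac_estimate_packets[OF est, of 1 "-1"] by (metis insertCI)
  show ?thesis
  proof (rule powr_growth_le)
    fix l :: real assume "l \<ge> 20"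
    from K[OF low_high_config[OF this]] show "l powr a \<le> (4 * K) * l powr a2"
      by simp
  qed
qed

lemma dirac_estimate_shell:
  assumes est: "dirac_estimate a b a1 b1 a2 b2"
  shows "1 + a \<le> a1 + b1 + a2"
proof -
  obtain K where K: "\<And>X1 Y1 X2 Y2 X0 Y0 \<theta> V W. packet_config 1 (-1) X1 Y1 X2 Y2 X0 Y0 \<theta> V W \<Longrightarrow>
      X0 powr a * Y0 powr b * \<theta> * W \<le> K * ((X1 powr a1 * Y1 powr b1) * (X2 powr a2 * Y2 powr b2) * sqrt V)"
    using dirac_estimate_packets[OF est, of 1 "-1"] by (metis insertCI)
  \<comment> \<open>The 3 is the exponent of \<open>W\<close>, and the 2 that of
    \<open>sqrt V\<close>.\<close>
  have "a + 3 \<le> a1 + b1 + a2 + 2"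
  proof (rule powr_growth_le)
    fix l :: real assume l: "l \<ge> 100"
    have "l powr a * l ^ 3 \<le> (2 * K) * (l powr a1 * l powr b1 * l powr a2 * sqrt (l ^ 4))"
      using K[OF shell_config[OF l]] by (simp add: mult_ac)
    moreover have "sqrt (l ^ 4) = l powr 2" "l ^ 3 = l powr 3"
      using l by (auto simp: powr_numeral intro!: real_sqrt_unique)
    ultimately show "l powr (a + 3) \<le> (2 * K) * l powr (a1 + b1 + a2 + 2)"
      by (simp add: powr_add mult_ac)
  qed
  then show ?thesis by simp
qed

lemma dirac_estimate_plank:
  assumes est: "dirac_estimate a b a1 b1 a2 b2"
  shows "1/2 + a \<le> a1 + a2"
proof -
  obtain K where K: "\<And>X1 Y1 X2 Y2 X0 Y0 \<theta> V W. packet_config 1 1 X1 Y1 X2 Y2 X0 Y0 \<theta> V W \<Longrightarrow>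
      X0 powr a * Y0 powr b * \<theta> * W \<le> K * ((X1 powr a1 * Y1 powr b1) * (X2 powr a2 * Y2 powr b2) * sqrt V)"
    using dirac_estimate_packets[OF est, of 1 1] by (metis insertCI)
  \<comment> \<open>Exponents of \<open>M\<close>, the square root of the scale:
    \<open>\<theta> = 1 / M\<close> lowers \<open>W\<close> from 4 to 3, and \<open>sqrt V\<close>
    contributes 2.\<close>
  have "2 * a + 3 \<le> 2 * a1 + 2 * a2 + 2"
  proof (rule powr_growth_le)
    fix M :: real assume M: "M \<ge> 100"
    have "M\<^sup>2 powr a * (M ^ 4 / M) \<le> K * (M\<^sup>2 powr a1 * M\<^sup>2 powr a2 * sqrt (M ^ 4))"
      using K[OF plank_config[OF M]] by simp
    moreover have "sqrt (M ^ 4) = M powr 2" "M ^ 4 / M = M powr 3" "M\<^sup>2 powr p = M powr (2 * p)" for p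
    proof -
      show "sqrt (M ^ 4) = M powr 2" "M ^ 4 / M = M powr 3"
        using M by (auto simp: powr_numeral power_eq_if intro!: real_sqrt_unique)
      have "M\<^sup>2 = M powr 2" using M by (simp add: powr_numeral)
      then show "M\<^sup>2 powr p = M powr (2 * p)" by (simp add: powr_powr)
    qed
    ultimately show "M powr (2 * a + 3) \<le> K * M powr (2 * a1 + 2 * a2 + 2)"
      by (simp only: powr_add mult.assoc)
  qed
  then show ?thesis by simp
qed

theorem theorem8:
  fixes s r :: real
  assumes "s \<le> 0 \<or> r \<le> 1/2 \<or> r < s \<or> r > 1 + s \<or> r > 1/2 + 2 * s"
  shows "\<forall>\<sigma> \<rho> \<epsilon> :: real. \<epsilon> > 0 \<longrightarrow>
    \<not> (dirac_estimate (- r) (- \<rho>) s \<sigma> (- s) (1 - \<sigma> - \<epsilon>) \<and>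
       dirac_estimate (r - 1) (\<rho> - 1 + \<epsilon>) s \<sigma> s \<sigma>)"
proof (intro allI impI notI, elim conjE)
  fix \<sigma> \<rho> \<epsilon> :: real
  assume \<epsilon>: "\<epsilon> > 0"
    and i: "dirac_estimate (- r) (- \<rho>) s \<sigma> (- s) (1 - \<sigma> - \<epsilon>)"
    and ii: "dirac_estimate (r - 1) (\<rho> - 1 + \<epsilon>) s \<sigma> s \<sigma>"
  \<comment> \<open>The frequency exponents \<open>s\<close> and \<open>- s\<close> cancel in both
    orders of the inputs, so only the modulation exponents remain and \<open>\<sigma>\<close> is
    squeezed between \<open>1 - r\<close> and \<open>r - \<epsilon>\<close>.\<close>
  have "1 - r \<le> \<sigma>" "1 - r \<le> 1 - \<sigma> - \<epsilon>"
    using dirac_estimate_shell[OF i] dirac_estimate_shell[OF dirac_estimate_swap[OF i]] by simp_all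
  then have "r > 1/2" using \<epsilon> by linarith
  moreover have "r \<ge> s" "r \<le> 1 + s"
    using dirac_estimate_low_high[OF i] dirac_estimate_low_high[OF ii] by simp_all
  moreover have "r \<le> 1/2 + 2 * s"
    using dirac_estimate_plank[OF ii] by simp
  \<comment> \<open>The case \<open>s \<le> 0\<close> has no example of its own: it is excluded by
    \<open>r > 1/2\<close> together with \<open>r \<le> 1/2 + 2 * s\<close>.\<close>
  ultimately show False
    using assms by linarith
qed

end
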